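(* Let $M$ be a closed connected manifold, let $\sigma$ be a closed two-form on $M$ and let $H:T^*M\to\mathbb R$ be a Tonelli Hamiltonian. For every $k\in[\min H,e_0(H))$ the energy sublevel set $\{H\le k\}$ is displaceable in $(T^*M,\omega_\sigma)$.
   Context: $\pi:T^*M\to M$ is the projection and $\omega_\sigma:=dp\wedge dq+\pi^*\sigma$ is the twisted symplectic form on $T^*M$. A Tonelli Hamiltonian is a smooth function $H:T^*M\to\mathbb R$ which is fibrewise uniformly convex (its second derivative along the fibres is positive definite everywhere) and grows superlinearly in the fibres. We set $e_0(H):=\max_{q\in M}\min_{p\in T_q^*M}H(q,p)$. For a symplectic manifold $(W,\omega)$, a set $U\subset W$ is displaceable in $(W,\omega)$ if there is a compactly supported Hamiltonian diffeomorphism $\varphi:W\to W$ (the time-$1$ map of a time-dependent, compactly supported Hamiltonian flow) such that $\varphi(U)\cap U=\emptyset$. *)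

theory Defs
  imports "HOL-Analysis.Analysis"
begin

section \<open>Smooth functions\<close>

text \<open>Intended for open sets in finite-dimensional spaces.\<close>

fun Ck_on :: "nat \<Rightarrow> 'e::real_normed_vector set \<Rightarrow> ('e \<Rightarrow> 'f::real_normed_vector) \<Rightarrow> bool" where
  "Ck_on 0 S f \<longleftrightarrow> continuous_on S f"
| "Ck_on (Suc k) S f \<longleftrightarrow>
     (\<forall>x\<in>S. f differentiable (at x)) \<and> (\<forall>v. Ck_on k S (\<lambda>x. frechet_derivative f (at x) v))"

definition smooth_on :: "'e::real_normed_vector set \<Rightarrow> ('e \<Rightarrow> 'f::real_normed_vector) \<Rightarrow> bool" where
  "smooth_on S f \<longleftrightarrow> (\<forall>k. Ck_on k S f)"

lemma smooth_on_imp_differentiable: "smooth_on S f \<Longrightarrow> x \<in> S \<Longrightarrow> f differentiable (at x)"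
  unfolding smooth_on_def by (metis Ck_on.simps(2))

section \<open>Smooth manifolds\<close>

text \<open>An atlas is an indexed family of charts; only the values of \<open>cmap A i\<close> on \<open>cdom A i\<close>,
  for \<open>i\<close> in \<open>charts A\<close>, are meaningful. The underlying set of the manifold is the union of the
  chart domains, and its topology is induced by the charts. Chart images are open subsets of
  the Euclidean space \<open>'e\<close>, so there is no boundary and the dimension is \<open>DIM('e)\<close>.\<close>

record ('i, 'a, 'e) atlas =
  charts :: "'i set"
  cdom :: "'i \<Rightarrow> 'a set"
  cmap :: "'i \<Rightarrow> 'a \<Rightarrow> 'e"

definition points :: "('i, 'a, 'e) atlas \<Rightarrow> 'a set" where
  "points A = (\<Union>i\<in>charts A. cdom A i)"

definition cimage :: "('i, 'a, 'e) atlas \<Rightarrow> 'i \<Rightarrow> 'e set" where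
  "cimage A i = cmap A i ` cdom A i"

definition cinv :: "('i, 'a, 'e) atlas \<Rightarrow> 'i \<Rightarrow> 'e \<Rightarrow> 'a" where
  "cinv A i = the_inv_into (cdom A i) (cmap A i)"

definition transition :: "('i, 'a, 'e) atlas \<Rightarrow> 'i \<Rightarrow> 'i \<Rightarrow> 'e \<Rightarrow> 'e" where
  "transition A i j = cmap A j \<circ> cinv A i"

definition manifold_topology :: "('i, 'a, 'e::euclidean_space) atlas \<Rightarrow> 'a topology" where
  "manifold_topology A =
     topology (\<lambda>S. S \<subseteq> points A \<and> (\<forall>i\<in>charts A. open (cmap A i ` (S \<inter> cdom A i))))"

definition smooth_atlas :: "('i, 'a, 'e::euclidean_space) atlas \<Rightarrow> bool" where
  "smooth_atlas A \<longleftrightarrow>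
     (\<forall>i\<in>charts A. inj_on (cmap A i) (cdom A i)) \<and>
     (\<forall>i\<in>charts A. \<forall>j\<in>charts A.
        open (cmap A i ` (cdom A i \<inter> cdom A j)) \<and>
        smooth_on (cmap A i ` (cdom A i \<inter> cdom A j)) (transition A i j))"

definition smooth_manifold :: "('i, 'a, 'e::euclidean_space) atlas \<Rightarrow> bool" where
  "smooth_manifold A \<longleftrightarrow>
     smooth_atlas A \<and> Hausdorff_space (manifold_topology A) \<and> second_countable (manifold_topology A)"

definition closed_connected_manifold :: "('i, 'a, 'e::euclidean_space) atlas \<Rightarrow> bool" where
  "closed_connected_manifold A \<longleftrightarrow>
     smooth_manifold A \<and> compact_space (manifold_topology A) \<and> connected_space (manifold_topology A)"

definition smooth_function :: "('i, 'a, 'e::euclidean_space) atlas \<Rightarrow> ('a \<Rightarrow> real) \<Rightarrow> bool" where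
  "smooth_function A f \<longleftrightarrow> (\<forall>i\<in>charts A. smooth_on (cimage A i) (f \<circ> cinv A i))"

text \<open>The charts do induce a topology, so that the constant \<^const>\<open>topology\<close> is used meaningfully.\<close>

lemma openin_manifold_topology:
  assumes inj: "\<And>i. i \<in> charts A \<Longrightarrow> inj_on (cmap A i) (cdom A i)"
  shows "openin (manifold_topology A) S \<longleftrightarrow>
     S \<subseteq> points A \<and> (\<forall>i\<in>charts A. open (cmap A i ` (S \<inter> cdom A i)))"
proof -
  have *: "cmap A i ` (S \<inter> T \<inter> cdom A i) = cmap A i ` (S \<inter> cdom A i) \<inter> cmap A i ` (T \<inter> cdom A i)"
    if "i \<in> charts A" for i S T
    using inj[OF that] by (auto simp: inj_on_def)
  have **: "cmap A i ` (\<Union>K \<inter> cdom A i) = (\<Union>S\<in>K. cmap A i ` (S \<inter> cdom A i))" for i K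
    by auto
  have "istopology (\<lambda>S. S \<subseteq> points A \<and> (\<forall>i\<in>charts A. open (cmap A i ` (S \<inter> cdom A i))))"
    unfolding istopology_def by (auto simp: * ** intro!: open_Int open_UN)
  then show ?thesis
    by (simp add: manifold_topology_def topology_inverse')
qed

section \<open>Two-forms\<close>

text \<open>A two-form is given by its local expressions: \<open>\<sigma> i x u v\<close> is its value at the point with
  coordinates \<open>x\<close> in the chart \<open>i\<close>, on the tangent vectors with coordinates \<open>u\<close> and \<open>v\<close>.\<close>

type_synonym ('i, 'e) form2 = "'i \<Rightarrow> 'e \<Rightarrow> 'e \<Rightarrow> 'e \<Rightarrow> real"

definition two_form :: "('i, 'a, 'e::euclidean_space) atlas \<Rightarrow> ('i, 'e) form2 \<Rightarrow> bool" where
  "two_form A \<sigma> \<longleftrightarrow>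
     (\<forall>i\<in>charts A. \<forall>x\<in>cimage A i.
        (\<forall>u. linear (\<sigma> i x u)) \<and> (\<forall>u v. \<sigma> i x v u = - \<sigma> i x u v)) \<and>
     (\<forall>i\<in>charts A. \<forall>u v. smooth_on (cimage A i) (\<lambda>x. \<sigma> i x u v)) \<and>
     (\<forall>i\<in>charts A. \<forall>j\<in>charts A. \<forall>x\<in>cmap A i ` (cdom A i \<inter> cdom A j). \<forall>u v.
        \<sigma> i x u v = \<sigma> j (transition A i j x)
          (frechet_derivative (transition A i j) (at x) u)
          (frechet_derivative (transition A i j) (at x) v))"

text \<open>The exterior derivative, evaluated on constant coordinate vector fields.\<close>

definition ext_deriv :: "('i, 'e::euclidean_space) form2 \<Rightarrow> 'i \<Rightarrow> 'e \<Rightarrow> 'e \<Rightarrow> 'e \<Rightarrow> 'e \<Rightarrow> real" where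
  "ext_deriv \<sigma> i x u v w =
     frechet_derivative (\<lambda>y. \<sigma> i y v w) (at x) u
   - frechet_derivative (\<lambda>y. \<sigma> i y u w) (at x) v
   + frechet_derivative (\<lambda>y. \<sigma> i y u v) (at x) w"

definition closed_two_form :: "('i, 'a, 'e::euclidean_space) atlas \<Rightarrow> ('i, 'e) form2 \<Rightarrow> bool" where
  "closed_two_form A \<sigma> \<longleftrightarrow>
     two_form A \<sigma> \<and> (\<forall>i\<in>charts A. \<forall>x\<in>cimage A i. \<forall>u v w. ext_deriv \<sigma> i x u v w = 0)"

section \<open>The cotangent bundle\<close>

text \<open>A covector at \<open>q\<close> is the family of its coordinate expressions in all charts around \<open>q\<close>
  (and \<open>0\<close> in the other charts): \<open>p i\<close> is the vector of the coefficients of \<open>p\<close> with respect to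
  the coordinate differentials of the chart \<open>i\<close>, that is, \<open>p\<close> maps the tangent vector with
  coordinates \<open>v\<close> to \<open>p i \<bullet> v\<close>. The vector space structure on covectors is pointwise.\<close>

definition cotangent_space ::
    "('i, 'a, 'e::euclidean_space) atlas \<Rightarrow> 'a \<Rightarrow> ('i \<Rightarrow> 'e) set" where
  "cotangent_space A q =
     {p. (\<forall>i. \<not> (i \<in> charts A \<and> q \<in> cdom A i) \<longrightarrow> p i = 0) \<and>
         (\<forall>i\<in>charts A. \<forall>j\<in>charts A. q \<in> cdom A i \<inter> cdom A j \<longrightarrow>
            (\<forall>v. p i \<bullet> v = p j \<bullet> frechet_derivative (transition A i j) (at (cmap A i q)) v))}"

text \<open>The chart of the cotangent bundle induced by a chart of the base is \<open>(q, p)\<close>-coordinates.\<close>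

definition cotangent_bundle ::
    "('i, 'a, 'e::euclidean_space) atlas \<Rightarrow> ('i, 'a \<times> ('i \<Rightarrow> 'e), 'e \<times> 'e) atlas" where
  "cotangent_bundle A =
     \<lparr>charts = charts A,
      cdom = (\<lambda>i. {(q, p). q \<in> cdom A i \<and> p \<in> cotangent_space A q}),
      cmap = (\<lambda>i (q, p). (cmap A i q, p i))\<rparr>"

text \<open>The induced charts are injective with open image, and covectors have arbitrary coordinates.\<close>

lemma inj_on_cotangent_chart:
  assumes A: "smooth_atlas A" and i: "i \<in> charts (cotangent_bundle A)"
  shows "inj_on (cmap (cotangent_bundle A) i) (cdom (cotangent_bundle A) i)"
proof (rule inj_onI, clarsimp simp: cotangent_bundle_def)
  fix q p q' p'
  assume q: "q \<in> cdom A i" "q' \<in> cdom A i" "cmap A i q = cmap A i q'"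
    and p: "p \<in> cotangent_space A q" "p' \<in> cotangent_space A q'" and eq: "p i = p' i"
  have i': "i \<in> charts A" using i by (simp add: cotangent_bundle_def)
  with A q have [simp]: "q' = q" by (auto simp: smooth_atlas_def inj_on_def)
  have "p j = p' j" for j
  proof (cases "j \<in> charts A \<and> q \<in> cdom A j")
    case True
    have "r j \<bullet> v = r i \<bullet> frechet_derivative (transition A j i) (at (cmap A j q)) v"
      if "r \<in> cotangent_space A q" for r v
      using that q i' True unfolding cotangent_space_def by blast
    then have "\<forall>v. p j \<bullet> v = p' j \<bullet> v"
      using p eq by (simp only: \<open>q' = q\<close> simp_thms)
    then show ?thesis by (simp only: vector_eq_rdot)
  next
    case False
    then show ?thesis using p by (auto simp: cotangent_space_def)
  qed
  then show "q = q' \<and> p = p'" by auto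
qed

lemma cimage_cotangent_chart:
  fixes A :: "('i, 'a, 'e::euclidean_space) atlas"
  assumes A: "smooth_atlas A" and i: "i \<in> charts A"
  shows "cimage (cotangent_bundle A) i = cimage A i \<times> UNIV"
proof -
  have "\<exists>p\<in>cotangent_space A q. p i = y" if q: "q \<in> cdom A i" for q y
  proof -
    define D where "D j k = frechet_derivative (transition A j k) (at (cmap A j q))" for j k
    have der: "(transition A j k has_derivative D j k) (at (cmap A j q))"
      if "j \<in> charts A" "k \<in> charts A" "q \<in> cdom A j" "q \<in> cdom A k" for j k
    proof -
      have "transition A j k differentiable (at (cmap A j q))"
        using A that by (intro smooth_on_imp_differentiable[of "cmap A j ` (cdom A j \<inter> cdom A k)"])
          (auto simp: smooth_atlas_def)
      then show ?thesis unfolding D_def by (simp add: frechet_derivative_works)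
    qed
    have inv: "cinv A j (cmap A j w) = w" if "j \<in> charts A" "w \<in> cdom A j" for j w
      using A that unfolding cinv_def smooth_atlas_def by (intro the_inv_into_f_f) auto
    have chain: "D k l (D j k v) = D j l v"
      if c: "j \<in> charts A" "k \<in> charts A" "l \<in> charts A"
        "q \<in> cdom A j" "q \<in> cdom A k" "q \<in> cdom A l" for j k l v
    proof -
      have t: "transition A j k (cmap A j q) = cmap A k q"
        using c by (simp add: transition_def inv)
      have 1: "(transition A k l \<circ> transition A j k has_derivative D k l \<circ> D j k) (at (cmap A j q))"
        using der[OF c(1,2,4,5)] der[OF c(2,3,5,6)] t by (metis diff_chain_at)
      have op: "open (cmap A j ` (cdom A j \<inter> cdom A k))" using A c by (auto simp: smooth_atlas_def)
      have "(transition A j l has_derivative D k l \<circ> D j k) (at (cmap A j q))"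
        by (rule has_derivative_transform_within_open[OF 1 op])
           (use c in \<open>auto simp: transition_def inv\<close>)
      with der[OF c(1,3,4,6)] have "D k l \<circ> D j k = D j l" by (metis has_derivative_unique)
      then show ?thesis by (metis comp_apply)
    qed
    define p where "p j = (if j \<in> charts A \<and> q \<in> cdom A j then adjoint (D j i) y else 0)" for j
    have pv: "p j \<bullet> v = y \<bullet> D j i v" if "j \<in> charts A" "q \<in> cdom A j" for j v
      using that adjoint_works[OF has_derivative_linear[OF der[OF that(1) i that(2) q]], of v y]
      by (simp add: p_def inner_commute)
    have "p \<in> cotangent_space A q"
      unfolding cotangent_space_def D_def[symmetric]
      using chain pv i q by (auto simp: p_def)
    moreover have "p i = y"
    proof -
      have op: "open (cmap A i ` (cdom A i \<inter> cdom A i))" using A i unfolding smooth_atlas_def by blast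
      have "(transition A i i has_derivative (\<lambda>v. v)) (at (cmap A i q))"
        by (rule has_derivative_transform_within_open[OF has_derivative_ident op])
           (use i q in \<open>auto simp: transition_def inv\<close>)
      with der[OF i i q q] have "D i i = (\<lambda>v. v)" by (metis has_derivative_unique)
      then have "\<forall>v. p i \<bullet> v = y \<bullet> v" using pv[OF i q] by simp
      then show ?thesis by (simp only: vector_eq_rdot)
    qed
    ultimately show ?thesis by blast
  qed
  then have *: "\<exists>p\<in>cotangent_space A q. p i = y" if "q \<in> cdom A i" for q y
    using that .
  show ?thesis
  proof (intro set_eqI iffI)
    fix z assume "z \<in> cimage (cotangent_bundle A) i"
    then show "z \<in> cimage A i \<times> UNIV"
      by (auto simp: cimage_def cotangent_bundle_def)
  next
    fix z assume "z \<in> cimage A i \<times> (UNIV :: 'e set)"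
    then obtain q y where q: "q \<in> cdom A i" and z: "z = (cmap A i q, y)"
      by (cases z) (auto simp: cimage_def)
    from *[OF q] obtain p where "p \<in> cotangent_space A q" "p i = y" by blast
    with q z have "z = cmap (cotangent_bundle A) i (q, p)" "(q, p) \<in> cdom (cotangent_bundle A) i"
      by (simp_all add: cotangent_bundle_def)
    then show "z \<in> cimage (cotangent_bundle A) i"
      unfolding cimage_def by (rule image_eqI)
  qed
qed

text \<open>In the induced charts, \<open>dp \<and> dq\<close> has the following expression and the projection to
  the base is \<^const>\<open>fst\<close>.\<close>

definition dp_wedge_dq :: "('i, 'e::euclidean_space \<times> 'e) form2" where
  "dp_wedge_dq i z \<xi> \<eta> = snd \<xi> \<bullet> fst \<eta> - snd \<eta> \<bullet> fst \<xi>"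

definition pullback_pi :: "('i, 'e::euclidean_space) form2 \<Rightarrow> ('i, 'e \<times> 'e) form2" where
  "pullback_pi \<sigma> i z \<xi> \<eta> = \<sigma> i (fst z) (fst \<xi>) (fst \<eta>)"

definition twisted_form :: "('i, 'e::euclidean_space) form2 \<Rightarrow> ('i, 'e \<times> 'e) form2" where
  "twisted_form \<sigma> i z \<xi> \<eta> = dp_wedge_dq i z \<xi> \<eta> + pullback_pi \<sigma> i z \<xi> \<eta>"

lemma twisted_form_nondegenerate:
  assumes "\<forall>u. linear (\<sigma> i (fst z) u)" "\<forall>u v. \<sigma> i (fst z) v u = - \<sigma> i (fst z) u v"
    and "\<forall>\<eta>. twisted_form \<sigma> i z \<xi> \<eta> = 0"
  shows "\<xi> = (0::'e::euclidean_space \<times> 'e)"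
proof -
  have l0: "\<sigma> i (fst z) u 0 = 0" for u using assms(1) linear_0 by blast
  have "fst \<xi> \<bullet> v = 0" for v using assms(3)[rule_format, of "(0,v)"] l0
    by (simp add: twisted_form_def dp_wedge_dq_def pullback_pi_def inner_commute)
  then have 1: "fst \<xi> = 0" by (metis inner_eq_zero_iff)
  then have "snd \<xi> \<bullet> v = 0" for v using assms(3)[rule_format, of "(v,0)"] assms(2)[rule_format, of 0 v] l0
    by (simp add: twisted_form_def dp_wedge_dq_def pullback_pi_def)
  then have "snd \<xi> = 0" by (metis inner_eq_zero_iff)
  with 1 show ?thesis by (simp add: prod_eq_iff)
qed

section \<open>Displaceability\<close>

definition compactly_supported_hamiltonian ::
    "('i, 'a, 'e::euclidean_space) atlas \<Rightarrow> (real \<Rightarrow> 'a \<Rightarrow> real) \<Rightarrow> bool" where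
  "compactly_supported_hamiltonian A F \<longleftrightarrow>
     (\<forall>i\<in>charts A. smooth_on (UNIV \<times> cimage A i) (\<lambda>(t, x). F t (cinv A i x))) \<and>
     (\<exists>K. compactin (manifold_topology A) K \<and> (\<forall>t. \<forall>w\<in>points A - K. F t w = 0))"

text \<open>\<open>\<Phi>\<close> is the flow, starting from the identity at time \<open>0\<close>, of the time-dependent vector
  field \<open>X\<close> given by \<open>\<omega>(X, \<cdot>) = - dF\<close>; for \<open>dp \<and> dq\<close> these are Hamilton's equations with the
  usual signs.\<close>

definition hamiltonian_flow ::
    "('i, 'a, 'e::euclidean_space) atlas \<Rightarrow> ('i, 'e) form2 \<Rightarrow> (real \<Rightarrow> 'a \<Rightarrow> real) \<Rightarrow>
     (real \<Rightarrow> 'a \<Rightarrow> 'a) \<Rightarrow> bool" where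
  "hamiltonian_flow A \<omega> F \<Phi> \<longleftrightarrow>
     (\<forall>w\<in>points A. \<Phi> 0 w = w \<and>
        continuous_map euclideanreal (manifold_topology A) (\<lambda>t. \<Phi> t w) \<and>
        (\<forall>t. \<forall>i\<in>charts A. \<Phi> t w \<in> cdom A i \<longrightarrow>
           (\<exists>\<xi>. ((\<lambda>s. cmap A i (\<Phi> s w)) has_vector_derivative \<xi>) (at t) \<and>
                (\<forall>v. \<omega> i (cmap A i (\<Phi> t w)) \<xi> v =
                     - frechet_derivative (F t \<circ> cinv A i) (at (cmap A i (\<Phi> t w))) v))))"

definition hamiltonian_diffeomorphism ::
    "('i, 'a, 'e::euclidean_space) atlas \<Rightarrow> ('i, 'e) form2 \<Rightarrow> ('a \<Rightarrow> 'a) \<Rightarrow> bool" where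
  "hamiltonian_diffeomorphism A \<omega> \<phi> \<longleftrightarrow>
     (\<exists>F \<Phi>. compactly_supported_hamiltonian A F \<and> hamiltonian_flow A \<omega> F \<Phi> \<and> \<phi> = \<Phi> 1)"

definition displaceable ::
    "('i, 'a, 'e::euclidean_space) atlas \<Rightarrow> ('i, 'e) form2 \<Rightarrow> 'a set \<Rightarrow> bool" where
  "displaceable A \<omega> U \<longleftrightarrow>
     (\<exists>\<phi>. hamiltonian_diffeomorphism A \<omega> \<phi> \<and> \<phi> ` U \<inter> U = {})"

section \<open>Tonelli Hamiltonians\<close>

text \<open>The second derivative along the fibre at \<open>(q, p)\<close>, evaluated at \<open>(r, r)\<close>, is the
  second derivative of \<open>s \<mapsto> H (q, p + s r)\<close> at \<open>0\<close>. In the growth condition the norm on the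
  finite-dimensional space of covectors at \<open>q\<close> is the coordinate norm of any chart at \<open>q\<close>.\<close>

definition fibrewise_convex ::
    "('i, 'a, 'e::euclidean_space) atlas \<Rightarrow> ('a \<times> ('i \<Rightarrow> 'e) \<Rightarrow> real) \<Rightarrow> bool" where
  "fibrewise_convex M H \<longleftrightarrow>
     (\<forall>q\<in>points M. \<forall>p\<in>cotangent_space M q. \<forall>r\<in>cotangent_space M q. r \<noteq> (\<lambda>_. 0) \<longrightarrow>
        (deriv ^^ 2) (\<lambda>s::real. H (q, \<lambda>i. p i + s *\<^sub>R r i)) 0 > 0)"

definition fibrewise_superlinear ::
    "('i, 'a, 'e::euclidean_space) atlas \<Rightarrow> ('a \<times> ('i \<Rightarrow> 'e) \<Rightarrow> real) \<Rightarrow> bool" where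
  "fibrewise_superlinear M H \<longleftrightarrow>
     (\<forall>i\<in>charts M. \<forall>q\<in>cdom M i. \<forall>C. \<exists>R. \<forall>p\<in>cotangent_space M q.
        norm (p i) \<ge> R \<longrightarrow> H (q, p) \<ge> C * norm (p i))"

definition tonelli ::
    "('i, 'a, 'e::euclidean_space) atlas \<Rightarrow> ('a \<times> ('i \<Rightarrow> 'e) \<Rightarrow> real) \<Rightarrow> bool" where
  "tonelli M H \<longleftrightarrow>
     smooth_function (cotangent_bundle M) H \<and> fibrewise_convex M H \<and> fibrewise_superlinear M H"

text \<open>For a Tonelli Hamiltonian on a nonempty closed manifold all extrema below are attained.\<close>

definition min_energy ::
    "('i, 'a, 'e::euclidean_space) atlas \<Rightarrow> ('a \<times> ('i \<Rightarrow> 'e) \<Rightarrow> real) \<Rightarrow> real" where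
  "min_energy M H = (INF z\<in>points (cotangent_bundle M). H z)"

definition e0 ::
    "('i, 'a, 'e::euclidean_space) atlas \<Rightarrow> ('a \<times> ('i \<Rightarrow> 'e) \<Rightarrow> real) \<Rightarrow> real" where
  "e0 M H = (SUP q\<in>points M. INF p\<in>cotangent_space M q. H (q, p))"

definition sublevel ::
    "('i, 'a, 'e::euclidean_space) atlas \<Rightarrow> ('a \<times> ('i \<Rightarrow> 'e) \<Rightarrow> real) \<Rightarrow> real \<Rightarrow> ('a \<times> ('i \<Rightarrow> 'e)) set" where
  "sublevel M H k = {z \<in> points (cotangent_bundle M). H z \<le> k}"

end

theory Submission
  imports Defs
begin

text \<open>Since \<open>k < e\<^sub>0(H)\<close>, there is a nonempty open \<open>U \<subseteq> M\<close> over which \<open>H > k\<close>. A Morse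
  function has finitely many critical points, and these can be moved into \<open>U\<close> one at a time, so
  there is a smooth \<open>g : M \<rightarrow> \<real>\<close> without critical points outside \<open>U\<close>. Whatever \<open>\<sigma>\<close> is, the flow of
  \<open>\<Lambda> g \<circ> \<pi>\<close> is the fibre translation \<open>(q, p) \<mapsto> (q, p - t \<Lambda> dg(q))\<close>, and for large \<open>\<Lambda>\<close> its time-one
  map takes the fibrewise bounded set \<open>{H \<le> k}\<close> off itself.

  The Hamiltonian must be cut off, and the flow must then exist also where it is not explicit.
  A partition of unity splits \<open>\<Lambda> g\<close> into functions supported in charts, whose cut-off flows are
  performed one after the other: each then is an ordinary differential equation with a
  compactly supported field in a Euclidean space. Flows need not depend continuously on the
  initial point in the definition of a Hamiltonian diffeomorphism used here, so it is enough to
  find one integral curve through each point, and in the sublevel the explicit one is taken.\<close>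

section \<open>Calculus of smooth functions\<close>

text \<open>The displacement compares two sizes. Away from U the covector dg has no zeros, so on
  compact pieces it is bounded below, while the fibres of the sublevel are bounded. If a point and
  its image both lay in the sublevel, their difference \<Lambda> dg would be shorter than twice the
  fibre bound. Hence the order of choices: first the fibre bounds, then \<Lambda>, then cut-off
  radii that exceed the fibre bounds by all translations to come, so that no curve from the sublevel
  meets a cut-off. The form \<sigma> cannot disturb the translation: the field of a function of q is
  vertical, and vertical vectors lie in the kernel of the pullback of \<sigma>. Translations in a
  fibre commute, so pieces performed in sequence add up to the whole of \<Lambda> dg. Superlinear
  growth is assumed in each fibre separately; convexity along rays makes it locally uniform in q.
  Critical points are moved by precomposition: if \<theta> has invertible derivative and maps only
  points of U to critical points of f, then the critical points of f \<circ> \<theta> lie in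
  U.\<close>

lemma frechet_derivative_transform_open:
  assumes "open S" "x \<in> S" "\<And>y. y \<in> S \<Longrightarrow> f y = g y"
  shows "frechet_derivative f (at x) = frechet_derivative g (at x)"
proof -
  \<comment> \<open>\<open>frechet_derivative\<close> is a choice from the set of derivatives, so
    equal sets give equal values, even at a point without derivative.\<close>
  have "(f has_derivative D) (at x) \<longleftrightarrow> (g has_derivative D) (at x)" for D
    using has_derivative_transform_within_open[OF _ assms(1,2)] assms(3) by metis
  then show ?thesis unfolding frechet_derivative_def by simp
qed

lemma differentiable_transform_open:
  assumes "open S" "x \<in> S" "\<And>y. y \<in> S \<Longrightarrow> f y = g y" "f differentiable (at x)"
  shows "g differentiable (at x)"
  using assms has_derivative_transform_within_open unfolding differentiable_def by metis

lemma Ck_on_subset: "Ck_on k S f \<Longrightarrow> T \<subseteq> S \<Longrightarrow> Ck_on k T f"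
  by (induction k arbitrary: f) (auto intro: continuous_on_subset)

lemma Ck_on_cong:
  assumes "open S"
  shows "(\<And>x. x \<in> S \<Longrightarrow> f x = g x) \<Longrightarrow> Ck_on k S f \<Longrightarrow> Ck_on k S g"
proof (induction k arbitrary: f g)
  case 0
  then show ?case using continuous_on_cong by (metis Ck_on.simps(1))
next
  case (Suc k)
  have "Ck_on k S (\<lambda>x. frechet_derivative g (at x) v)" for v
  proof (rule Suc.IH)
    show "Ck_on k S (\<lambda>x. frechet_derivative f (at x) v)" using Suc.prems by simp
    show "frechet_derivative f (at x) v = frechet_derivative g (at x) v" if "x \<in> S" for x
      by (subst frechet_derivative_transform_open[OF assms that Suc.prems(1)]) auto
  qed
  moreover have "g differentiable (at x)" if "x \<in> S" for x
    using Suc.prems(2) that by (intro differentiable_transform_open[OF assms that Suc.prems(1)]) auto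
  ultimately show ?case by simp
qed

lemma Ck_on_SucD: "Ck_on (Suc k) S f \<Longrightarrow> Ck_on k S f"
proof (induction k arbitrary: f)
  case 0
  then show ?case
    by (auto intro!: continuous_at_imp_continuous_on differentiable_imp_continuous_within)
next
  case (Suc k)
  then show ?case by (meson Ck_on.simps(2))
qed

text \<open>Lets a proof name the derivative instead of handling \<open>frechet_derivative\<close>.
  The closure properties below are inductions on k through this rule: the derivative is built from
  ingredients of order k.\<close>

lemma Ck_on_SucI:
  assumes "open S" "\<And>x. x \<in> S \<Longrightarrow> (f has_derivative D x) (at x)" "\<And>v. Ck_on k S (\<lambda>x. D x v)"
  shows "Ck_on (Suc k) S f"
proof -
  have "frechet_derivative f (at x) = D x" if "x \<in> S" for x
    using assms(2)[OF that] by (metis frechet_derivative_at)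
  then have "Ck_on k S (\<lambda>x. frechet_derivative f (at x) v)" for v
    by (intro Ck_on_cong[OF assms(1) _ assms(3)]) auto
  then show ?thesis using assms(2) by (auto simp: differentiable_def)
qed

lemma Ck_on_has_derivative:
  "Ck_on (Suc k) S f \<Longrightarrow> x \<in> S \<Longrightarrow> (f has_derivative frechet_derivative f (at x)) (at x)"
  by (simp add: frechet_derivative_works)

lemma Ck_on_const: "open S \<Longrightarrow> Ck_on k S (\<lambda>x. c)"
proof (induction k arbitrary: c)
  case (Suc k)
  then show ?case by (intro Ck_on_SucI[where D = "\<lambda>x v. 0"]) auto
qed auto

lemma Ck_on_bounded_linear_fun:
  assumes "open S" "bounded_linear L"
  shows "Ck_on k S L"
proof (cases k)
  case 0
  then show ?thesis using assms by (simp add: linear_continuous_on)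
next
  case (Suc n)
  then show ?thesis using assms
    by (simp del: Ck_on.simps, intro Ck_on_SucI[where D = "\<lambda>x v. L v"] Ck_on_const bounded_linear_imp_has_derivative)
qed

lemma Ck_on_add:
  assumes "open S"
  shows "Ck_on k S f \<Longrightarrow> Ck_on k S g \<Longrightarrow> Ck_on k S (\<lambda>x. f x + g x)"
proof (induction k arbitrary: f g)
  case (Suc k)
  show ?case
  proof (rule Ck_on_SucI[OF assms])
    show "((\<lambda>x. f x + g x) has_derivative
        (\<lambda>v. frechet_derivative f (at x) v + frechet_derivative g (at x) v)) (at x)" if "x \<in> S" for x
      using Ck_on_has_derivative[OF Suc.prems(1) that] Ck_on_has_derivative[OF Suc.prems(2) that]
      by (rule has_derivative_add)
    show "Ck_on k S (\<lambda>x. frechet_derivative f (at x) v + frechet_derivative g (at x) v)" for v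
      using Suc by simp
  qed
qed (auto intro: continuous_on_add)

text \<open>Leibniz rule. Its terms contain f and g undifferentiated, so the induction step first
  weakens their regularity from Suc k to k. Products, scalar multiples and inner products are all
  instances.\<close>

lemma Ck_on_bilinear:
  assumes "open S" "bounded_bilinear B"
  shows "Ck_on k S f \<Longrightarrow> Ck_on k S g \<Longrightarrow> Ck_on k S (\<lambda>x. B (f x) (g x))"
proof (induction k arbitrary: f g)
  case 0
  then show ?case using assms bounded_bilinear.continuous_on by auto
next
  case (Suc k)
  show ?case
  proof (rule Ck_on_SucI[OF assms(1)])
    show "((\<lambda>x. B (f x) (g x)) has_derivative
        (\<lambda>v. B (f x) (frechet_derivative g (at x) v) + B (frechet_derivative f (at x) v) (g x))) (at x)"
      if "x \<in> S" for x
      using bounded_bilinear.FDERIV[OF assms(2) Ck_on_has_derivative[OF Suc.prems(1) that]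
          Ck_on_has_derivative[OF Suc.prems(2) that]] .
    show "Ck_on k S (\<lambda>x. B (f x) (frechet_derivative g (at x) v) + B (frechet_derivative f (at x) v) (g x))" for v
      using Suc Ck_on_SucD[OF Suc.prems(1)] Ck_on_SucD[OF Suc.prems(2)]
      by (intro Ck_on_add[OF assms(1)] Suc.IH) auto
  qed
qed

lemma Ck_on_sum:
  assumes "open S" "\<And>i. i \<in> I \<Longrightarrow> Ck_on k S (f i)"
  shows "Ck_on k S (\<lambda>x. \<Sum>i\<in>I. f i x)"
  using assms(2)
proof (induction I rule: infinite_finite_induct)
  case (insert a F)
  then show ?case by (simp add: Ck_on_add[OF assms(1)])
qed (auto intro: Ck_on_const assms)

lemma Ck_on_linear_compose:
  assumes "open S" "bounded_linear L"
  shows "Ck_on k S f \<Longrightarrow> Ck_on k S (\<lambda>x. L (f x))"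
proof (induction k arbitrary: f)
  case 0
  then show ?case using assms by (auto intro: bounded_linear.continuous_on)
next
  case (Suc k)
  show ?case
  proof (rule Ck_on_SucI[OF assms(1)])
    show "((\<lambda>x. L (f x)) has_derivative (\<lambda>v. L (frechet_derivative f (at x) v))) (at x)"
      if "x \<in> S" for x
      using bounded_linear.has_derivative[OF assms(2) Ck_on_has_derivative[OF Suc.prems that]] .
  qed (use Suc in auto)
qed

lemma linear_basis_expansion:
  fixes v :: "'b::euclidean_space"
  assumes "linear L" shows "L v = (\<Sum>b\<in>Basis. (v \<bullet> b) *\<^sub>R L b)"
proof -
  have "L v = L (\<Sum>b\<in>Basis. (v \<bullet> b) *\<^sub>R b)" by (simp add: euclidean_representation)
  then show ?thesis using assms by (simp add: linear_sum linear_cmul)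
qed

text \<open>\<open>Ck_on\<close> controls derivatives in fixed directions only, but the chain rule
  differentiates g in the moving direction Df(x) v. Expanding that direction in a basis of the
  intermediate space restores fixed directions.\<close>

lemma Ck_on_compose:
  fixes f :: "'a::real_normed_vector \<Rightarrow> 'b::euclidean_space" and g :: "'b \<Rightarrow> 'c::real_normed_vector"
  assumes "open S" "f ` S \<subseteq> T"
  shows "Ck_on k S f \<Longrightarrow> Ck_on k T g \<Longrightarrow> Ck_on k S (\<lambda>x. g (f x))"
  using assms(2)
proof (induction k arbitrary: g)
  case 0
  then show ?case by (auto intro: continuous_on_compose2)
next
  case (Suc k)
  let ?D = "\<lambda>x v. \<Sum>b\<in>Basis. (frechet_derivative f (at x) v \<bullet> b) *\<^sub>R frechet_derivative g (at (f x)) b"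
  show ?case
  proof (rule Ck_on_SucI[OF assms(1)])
    show "((\<lambda>x. g (f x)) has_derivative ?D x) (at x)" if "x \<in> S" for x
    proof -
      have f: "f x \<in> T" using that Suc.prems(3) by auto
      note g = Ck_on_has_derivative[OF Suc.prems(2) f]
      from diff_chain_at[OF Ck_on_has_derivative[OF Suc.prems(1) that] g]
      have "((\<lambda>x. g (f x)) has_derivative (\<lambda>v. frechet_derivative g (at (f x)) (frechet_derivative f (at x) v))) (at x)"
        by (simp add: o_def)
      then show ?thesis
        by (subst (asm) linear_basis_expansion[OF has_derivative_linear[OF g]])
    qed
    show "Ck_on k S (\<lambda>x. ?D x v)" for v
    proof (rule Ck_on_sum[OF assms(1)])
      fix b :: 'b assume "b \<in> Basis"
      show "Ck_on k S (\<lambda>x. (frechet_derivative f (at x) v \<bullet> b) *\<^sub>R frechet_derivative g (at (f x)) b)"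
      proof (rule Ck_on_bilinear[OF assms(1) bounded_bilinear_scaleR])
        show "Ck_on k S (\<lambda>x. frechet_derivative f (at x) v \<bullet> b)"
          using Suc.prems(1) by (intro Ck_on_linear_compose[OF assms(1) bounded_linear_inner_left]) auto
        show "Ck_on k S (\<lambda>x. frechet_derivative g (at (f x)) b)"
          using Suc.prems(2,3) by (intro Suc.IH[OF Ck_on_SucD[OF Suc.prems(1)]]) auto
      qed
    qed
  qed
qed

lemma Ck_on_local:
  assumes "\<And>x. x \<in> S \<Longrightarrow> \<exists>T. open T \<and> x \<in> T \<and> Ck_on k T f"
  shows "Ck_on k S f"
  using assms
proof (induction k arbitrary: f)
  case 0
  then have "isCont f x" if "x \<in> S" for x
    using that by (metis Ck_on.simps(1) continuous_on_eq_continuous_at)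
  then show ?case by (simp add: continuous_at_imp_continuous_on)
next
  case (Suc k)
  then have "Ck_on k S (\<lambda>x. frechet_derivative f (at x) v)" for v
    by (intro Suc.IH) (metis Ck_on.simps(2))
  moreover have "f differentiable (at x)" if "x \<in> S" for x
    using Suc.prems[OF that] by auto
  ultimately show ?case by simp
qed

section \<open>Rules for smooth functions\<close>

lemma smooth_on_subset: "smooth_on S f \<Longrightarrow> T \<subseteq> S \<Longrightarrow> smooth_on T f"
  unfolding smooth_on_def using Ck_on_subset by blast

lemma smooth_on_cong:
  "open S \<Longrightarrow> (\<And>x. x \<in> S \<Longrightarrow> f x = g x) \<Longrightarrow> smooth_on S f \<Longrightarrow> smooth_on S g"
  unfolding smooth_on_def using Ck_on_cong by metis

lemma smooth_on_local:
  "(\<And>x. x \<in> S \<Longrightarrow> \<exists>T. open T \<and> x \<in> T \<and> smooth_on T f) \<Longrightarrow> smooth_on S f"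
  unfolding smooth_on_def by (metis Ck_on_local)

lemma smooth_on_imp_continuous_on: "smooth_on S f \<Longrightarrow> continuous_on S f"
  unfolding smooth_on_def by (metis Ck_on.simps(1))

lemma smooth_on_has_derivative:
  "smooth_on S f \<Longrightarrow> x \<in> S \<Longrightarrow> (f has_derivative frechet_derivative f (at x)) (at x)"
  using smooth_on_imp_differentiable frechet_derivative_works by blast

lemma smooth_on_frechet_derivative:
  "smooth_on S f \<Longrightarrow> smooth_on S (\<lambda>x. frechet_derivative f (at x) v)"
  unfolding smooth_on_def by (metis Ck_on.simps(2))

lemma smooth_on_const: "open S \<Longrightarrow> smooth_on S (\<lambda>x. c)"
  unfolding smooth_on_def by (simp add: Ck_on_const)

lemma smooth_on_bounded_linear_fun: "open S \<Longrightarrow> bounded_linear L \<Longrightarrow> smooth_on S L"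
  unfolding smooth_on_def by (simp add: Ck_on_bounded_linear_fun)

lemma smooth_on_linear_compose:
  "open S \<Longrightarrow> bounded_linear L \<Longrightarrow> smooth_on S f \<Longrightarrow> smooth_on S (\<lambda>x. L (f x))"
  unfolding smooth_on_def by (simp add: Ck_on_linear_compose)

lemma smooth_on_bilinear:
  "open S \<Longrightarrow> bounded_bilinear B \<Longrightarrow> smooth_on S f \<Longrightarrow> smooth_on S g \<Longrightarrow> smooth_on S (\<lambda>x. B (f x) (g x))"
  unfolding smooth_on_def by (simp add: Ck_on_bilinear)

lemma smooth_on_add:
  "open S \<Longrightarrow> smooth_on S f \<Longrightarrow> smooth_on S g \<Longrightarrow> smooth_on S (\<lambda>x. f x + g x)"
  unfolding smooth_on_def by (simp add: Ck_on_add)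

lemma smooth_on_sum:
  "open S \<Longrightarrow> (\<And>i. i \<in> I \<Longrightarrow> smooth_on S (h i)) \<Longrightarrow> smooth_on S (\<lambda>x. \<Sum>i\<in>I. h i x)"
  unfolding smooth_on_def by (simp add: Ck_on_sum)

lemma smooth_on_compose:
  fixes f :: "'a::real_normed_vector \<Rightarrow> 'b::euclidean_space" and g :: "'b \<Rightarrow> 'c::real_normed_vector"
  shows "open S \<Longrightarrow> smooth_on S f \<Longrightarrow> smooth_on T g \<Longrightarrow> f ` S \<subseteq> T \<Longrightarrow> smooth_on S (\<lambda>x. g (f x))"
  unfolding smooth_on_def using Ck_on_compose by blast

lemmas smooth_on_ident = smooth_on_bounded_linear_fun[OF _ bounded_linear_ident]
lemmas smooth_on_fst = smooth_on_linear_compose[OF _ bounded_linear_fst]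
lemmas smooth_on_snd = smooth_on_linear_compose[OF _ bounded_linear_snd]
lemmas smooth_on_minus = smooth_on_linear_compose[OF _ bounded_linear_minus[OF bounded_linear_ident]]
lemmas smooth_on_scaleR = smooth_on_bilinear[OF _ bounded_bilinear_scaleR]
lemmas smooth_on_inner = smooth_on_bilinear[OF _ bounded_bilinear_inner]
lemmas smooth_on_mult = smooth_on_bilinear[OF _ bounded_bilinear_mult]

lemma smooth_on_diff:
  "open S \<Longrightarrow> smooth_on S f \<Longrightarrow> smooth_on S g \<Longrightarrow> smooth_on S (\<lambda>x. f x - g x)"
  using smooth_on_add[OF _ _ smooth_on_minus, of S f g] by simp

lemma smooth_on_Pair:
  fixes f :: "'a::real_normed_vector \<Rightarrow> 'b::real_normed_vector" and g :: "'a \<Rightarrow> 'c::real_normed_vector"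
  assumes "open S" "smooth_on S f" "smooth_on S g" shows "smooth_on S (\<lambda>x. (f x, g x))"
proof -
  have "bounded_linear (\<lambda>x::'b. (x, 0::'c))" "bounded_linear (\<lambda>y::'c. (0::'b, y))"
    by (auto intro!: bounded_linear_Pair bounded_linear_ident bounded_linear_zero)
  from smooth_on_add[OF assms(1) smooth_on_linear_compose[OF assms(1) this(1) assms(2)]
      smooth_on_linear_compose[OF assms(1) this(2) assms(3)]]
  show ?thesis by simp
qed

lemmas smooth_intros = smooth_on_const smooth_on_ident smooth_on_fst smooth_on_snd smooth_on_minus
  smooth_on_scaleR smooth_on_inner smooth_on_mult smooth_on_add smooth_on_diff smooth_on_sum smooth_on_Pair

lemma smooth_on_prod:
  fixes h :: "'i \<Rightarrow> 'a::real_normed_vector \<Rightarrow> real"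
  assumes "open S" "\<And>i. i \<in> I \<Longrightarrow> smooth_on S (h i)"
  shows "smooth_on S (\<lambda>x. \<Prod>i\<in>I. h i x)"
  using assms(2)
proof (induction I rule: infinite_finite_induct)
  case (insert a F)
  then show ?case by (simp add: smooth_on_mult[OF assms(1)])
qed (auto intro: smooth_on_const assms)

text \<open>The basis expansion again, for a direction that varies with the parameter; it yields
  joint continuity of the Hessian in the point and the vector.\<close>

lemma smooth_on_frechet_derivative_dir:
  fixes f :: "'b::euclidean_space \<Rightarrow> 'c::real_normed_vector"
  assumes "open S" "open T" "smooth_on T f" "smooth_on S x" "x ` S \<subseteq> T" "smooth_on S w"
  shows "smooth_on S (\<lambda>z. frechet_derivative f (at (x z)) (w z))"
proof (rule smooth_on_cong[OF assms(1)])
  show "smooth_on S (\<lambda>z. \<Sum>b\<in>Basis. (w z \<bullet> b) *\<^sub>R frechet_derivative f (at (x z)) b)"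
    by (intro smooth_on_sum smooth_on_scaleR smooth_on_inner smooth_on_const assms
        smooth_on_compose[OF assms(1,4) smooth_on_frechet_derivative[OF assms(3)]])
  fix z assume "z \<in> S"
  then have "x z \<in> T" using assms by auto
  note D = has_derivative_linear[OF smooth_on_has_derivative[OF assms(3) this]]
  show "(\<Sum>b\<in>Basis. (w z \<bullet> b) *\<^sub>R frechet_derivative f (at (x z)) b) = frechet_derivative f (at (x z)) (w z)"
    by (rule linear_basis_expansion[OF D, symmetric])
qed

lemma smooth_on_inverse: "smooth_on {0<..} (inverse :: real \<Rightarrow> real)"
proof -
  have "Ck_on k {0<..} (inverse :: real \<Rightarrow> real)" for k
  proof (induction k)
    case 0
    then show ?case by (auto intro!: continuous_on_inverse continuous_on_id)
  next
    case (Suc k)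
    show ?case
    proof (rule Ck_on_SucI[where D = "\<lambda>x v. - (inverse x * v * inverse x)"])
      show "Ck_on k {0<..} (\<lambda>x::real. - (inverse x * v * inverse x))" for v
        by (intro Ck_on_linear_compose[OF _ bounded_linear_minus[OF bounded_linear_ident]]
            Ck_on_bilinear[OF _ bounded_bilinear_mult] Ck_on_const Suc) auto
    qed (auto intro!: derivative_eq_intros)
  qed
  then show ?thesis by (simp add: smooth_on_def)
qed

text \<open>Two mean value arguments for the second difference of \<open>f\<close> over a small parallelogram.\<close>

lemma frechet_derivative_commute:
  fixes f :: "'a::real_normed_vector \<Rightarrow> real"
  assumes S: "open S" "smooth_on S f" "x \<in> S"
  shows "frechet_derivative (\<lambda>y. frechet_derivative f (at y) u) (at x) v =
         frechet_derivative (\<lambda>y. frechet_derivative f (at y) v) (at x) u"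
proof -
  define D where "D u v y = frechet_derivative (\<lambda>y. frechet_derivative f (at y) u) (at y) v" for u v y
  have *: "\<exists>a b. 0 < a \<and> a < h \<and> 0 < b \<and> b < h \<and>
     f (x + h *\<^sub>R u + h *\<^sub>R v) - f (x + h *\<^sub>R u) - f (x + h *\<^sub>R v) + f x = h * h * D u v (x + a *\<^sub>R u + b *\<^sub>R v)"
    if h: "h > 0" and inS: "\<And>a b. 0 \<le> a \<Longrightarrow> a \<le> h \<Longrightarrow> 0 \<le> b \<Longrightarrow> b \<le> h \<Longrightarrow> x + a *\<^sub>R u + b *\<^sub>R v \<in> S" for h u v
  proof -
    let ?g = "\<lambda>a. f (x + a *\<^sub>R u + h *\<^sub>R v) - f (x + a *\<^sub>R u + 0 *\<^sub>R v)"
    have d1: "((\<lambda>a. f (x + a *\<^sub>R u + b *\<^sub>R v)) has_real_derivative frechet_derivative f (at (x + a *\<^sub>R u + b *\<^sub>R v)) u) (at a)"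
      if "0 \<le> a" "a \<le> h" "0 \<le> b" "b \<le> h" for a b
    proof -
      have "((\<lambda>a. x + a *\<^sub>R u + b *\<^sub>R v) has_derivative (\<lambda>s. s *\<^sub>R u)) (at a)"
        by (auto intro!: derivative_eq_intros)
      note diff_chain_at[OF this smooth_on_has_derivative[OF S(2) inS[OF that]]]
      moreover have "linear (frechet_derivative f (at (x + a *\<^sub>R u + b *\<^sub>R v)))"
        using smooth_on_has_derivative[OF S(2) inS[OF that]] has_derivative_linear by blast
      ultimately show ?thesis
        by (simp add: has_field_derivative_def o_def linear_cmul mult_commute_abs)
    qed
    have d2: "((\<lambda>b. frechet_derivative f (at (x + a *\<^sub>R u + b *\<^sub>R v)) u) has_real_derivative D u v (x + a *\<^sub>R u + b *\<^sub>R v)) (at b)"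
      if "0 \<le> a" "a \<le> h" "0 \<le> b" "b \<le> h" for a b
    proof -
      have c: "((\<lambda>b. x + a *\<^sub>R u + b *\<^sub>R v) has_derivative (\<lambda>s. s *\<^sub>R v)) (at b)"
        by (auto intro!: derivative_eq_intros)
      note D = smooth_on_has_derivative[OF smooth_on_frechet_derivative[OF S(2)] inS[OF that]]
      note diff_chain_at[OF c D[of u]]
      with has_derivative_linear[OF D[of u]] show ?thesis
        by (simp add: has_field_derivative_def o_def linear_cmul D_def mult_commute_abs)
    qed
    have "\<exists>a>0. a < h \<and> ?g h - ?g 0 = (h - 0) * (frechet_derivative f (at (x + a *\<^sub>R u + h *\<^sub>R v)) u - frechet_derivative f (at (x + a *\<^sub>R u + 0 *\<^sub>R v)) u)"
      using h by (intro MVT2 DERIV_diff d1) auto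
    then obtain a where a: "0 < a" "a < h" and 1: "?g h - ?g 0 = h * (frechet_derivative f (at (x + a *\<^sub>R u + h *\<^sub>R v)) u - frechet_derivative f (at (x + a *\<^sub>R u + 0 *\<^sub>R v)) u)"
      by auto
    have "\<exists>b>0. b < h \<and> frechet_derivative f (at (x + a *\<^sub>R u + h *\<^sub>R v)) u - frechet_derivative f (at (x + a *\<^sub>R u + 0 *\<^sub>R v)) u = (h - 0) * D u v (x + a *\<^sub>R u + b *\<^sub>R v)"
      using h a by (intro MVT2 d2) auto
    then obtain b where b: "0 < b" "b < h" and 2: "frechet_derivative f (at (x + a *\<^sub>R u + h *\<^sub>R v)) u - frechet_derivative f (at (x + a *\<^sub>R u + 0 *\<^sub>R v)) u = h * D u v (x + a *\<^sub>R u + b *\<^sub>R v)"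
      by auto
    show ?thesis using a b 1 2 by (intro exI[of _ a] exI[of _ b]) (simp add: algebra_simps)
  qed
  have "\<bar>D u v x - D v u x\<bar> < e" if e: "e > 0" for e
  proof -
    have c: "continuous_on S (D u v)" "continuous_on S (D v u)"
      unfolding D_def by (intro smooth_on_imp_continuous_on smooth_on_frechet_derivative S)+
    then have "isCont (D u v) x" "isCont (D v u) x" using S by (auto simp: continuous_on_eq_continuous_at)
    then obtain d1 d2 where d: "d1 > 0" "d2 > 0" "\<And>y. dist y x < d1 \<Longrightarrow> \<bar>D u v y - D u v x\<bar> < e/2"
      "\<And>y. dist y x < d2 \<Longrightarrow> \<bar>D v u y - D v u x\<bar> < e/2"
      using half_gt_zero[OF e] unfolding continuous_at_eps_delta dist_real_def by blast
    obtain r where r: "r > 0" "ball x r \<subseteq> S" using S open_contains_ball by blast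
    define m where "m = min r (min d1 d2)"
    \<comment> \<open>Small enough for the parallelogram with sides h u and h v to stay within
      distance m of x; the 1 keeps the denominator positive when u = v = 0.\<close>
    define h where "h = m / (2 * (norm u + norm v + 1))"
    have m: "m > 0" using r d by (simp add: m_def)
    have n: "norm u + norm v + 1 > 0" by (meson add_nonneg_pos add_nonneg_nonneg norm_ge_zero zero_less_one)
    have h: "h > 0" using m n by (simp add: h_def)
    have hn: "h * (norm u + norm v) < m"
    proof -
      have "h * (norm u + norm v) \<le> h * (norm u + norm v + 1)" using h by simp
      also have "\<dots> = m/2" using n by (simp add: h_def field_simps)
      finally show ?thesis using m by simp
    qed
    have close: "dist (x + a *\<^sub>R u + b *\<^sub>R v) x < m" if "0 \<le> a" "a \<le> h" "0 \<le> b" "b \<le> h" for a b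
    proof -
      have "norm (a *\<^sub>R u + b *\<^sub>R v) \<le> a * norm u + b * norm v"
        using norm_triangle_ineq[of "a *\<^sub>R u" "b *\<^sub>R v"] that by simp
      also have "\<dots> \<le> h * norm u + h * norm v"
        using that by (intro add_mono mult_right_mono) auto
      also have "\<dots> < m" using hn by (simp add: algebra_simps)
      finally show ?thesis by (simp add: dist_norm algebra_simps)
    qed
    have inS: "x + a *\<^sub>R u + b *\<^sub>R v \<in> S" if "0 \<le> a" "a \<le> h" "0 \<le> b" "b \<le> h" for a b
      using close[OF that] r by (auto simp: m_def mem_ball dist_commute subset_eq)
    have inS': "x + a *\<^sub>R v + b *\<^sub>R u \<in> S" if "0 \<le> a" "a \<le> h" "0 \<le> b" "b \<le> h" for a b
      using inS[OF that(3,4,1,2)] by (simp add: algebra_simps)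
    from *[OF h inS] obtain a b where ab: "0 < a" "a < h" "0 < b" "b < h"
      "f (x + h *\<^sub>R u + h *\<^sub>R v) - f (x + h *\<^sub>R u) - f (x + h *\<^sub>R v) + f x = h * h * D u v (x + a *\<^sub>R u + b *\<^sub>R v)"
      by blast
    from *[OF h inS'] obtain a' b' where ab': "0 < a'" "a' < h" "0 < b'" "b' < h"
      "f (x + h *\<^sub>R v + h *\<^sub>R u) - f (x + h *\<^sub>R v) - f (x + h *\<^sub>R u) + f x = h * h * D v u (x + a' *\<^sub>R v + b' *\<^sub>R u)"
      by blast
    have e1: "x + h *\<^sub>R v + h *\<^sub>R u = x + h *\<^sub>R u + h *\<^sub>R v"
      "x + a' *\<^sub>R v + b' *\<^sub>R u = x + b' *\<^sub>R u + a' *\<^sub>R v" by (simp_all add: algebra_simps)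
    \<comment> \<open>Both mean values compute the same second difference, so the two mixed
      derivatives agree at two points near x; continuity then compares them at x itself.\<close>
    have "h * h * D u v (x + a *\<^sub>R u + b *\<^sub>R v) = h * h * D v u (x + b' *\<^sub>R u + a' *\<^sub>R v)"
      using ab(5) ab'(5) unfolding e1 by linarith
    then have eq: "D u v (x + a *\<^sub>R u + b *\<^sub>R v) = D v u (x + b' *\<^sub>R u + a' *\<^sub>R v)" using h by simp
    have "\<bar>D u v (x + a *\<^sub>R u + b *\<^sub>R v) - D u v x\<bar> < e/2"
      using close[of a b] ab by (intro d) (auto simp: m_def)
    moreover have "\<bar>D v u (x + b' *\<^sub>R u + a' *\<^sub>R v) - D v u x\<bar> < e/2"
      using close[of b' a'] ab' by (intro d) (auto simp: m_def)
    ultimately show ?thesis using eq by argo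
  qed
  then have "D u v x = D v u x" by (metis abs_le_zero_iff diff_self eq_iff_diff_eq_0 less_irrefl not_le)
  then show ?thesis by (simp add: D_def)
qed

section \<open>Bump functions\<close>

text \<open>The classical exp(-1/x), extended by 0. The polynomial factor in 1/x makes the family
  closed under differentiation, which is what an induction over the order of smoothness
  needs.\<close>

definition flat_exp :: "real poly \<Rightarrow> real \<Rightarrow> real" where
  "flat_exp p x = (if x \<le> 0 then 0 else poly p (1 / x) * exp (- (1 / x)))"

lemma poly_over_exp_tendsto_0: "((\<lambda>x::real. poly p x * exp (- x)) \<longlongrightarrow> 0) at_top"
proof -
  have "((\<lambda>x. \<Sum>i\<le>degree p. coeff p i * (x ^ i / exp x)) \<longlongrightarrow> (\<Sum>i\<le>degree p. coeff p i * 0)) at_top"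
    by (intro tendsto_sum tendsto_mult tendsto_const tendsto_power_div_exp_0)
  then show ?thesis
    by (simp add: poly_altdef exp_minus divide_inverse sum_distrib_right mult.assoc)
qed

lemma flat_exp_tendsto_0: "(flat_exp p \<longlongrightarrow> 0) (at_right 0)"
proof -
  have "((\<lambda>x. poly p (inverse x) * exp (- inverse x)) \<longlongrightarrow> 0) (at_right (0::real))"
    by (rule filterlim_compose[OF poly_over_exp_tendsto_0 filterlim_inverse_at_top_right])
  then show ?thesis
  proof (rule Lim_transform_eventually)
    show "eventually (\<lambda>x. poly p (inverse x) * exp (- inverse x) = flat_exp p x) (at_right 0)"
      by (auto simp: eventually_at_right_field flat_exp_def inverse_eq_divide intro!: exI[of _ 1])
  qed
qed

text \<open>Differentiating p(1/x) exp(-1/x) gives (p - p')(1/x) / x^2 times the exponential;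
  division by x^2 multiplies the polynomial by the square of the variable.\<close>

lemma flat_exp_has_derivative:
  "(flat_exp p has_real_derivative flat_exp ([:0, 0, 1:] * (p - pderiv p)) x) (at x)"
proof -
  consider "x < 0" | "x > 0" | "x = 0" by linarith
  then show ?thesis
  proof cases
    case 1
    have "((\<lambda>x. 0) has_real_derivative 0) (at x)" by simp
    then have "(flat_exp p has_real_derivative 0) (at x)"
      by (rule has_field_derivative_transform_within_open[of _ _ _ "{..<0}"]) (use 1 in \<open>auto simp: flat_exp_def\<close>)
    then show ?thesis using 1 by (simp add: flat_exp_def)
  next
    case 2
    have "((\<lambda>x. poly p (1 / x) * exp (- (1 / x))) has_real_derivative
        flat_exp ([:0, 0, 1:] * (p - pderiv p)) x) (at x)"
      using 2 by (auto intro!: derivative_eq_intros DERIV_chain'[of _ _ _ _ "poly p"] poly_DERIV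
          simp: flat_exp_def power2_eq_square field_simps)
    then show ?thesis
      by (rule has_field_derivative_transform_within_open[of _ _ _ "{0<..}"]) (use 2 in \<open>auto simp: flat_exp_def\<close>)
  next
    case 3
    have "((\<lambda>h. (flat_exp p (0 + h) - flat_exp p 0) / h) \<longlongrightarrow> 0) (at_right 0)"
    \<comment> \<open>Dividing by h multiplies the polynomial by its variable, so the right
      difference quotient at 0 is again a member of the family.\<close>
    proof (rule Lim_transform_eventually[OF flat_exp_tendsto_0[of "[:0, 1:] * p"]])
      show "eventually (\<lambda>h. flat_exp ([:0, 1:] * p) h = (flat_exp p (0 + h) - flat_exp p 0) / h) (at_right 0)"
        by (auto simp: eventually_at_right_field flat_exp_def field_simps intro!: exI[of _ 1])
    qed
    moreover have "((\<lambda>h. (flat_exp p (0 + h) - flat_exp p 0) / h) \<longlongrightarrow> 0) (at_left 0)"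
    proof (rule Lim_transform_eventually[OF tendsto_const])
      show "eventually (\<lambda>h. 0 = (flat_exp p (0 + h) - flat_exp p 0) / h) (at_left 0)"
        by (auto simp: eventually_at_left_field flat_exp_def intro!: exI[of _ "-1"])
    qed
    ultimately have "(flat_exp p has_real_derivative 0) (at 0)"
      unfolding DERIV_def by (rule filterlim_split_at[rotated])
    then show ?thesis using 3 by (simp add: flat_exp_def)
  qed
qed

lemma smooth_on_flat_exp: "smooth_on UNIV (flat_exp p)"
proof -
  have "Ck_on k UNIV (flat_exp p)" for k
  proof (induction k arbitrary: p)
    case 0
    have "isCont (flat_exp p) x" for x using DERIV_isCont flat_exp_has_derivative by blast
    then show ?case by (simp add: continuous_at_imp_continuous_on)
  next
    case (Suc k)
    show ?case
    proof (rule Ck_on_SucI)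
      show "(flat_exp p has_derivative (*) (flat_exp ([:0, 0, 1:] * (p - pderiv p)) x)) (at x)" for x
        using flat_exp_has_derivative by (simp only: has_field_derivative_def)
      show "Ck_on k UNIV (\<lambda>x. flat_exp ([:0, 0, 1:] * (p - pderiv p)) x * v)" for v
        by (intro Ck_on_bilinear[OF _ bounded_bilinear_mult] Suc Ck_on_const) auto
    qed auto
  qed
  then show ?thesis by (simp add: smooth_on_def)
qed

definition smooth_step :: "real \<Rightarrow> real" where
  "smooth_step x = flat_exp 1 x * inverse (flat_exp 1 x + flat_exp 1 (1 - x))"

lemma smooth_step_denominator_pos: "flat_exp 1 x + flat_exp 1 (1 - x) > 0"
  by (auto simp: flat_exp_def intro: add_pos_pos)

lemma smooth_on_smooth_step: "smooth_on UNIV smooth_step"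
proof -
  have 1: "smooth_on UNIV (\<lambda>x. flat_exp 1 (1 - x))"
    by (rule smooth_on_compose[OF _ _ smooth_on_flat_exp]) (auto intro!: smooth_intros)
  have 2: "smooth_on UNIV (\<lambda>x. inverse (flat_exp 1 x + flat_exp 1 (1 - x)))"
    by (rule smooth_on_compose[OF _ _ smooth_on_inverse])
       (auto intro!: smooth_on_add 1 smooth_on_flat_exp smooth_step_denominator_pos)
  have "smooth_step = (\<lambda>x. flat_exp 1 x * inverse (flat_exp 1 x + flat_exp 1 (1 - x)))"
    by (rule ext) (simp add: smooth_step_def)
  then show ?thesis
    using smooth_on_mult[OF _ smooth_on_flat_exp[of 1] 2] by simp
qed

lemma smooth_step_eq_0: "x \<le> 0 \<Longrightarrow> smooth_step x = 0"
  by (simp add: smooth_step_def flat_exp_def)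

lemma smooth_step_eq_1: "x \<ge> 1 \<Longrightarrow> smooth_step x = 1"
  by (auto simp: smooth_step_def flat_exp_def)

lemma smooth_step_bounds: "0 \<le> smooth_step x" "smooth_step x \<le> 1"
proof -
  have "flat_exp 1 x \<ge> 0" "flat_exp 1 (1 - x) \<ge> 0" for x by (simp_all add: flat_exp_def)
  then show "0 \<le> smooth_step x" "smooth_step x \<le> 1"
    using smooth_step_denominator_pos[of x] by (simp_all add: smooth_step_def field_simps)
qed

lemma smooth_bump_exists:
  fixes c :: "'a::euclidean_space"
  assumes "0 < r" "r < s"
  obtains b :: "'a \<Rightarrow> real" where "smooth_on UNIV b" "\<And>x. 0 \<le> b x" "\<And>x. b x \<le> 1"
    "\<And>x. dist c x \<le> r \<Longrightarrow> b x = 1" "\<And>x. dist c x \<ge> s \<Longrightarrow> b x = 0"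
proof
  \<comment> \<open>The squared distance is smooth at the centre too; the affine function of it
    equals 1 at distance r and 0 at distance s.\<close>
  let ?b = "\<lambda>x. smooth_step (inverse (s^2 - r^2) * (s^2 - (x - c) \<bullet> (x - c)))"
  have pos: "s^2 - r^2 > 0" using assms by (simp add: power_strict_mono)
  have d: "(x - c) \<bullet> (x - c) = (dist c x)^2" for x by (simp add: dist_norm norm_minus_commute[of c] power2_norm_eq_inner)
  show "smooth_on UNIV ?b"
    by (rule smooth_on_compose[OF _ _ smooth_on_smooth_step]) (auto intro!: smooth_intros)
  show "0 \<le> ?b x" "?b x \<le> 1" for x by (rule smooth_step_bounds)+
  show "?b x = 1" if "dist c x \<le> r" for x
  proof (rule smooth_step_eq_1)
    have "(dist c x)^2 \<le> r^2" using that by (simp add: power_mono)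
    then show "1 \<le> inverse (s^2 - r^2) * (s^2 - (x - c) \<bullet> (x - c))"
      using pos unfolding d by (simp add: field_simps)
  qed
  show "?b x = 0" if "dist c x \<ge> s" for x
  proof (rule smooth_step_eq_0)
    have "(dist c x)^2 \<ge> s^2" using that assms by (simp add: power_mono)
    then show "inverse (s^2 - r^2) * (s^2 - (x - c) \<bullet> (x - c)) \<le> 0"
      using pos unfolding d by (simp add: mult_nonneg_nonpos)
  qed
qed

section \<open>Charts and the manifold topology\<close>

locale atlas =
  fixes A :: "('i, 'a, 'e::euclidean_space) atlas"
  assumes smooth_atlas: "smooth_atlas A"
begin

abbreviation "\<tau> \<equiv> transition A"
abbreviation "MT \<equiv> manifold_topology A"

definition overlap :: "'i \<Rightarrow> 'i \<Rightarrow> 'e set" where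
  "overlap i j = cmap A i ` (cdom A i \<inter> cdom A j)"

lemma inj_cmap: "i \<in> charts A \<Longrightarrow> inj_on (cmap A i) (cdom A i)"
  using smooth_atlas by (simp add: smooth_atlas_def)

lemma cinv_cmap: "i \<in> charts A \<Longrightarrow> q \<in> cdom A i \<Longrightarrow> cinv A i (cmap A i q) = q"
  unfolding cinv_def by (simp add: the_inv_into_f_f inj_cmap)

lemma cmap_in_cimage: "q \<in> cdom A i \<Longrightarrow> cmap A i q \<in> cimage A i"
  by (simp add: cimage_def)

lemma cmap_cinv: "i \<in> charts A \<Longrightarrow> x \<in> cimage A i \<Longrightarrow> cmap A i (cinv A i x) = x"
  by (auto simp: cimage_def cinv_cmap)

lemma cinv_in_cdom: "i \<in> charts A \<Longrightarrow> x \<in> cimage A i \<Longrightarrow> cinv A i x \<in> cdom A i"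
  by (auto simp: cimage_def cinv_cmap)

lemma open_overlap: "i \<in> charts A \<Longrightarrow> j \<in> charts A \<Longrightarrow> open (overlap i j)"
  using smooth_atlas by (simp add: smooth_atlas_def overlap_def)

lemma open_cimage: "i \<in> charts A \<Longrightarrow> open (cimage A i)"
  using open_overlap[of i i] by (simp add: overlap_def cimage_def)

lemma overlap_iff:
  "i \<in> charts A \<Longrightarrow> x \<in> overlap i j \<longleftrightarrow> x \<in> cimage A i \<and> cinv A i x \<in> cdom A j"
  unfolding overlap_def cimage_def by (auto simp: cinv_cmap)

lemma overlap_subset: "overlap i j \<subseteq> cimage A i"
  by (auto simp: overlap_def cimage_def)

lemma cmap_in_overlap: "q \<in> cdom A i \<Longrightarrow> q \<in> cdom A j \<Longrightarrow> cmap A i q \<in> overlap i j"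
  by (simp add: overlap_def)

lemma smooth_on_transition: "i \<in> charts A \<Longrightarrow> j \<in> charts A \<Longrightarrow> smooth_on (overlap i j) (\<tau> i j)"
  using smooth_atlas by (simp add: smooth_atlas_def overlap_def)

lemma transition_cmap: "i \<in> charts A \<Longrightarrow> q \<in> cdom A i \<Longrightarrow> \<tau> i j (cmap A i q) = cmap A j q"
  by (simp add: transition_def cinv_cmap)

lemma cinv_transition:
  "i \<in> charts A \<Longrightarrow> j \<in> charts A \<Longrightarrow> x \<in> overlap i j \<Longrightarrow> cinv A j (\<tau> i j x) = cinv A i x"
  by (auto simp: overlap_def transition_cmap cinv_cmap)

lemma transition_in_overlap:
  "i \<in> charts A \<Longrightarrow> j \<in> charts A \<Longrightarrow> x \<in> overlap i j \<Longrightarrow> \<tau> i j x \<in> overlap j i"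
  by (auto simp: overlap_def transition_cmap)

definition dtau :: "'i \<Rightarrow> 'i \<Rightarrow> 'e \<Rightarrow> 'e \<Rightarrow> 'e" where
  "dtau i j x = frechet_derivative (\<tau> i j) (at x)"

lemma dtau: "i \<in> charts A \<Longrightarrow> j \<in> charts A \<Longrightarrow> x \<in> overlap i j \<Longrightarrow> (\<tau> i j has_derivative dtau i j x) (at x)"
  unfolding dtau_def by (rule smooth_on_has_derivative[OF smooth_on_transition])

lemma dtau_chain:
  assumes "i \<in> charts A" "j \<in> charts A" "l \<in> charts A" "x \<in> overlap i j" "x \<in> overlap i l"
  shows "dtau j l (\<tau> i j x) (dtau i j x v) = dtau i l x v"
proof -
  have 0: "\<tau> i j x \<in> overlap j l"
    using assms by (auto simp: overlap_iff transition_in_overlap cinv_transition)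
       (metis assms overlap_iff transition_in_overlap)
  have 1: "(\<tau> j l \<circ> \<tau> i j has_derivative dtau j l (\<tau> i j x) \<circ> dtau i j x) (at x)"
    using diff_chain_at dtau assms 0 by blast
  have "(\<tau> i l has_derivative dtau j l (\<tau> i j x) \<circ> dtau i j x) (at x)"
  proof (rule has_derivative_transform_within_open[OF 1])
    show "open (overlap i j)" using assms by (simp add: open_overlap)
    show "(\<tau> j l \<circ> \<tau> i j) y = \<tau> i l y" if "y \<in> overlap i j" for y
      using that assms by (simp add: transition_def[of A j l] cinv_transition) (simp add: transition_def)
  qed (use assms in auto)
  then have "dtau j l (\<tau> i j x) \<circ> dtau i j x = dtau i l x"
    using dtau[OF assms(1,3,5)] has_derivative_unique by blast
  then show ?thesis by (metis comp_apply)
qed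

lemma dtau_self: "i \<in> charts A \<Longrightarrow> x \<in> cimage A i \<Longrightarrow> dtau i i x v = v"
proof -
  assume i: "i \<in> charts A" and x: "x \<in> cimage A i"
  have "(\<tau> i i has_derivative (\<lambda>v. v)) (at x)"
    by (rule has_derivative_transform_within_open[OF has_derivative_ident open_cimage[OF i] x])
       (simp add: transition_def i cmap_cinv)
  moreover have "(\<tau> i i has_derivative dtau i i x) (at x)"
    using i x by (intro dtau) (auto simp: overlap_def cimage_def)
  ultimately show ?thesis using has_derivative_unique by metis
qed

lemma dtau_inverse:
  assumes "i \<in> charts A" "j \<in> charts A" "x \<in> overlap i j"
  shows "dtau j i (\<tau> i j x) (dtau i j x v) = v"
proof -
  have "x \<in> cimage A i" using assms overlap_subset by blast
  then show ?thesis
    using dtau_chain[OF assms(1,2,1,3), of v] dtau_self[OF assms(1)] assms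
    by (simp add: overlap_def cimage_def)
qed

section \<open>The manifold topology seen in charts\<close>

lemma openin_iff:
  "openin MT S \<longleftrightarrow> S \<subseteq> points A \<and> (\<forall>i\<in>charts A. open (cmap A i ` (S \<inter> cdom A i)))"
  by (rule openin_manifold_topology[OF inj_cmap])

lemma cdom_subset_points: "i \<in> charts A \<Longrightarrow> cdom A i \<subseteq> points A"
  by (auto simp: points_def)

lemma topspace_MT: "topspace MT = points A"
proof -
  have "cmap A i ` (points A \<inter> cdom A i) = cimage A i" if "i \<in> charts A" for i
    using that by (auto simp: cimage_def points_def)
  then have "openin MT (points A)" by (simp add: openin_iff open_cimage)
  then show ?thesis by (meson openin_iff openin_subset openin_topspace subset_antisym)
qed

lemma openin_chart_preimage:
  assumes "i \<in> charts A" "open W"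
  shows "openin MT {q \<in> cdom A i. cmap A i q \<in> W}"
  unfolding openin_iff
proof (intro conjI ballI)
  fix j assume j: "j \<in> charts A"
  have "cmap A j ` ({q \<in> cdom A i. cmap A i q \<in> W} \<inter> cdom A j) = overlap j i \<inter> \<tau> j i -` W"
    using j by (force simp: overlap_def transition_cmap)
  moreover have "open (overlap j i \<inter> \<tau> j i -` W)"
    using assms j by (intro continuous_open_preimage smooth_on_imp_continuous_on smooth_on_transition open_overlap)
  ultimately show "open (cmap A j ` ({q \<in> cdom A i. cmap A i q \<in> W} \<inter> cdom A j))" by simp
qed (use assms in \<open>auto simp: points_def\<close>)

lemma openin_cdom: "i \<in> charts A \<Longrightarrow> openin MT (cdom A i)"
  using openin_chart_preimage[of i UNIV] by simp

lemma cinv_image_eq: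
  "i \<in> charts A \<Longrightarrow> W \<subseteq> cimage A i \<Longrightarrow> cinv A i ` W = {q \<in> cdom A i. cmap A i q \<in> W}"
  by (force simp: cinv_in_cdom cmap_cinv cinv_cmap)

lemma openin_cinv_image: "i \<in> charts A \<Longrightarrow> open W \<Longrightarrow> W \<subseteq> cimage A i \<Longrightarrow> openin MT (cinv A i ` W)"
  by (simp add: cinv_image_eq openin_chart_preimage)

lemma continuous_map_cinv:
  assumes "i \<in> charts A"
  shows "continuous_map (top_of_set (cimage A i)) MT (cinv A i)"
  unfolding continuous_map
proof (intro conjI allI impI)
  show "cinv A i ` topspace (top_of_set (cimage A i)) \<subseteq> topspace MT"
    using assms cinv_in_cdom cdom_subset_points by (auto simp: topspace_MT)
  fix U assume U: "openin MT U"
  have "{x \<in> topspace (top_of_set (cimage A i)). cinv A i x \<in> U} = cmap A i ` (U \<inter> cdom A i)"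
    using assms by (auto simp: cimage_def cinv_cmap)
  then show "openin (top_of_set (cimage A i)) {x \<in> topspace (top_of_set (cimage A i)). cinv A i x \<in> U}"
    using U assms by (auto simp: openin_iff cimage_def intro!: open_subset)
qed

lemma compactin_cinv_image:
  assumes "i \<in> charts A" "compact C" "C \<subseteq> cimage A i"
  shows "compactin MT (cinv A i ` C)"
  by (rule image_compactin[OF _ continuous_map_cinv[OF assms(1)]])
     (use assms in \<open>simp add: compactin_subtopology\<close>)

lemma continuous_map_curve:
  assumes "i \<in> charts A" "continuous_on UNIV u" "range u \<subseteq> cimage A i"
  shows "continuous_map euclideanreal MT (\<lambda>t. cinv A i (u t))"
proof -
  have "continuous_map euclideanreal (top_of_set (cimage A i)) u"
    using assms by (auto simp: continuous_map_in_subtopology)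
  then show ?thesis
    using continuous_map_compose[OF _ continuous_map_cinv[OF assms(1)]] by (simp add: o_def)
qed

lemma curve_in_chart:
  assumes "i \<in> charts A" "continuous_map euclideanreal MT c"
  shows "open {t. c t \<in> cdom A i}" "continuous_on {t. c t \<in> cdom A i} (\<lambda>t. cmap A i (c t))"
proof -
  have *: "open {t. c t \<in> V}" if "openin MT V" for V
    using openin_continuous_map_preimage[OF assms(2) that] by simp
  show o: "open {t. c t \<in> cdom A i}" using * openin_cdom assms by blast
  show "continuous_on {t. c t \<in> cdom A i} (\<lambda>t. cmap A i (c t))"
  proof (subst continuous_on_open_vimage[OF o], intro allI impI)
    fix B :: "'e set" assume "open B"
    then have "open {t. c t \<in> {q \<in> cdom A i. cmap A i q \<in> B}}"
      using * openin_chart_preimage[OF assms(1)] by blast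
    moreover have "{t. c t \<in> {q \<in> cdom A i. cmap A i q \<in> B}} = (\<lambda>t. cmap A i (c t)) -` B \<inter> {t. c t \<in> cdom A i}"
      by auto
    ultimately show "open ((\<lambda>t. cmap A i (c t)) -` B \<inter> {t. c t \<in> cdom A i})" by simp
  qed
qed

section \<open>Smooth functions on a manifold\<close>

lemma smooth_functionD:
  "smooth_function A f \<Longrightarrow> i \<in> charts A \<Longrightarrow> smooth_on (cimage A i) (\<lambda>x. f (cinv A i x))"
  by (simp add: smooth_function_def o_def)

lemma smooth_functionI:
  "(\<And>i. i \<in> charts A \<Longrightarrow> smooth_on (cimage A i) (\<lambda>x. f (cinv A i x))) \<Longrightarrow> smooth_function A f"
  by (simp add: smooth_function_def o_def)

lemma smooth_function_const: "smooth_function A (\<lambda>q. c)"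
  by (intro smooth_functionI smooth_on_const open_cimage)

lemma smooth_function_add:
  "smooth_function A f \<Longrightarrow> smooth_function A g \<Longrightarrow> smooth_function A (\<lambda>q. f q + g q)"
  by (simp add: smooth_function_def o_def smooth_on_add open_cimage)

lemma smooth_function_diff:
  "smooth_function A f \<Longrightarrow> smooth_function A g \<Longrightarrow> smooth_function A (\<lambda>q. f q - g q)"
  by (simp add: smooth_function_def o_def smooth_on_diff open_cimage)

lemma smooth_function_mult:
  "smooth_function A f \<Longrightarrow> smooth_function A g \<Longrightarrow> smooth_function A (\<lambda>q. f q * g q)"
  by (simp add: smooth_function_def o_def smooth_on_mult open_cimage)

lemma smooth_function_sum:
  "(\<And>k. k \<in> K \<Longrightarrow> smooth_function A (f k)) \<Longrightarrow> smooth_function A (\<lambda>q. \<Sum>k\<in>K. f k q)"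
  by (simp add: smooth_function_def o_def smooth_on_sum open_cimage)

lemma smooth_function_prod:
  "(\<And>k. k \<in> K \<Longrightarrow> smooth_function A (f k)) \<Longrightarrow> smooth_function A (\<lambda>q. \<Prod>k\<in>K. f k q)"
  by (simp add: smooth_function_def o_def smooth_on_prod open_cimage)

text \<open>A point outside the chart domain has the complement of L as a neighbourhood on which the
  extension is 0. This is why L must be closed in the manifold and not just in the chart.\<close>

lemma smooth_function_extend:
  assumes i: "i \<in> charts A" and L: "closedin MT L" "L \<subseteq> cdom A i"
    and u: "smooth_on (cimage A i) u" "\<And>x. x \<in> cimage A i \<Longrightarrow> cinv A i x \<notin> L \<Longrightarrow> u x = 0"
  shows "smooth_function A (\<lambda>q. if q \<in> cdom A i then u (cmap A i q) else 0)" (is "smooth_function A ?f")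
proof (rule smooth_functionI, rule smooth_on_local)
  fix j x assume j: "j \<in> charts A" and x: "x \<in> cimage A j"
  show "\<exists>T. open T \<and> x \<in> T \<and> smooth_on T (\<lambda>x. ?f (cinv A j x))"
  proof (cases "cinv A j x \<in> cdom A i")
    case True
    have "smooth_on (overlap j i) (\<lambda>y. u (\<tau> j i y))"
      using transition_in_overlap[OF j i] overlap_subset
      by (intro smooth_on_compose[OF _ smooth_on_transition u(1)] open_overlap i j) blast
    then have "smooth_on (overlap j i) (\<lambda>x. ?f (cinv A j x))"
      by (rule smooth_on_cong[OF open_overlap[OF j i], rotated])
         (use j in \<open>auto simp: overlap_iff transition_def\<close>)
    then show ?thesis using open_overlap[OF j i] True x j by (auto simp: overlap_iff)
  next
    case False
    let ?T = "cmap A j ` ((points A - L) \<inter> cdom A j)"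
    have "openin MT (points A - L)" using L topspace_MT by (metis closedin_def)
    then have T: "open ?T" using j by (simp add: openin_iff)
    have "?f (cinv A j y) = 0" if "y \<in> ?T" for y
    proof (cases "cinv A j y \<in> cdom A i")
      case True
      moreover have "cinv A j y \<notin> L" using that j by (auto simp: cinv_cmap)
      ultimately show ?thesis using u(2)[of "cmap A i (cinv A j y)"] i by (simp add: cinv_cmap cmap_in_cimage)
    qed auto
    then have "smooth_on ?T (\<lambda>x. ?f (cinv A j x))"
      by (intro smooth_on_cong[OF T _ smooth_on_const[OF T, of 0]]) simp
    moreover have "x \<in> ?T" using False L(2) x j cinv_in_cdom[OF j x] cmap_cinv[OF j x] cdom_subset_points[OF j]
      by (metis DiffI IntI image_eqI subsetD)
    ultimately show ?thesis using T by blast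
  qed
qed

section \<open>Differentials and critical points\<close>

definition differential :: "('a \<Rightarrow> real) \<Rightarrow> 'i \<Rightarrow> 'e \<Rightarrow> 'e \<Rightarrow> real" where
  "differential f i x = frechet_derivative (\<lambda>x. f (cinv A i x)) (at x)"

lemma differential:
  "smooth_function A f \<Longrightarrow> i \<in> charts A \<Longrightarrow> x \<in> cimage A i \<Longrightarrow>
     ((\<lambda>x. f (cinv A i x)) has_derivative differential f i x) (at x)"
  unfolding differential_def by (rule smooth_on_has_derivative[OF smooth_functionD])

lemma linear_differential:
  "smooth_function A f \<Longrightarrow> i \<in> charts A \<Longrightarrow> x \<in> cimage A i \<Longrightarrow> linear (differential f i x)"
  using differential has_derivative_linear by blast

lemma differential_transition:
  assumes "smooth_function A f" "i \<in> charts A" "j \<in> charts A" "x \<in> overlap i j"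
  shows "differential f i x v = differential f j (\<tau> i j x) (dtau i j x v)"
proof -
  have t: "\<tau> i j x \<in> cimage A j" using transition_in_overlap[OF assms(2-4)] overlap_subset by blast
  from diff_chain_at[OF dtau[OF assms(2-4)] differential[OF assms(1,3) t]]
  have "((\<lambda>x. f (cinv A i x)) has_derivative differential f j (\<tau> i j x) \<circ> dtau i j x) (at x)"
    by (rule has_derivative_transform_within_open[OF _ open_overlap[OF assms(2,3)] assms(4)])
       (use assms in \<open>simp add: cinv_transition\<close>)
  then show ?thesis
    using differential[OF assms(1,2)] assms(4) overlap_subset has_derivative_unique by (metis comp_apply subsetD)
qed

text \<open>The coefficients of the covector df in the chart, not a gradient for some metric: the
  vector depends on the chart, its vanishing does not.\<close>

definition gradient :: "('a \<Rightarrow> real) \<Rightarrow> 'i \<Rightarrow> 'e \<Rightarrow> 'e" where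
  "gradient f i x = (\<Sum>b\<in>Basis. differential f i x b *\<^sub>R b)"

lemma differential_eq_gradient:
  assumes "smooth_function A f" "i \<in> charts A" "x \<in> cimage A i"
  shows "differential f i x v = gradient f i x \<bullet> v"
  using linear_basis_expansion[OF linear_differential[OF assms], of v]
  by (simp add: gradient_def inner_sum_left mult.commute inner_commute[of v])

lemma gradient_eqI:
  assumes "smooth_function A f" "i \<in> charts A" "x \<in> cimage A i" "\<And>v. differential f i x v = g \<bullet> v"
  shows "gradient f i x = g"
  using assms by (metis differential_eq_gradient vector_eq_rdot)

lemma smooth_on_gradient:
  assumes "smooth_function A f" "i \<in> charts A"
  shows "smooth_on (cimage A i) (gradient f i)"
proof -
  have "smooth_on (cimage A i) (\<lambda>x. \<Sum>b\<in>Basis. differential f i x b *\<^sub>R b)"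
    unfolding differential_def using assms smooth_on_frechet_derivative[OF smooth_functionD[OF assms]]
    by (intro smooth_on_sum smooth_on_scaleR smooth_on_const open_cimage) auto
  then show ?thesis by (simp add: gradient_def[abs_def])
qed

definition crit :: "('a \<Rightarrow> real) \<Rightarrow> 'a set" where
  "crit f = {q \<in> points A. \<forall>i\<in>charts A. q \<in> cdom A i \<longrightarrow> gradient f i (cmap A i q) = 0}"

lemma gradient_eq_0_iff:
  assumes "smooth_function A f" "i \<in> charts A" "x \<in> cimage A i"
  shows "gradient f i x = 0 \<longleftrightarrow> (\<forall>v. differential f i x v = 0)"
  using differential_eq_gradient[OF assms] by (metis inner_eq_zero_iff inner_zero_left)

text \<open>One chart decides, because the differential in any other chart factors through the one
  given.\<close>

lemma crit_iff:
  assumes "smooth_function A f" "i \<in> charts A" "q \<in> cdom A i"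
  shows "q \<in> crit f \<longleftrightarrow> gradient f i (cmap A i q) = 0"
proof -
  have "gradient f j (cmap A j q) = 0" if "gradient f i (cmap A i q) = 0" "j \<in> charts A" "q \<in> cdom A j" for j
  proof -
    have "\<forall>v. differential f j (cmap A j q) v = 0"
      using that assms differential_transition[OF assms(1) that(2) assms(2) cmap_in_overlap[OF that(3) assms(3)]]
      by (simp add: transition_cmap gradient_eq_0_iff cmap_in_cimage)
    then show ?thesis using gradient_eq_0_iff[OF assms(1) that(2)] that cmap_in_cimage by blast
  qed
  then show ?thesis using assms by (auto simp: crit_def points_def)
qed

end

section \<open>Sard's theorem in equal dimensions\<close>

text \<open>The library states Sard's theorem for \<open>real ^ 'n\<close> only; this type indexes the coordinates
  of an arbitrary Euclidean space.\<close>

typedef (overloaded) 'e basis_index = "Basis :: 'e::euclidean_space set"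
  by (metis SOME_Basis)

instance basis_index :: (euclidean_space) finite
proof
  have "(UNIV :: 'a basis_index set) = Abs_basis_index ` Basis"
    by (metis type_definition.Abs_image type_definition_basis_index)
  then show "finite (UNIV :: 'a basis_index set)" by (metis finite_Basis finite_imageI)
qed

text \<open>\<open>baby_Sard\<close> asks for a wellordered finite index type. Any order serves, so
  one is copied from the natural numbers along an arbitrary injection.\<close>

definition basis_code :: "'a::euclidean_space basis_index \<Rightarrow> nat" where
  "basis_code = (SOME f. inj f)"

lemma inj_basis_code: "inj (basis_code :: 'a::euclidean_space basis_index \<Rightarrow> nat)"
proof -
  obtain f :: "'a basis_index \<Rightarrow> nat" where "inj f"
    using finite_imp_inj_to_nat_seg[OF finite[of "UNIV :: 'a basis_index set"]] by auto
  then show ?thesis unfolding basis_code_def by (rule someI[where P = "\<lambda>f. inj f"])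
qed

instantiation basis_index :: (euclidean_space) linorder
begin

definition less_eq_basis_index :: "'a basis_index \<Rightarrow> 'a basis_index \<Rightarrow> bool" where
  "x \<le> y \<longleftrightarrow> basis_code x \<le> basis_code y"

definition less_basis_index :: "'a basis_index \<Rightarrow> 'a basis_index \<Rightarrow> bool" where
  "x < y \<longleftrightarrow> basis_code x < basis_code y"

instance
proof
  fix x y z :: "'a basis_index"
  show "x < y \<longleftrightarrow> x \<le> y \<and> \<not> y \<le> x"
    unfolding less_eq_basis_index_def less_basis_index_def by linarith
  show "x \<le> x" "x \<le> y \<or> y \<le> x"
    unfolding less_eq_basis_index_def by linarith+
  show "x \<le> y \<Longrightarrow> y \<le> z \<Longrightarrow> x \<le> z"
    unfolding less_eq_basis_index_def by linarith
  show "x \<le> y \<Longrightarrow> y \<le> x \<Longrightarrow> x = y"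
    unfolding less_eq_basis_index_def using injD[OF inj_basis_code, of x y] by linarith
qed

end

instance basis_index :: (euclidean_space) wellorder
proof
  fix P :: "'a basis_index \<Rightarrow> bool" and a
  assume step: "\<And>x. (\<And>y. y < x \<Longrightarrow> P y) \<Longrightarrow> P x"
  show "P a"
  proof (induction a rule: measure_induct_rule[where f = basis_code])
    case (less x)
    show ?case by (rule step, rule less, simp only: less_basis_index_def)
  qed
qed

lemma card_basis_index: "CARD('e::euclidean_space basis_index) = DIM('e)"
  by (rule type_definition.card[OF type_definition_basis_index])

definition from_coords :: "real ^ 'e::euclidean_space basis_index \<Rightarrow> 'e" where
  "from_coords y = (\<Sum>i\<in>UNIV. (y $ i) *\<^sub>R Rep_basis_index i)"

definition to_coords :: "'e::euclidean_space \<Rightarrow> real ^ 'e basis_index" where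
  "to_coords x = (\<chi> i. x \<bullet> Rep_basis_index i)"

lemma linear_from_coords: "linear from_coords"
  by (rule linearI) (simp_all add: from_coords_def algebra_simps sum.distrib scaleR_sum_right)

lemma linear_to_coords: "linear to_coords"
  by (rule linearI) (simp_all add: to_coords_def vec_eq_iff algebra_simps)

lemma from_to_coords: "from_coords (to_coords x) = x"
proof -
  have "from_coords (to_coords x) = (\<Sum>i\<in>UNIV. (x \<bullet> Rep_basis_index i) *\<^sub>R Rep_basis_index i)"
    by (simp add: from_coords_def to_coords_def)
  also have "\<dots> = (\<Sum>b\<in>range Rep_basis_index. (x \<bullet> b) *\<^sub>R b)"
    by (subst sum.reindex) (auto simp: inj_on_def Rep_basis_index_inject)
  also have "range Rep_basis_index = (Basis :: 'a set)"
    by (rule type_definition.Rep_range[OF type_definition_basis_index])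
  finally show ?thesis by (simp add: euclidean_representation)
qed

text \<open>A kernel vector forces the rank below the dimension, which is the hypothesis of
  \<open>baby_Sard\<close> once G is conjugated with the coordinate isomorphism. The way back is
  linear between spaces of equal dimension and preserves null sets.\<close>

lemma negligible_singular_values:
  fixes G :: "'e::euclidean_space \<Rightarrow> 'e"
  assumes "\<And>x. x \<in> S \<Longrightarrow> (G has_derivative D x) (at x)"
    and "\<And>x. x \<in> S \<Longrightarrow> \<exists>v. v \<noteq> 0 \<and> D x v = 0"
  shows "negligible (G ` S)"
proof -
  let ?F = "\<lambda>y. to_coords (G (from_coords y)) :: real ^ 'e basis_index"
  let ?D = "\<lambda>y v. to_coords (D (from_coords y) (from_coords v)) :: real ^ 'e basis_index"
  note bl = linear_conv_bounded_linear[THEN iffD1]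
  have "negligible (?F ` (to_coords ` S))"
  proof (rule baby_Sard[where f' = ?D])
    fix y assume "y \<in> to_coords ` S"
    then obtain x where x: "x \<in> S" "from_coords y = x" by (auto simp: from_to_coords)
    have "(from_coords has_derivative from_coords) (at y)"
      by (rule bounded_linear_imp_has_derivative[OF bl[OF linear_from_coords]])
    from diff_chain_at[OF this, of G "D x"] assms(1)[OF x(1)] x(2)
    have "((\<lambda>y. G (from_coords y)) has_derivative (\<lambda>v. D x (from_coords v))) (at y)"
      by (simp add: o_def)
    from bounded_linear.has_derivative[OF bl[OF linear_to_coords] this] x(2)
    have d: "(?F has_derivative ?D y) (at y)" by simp
    then show "(?F has_derivative ?D y) (at y within to_coords ` S)" by (rule has_derivative_at_withinI)
    have lin: "linear (?D y)" by (rule has_derivative_linear[OF d])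
    obtain v where v: "v \<noteq> 0" "D x v = 0" using assms(2)[OF x(1)] by blast
    have "?D y (to_coords v) = 0" using v x linear_0[OF linear_to_coords] by (simp add: from_to_coords)
    moreover have "to_coords v \<noteq> 0" using v(1) from_to_coords[of v] linear_0[OF linear_from_coords] by metis
    ultimately have "\<not> inj (?D y)" using linear_injective_0[OF lin] by blast
    then show "rank (matrix (?D y)) < CARD('e basis_index)"
      using less_rank_noninjective[of "matrix (?D y)"] by (simp only: matrix_vector_mul(2)[OF lin] simp_thms)
  qed simp
  then have "negligible (from_coords ` (?F ` (to_coords ` S)))"
  proof (rule negligible_differentiable_image_negligible[rotated])
    show "from_coords differentiable_on ?F ` to_coords ` S"
      using linear_imp_differentiable_on linear_from_coords by blast
  qed (simp add: card_basis_index)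
  also have "from_coords ` (?F ` (to_coords ` S)) = G ` S"
    by (simp add: image_image from_to_coords)
  finally show ?thesis .
qed

section \<open>Closed manifolds and Morse functions\<close>

locale closed_manifold = atlas A for A :: "('i, 'a, 'e::euclidean_space) atlas" +
  assumes Hausdorff: "Hausdorff_space (manifold_topology A)"
    and compact: "compact_space (manifold_topology A)"
    and connected: "connected_space (manifold_topology A)"
begin

text \<open>In a Hausdorff manifold the compact image of C is closed, as an extension by zero
  requires.\<close>

lemma smooth_function_extend_compact:
  assumes "i \<in> charts A" "compact C" "C \<subseteq> cimage A i" "smooth_on (cimage A i) u"
    "\<And>x. x \<in> cimage A i \<Longrightarrow> x \<notin> C \<Longrightarrow> u x = 0"
  shows "smooth_function A (\<lambda>q. if q \<in> cdom A i then u (cmap A i q) else 0)"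
proof (rule smooth_function_extend[OF assms(1) _ _ assms(4)])
  show "closedin MT (cinv A i ` C)"
    using compactin_imp_closedin[OF Hausdorff compactin_cinv_image[OF assms(1-3)]] .
  show "cinv A i ` C \<subseteq> cdom A i" using assms cinv_in_cdom by blast
qed (use assms(5) in auto)

text \<open>The factor 3 leaves room for bump functions: the balls of radius r already cover, a bump
  is 1 up to radius 2 r and vanishes from 3 r on, still inside the chart.\<close>

lemma chart_cover:
  obtains n :: nat and I c r where
    "\<And>k. k < n \<Longrightarrow> I k \<in> charts A" "\<And>k. k < n \<Longrightarrow> 0 < r k"
    "\<And>k. k < n \<Longrightarrow> cball (c k) (3 * r k) \<subseteq> cimage A (I k)"
    "points A = (\<Union>k<n. cinv A (I k) ` ball (c k) (r k))"
proof -
  define Q where "Q = {p. fst p \<in> charts A \<and> 0 < snd (snd p) \<and> cball (fst (snd p)) (3 * snd (snd p)) \<subseteq> cimage A (fst p)}"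
  define U where "U = (\<lambda>p. cinv A (fst p) ` ball (fst (snd p)) (snd (snd p)))"
  have op: "openin MT (U p)" if "p \<in> Q" for p
  proof -
    have "ball (fst (snd p)) (snd (snd p)) \<subseteq> cball (fst (snd p)) (3 * snd (snd p))"
      using that by (auto simp: Q_def)
    then show ?thesis
      using that unfolding U_def Q_def by (intro openin_cinv_image) auto
  qed
  have "points A \<subseteq> \<Union>(U ` Q)"
  proof
    fix q assume "q \<in> points A"
    then obtain i where i: "i \<in> charts A" "q \<in> cdom A i" by (auto simp: points_def)
    then obtain e where e: "e > 0" "cball (cmap A i q) e \<subseteq> cimage A i"
      using open_contains_cball open_cimage cmap_in_cimage by blast
    then have "(i, cmap A i q, e/3) \<in> Q" using i by (auto simp: Q_def)
    moreover have "q \<in> U (i, cmap A i q, e/3)"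
      using i e by (auto intro!: image_eqI[of _ _ "cmap A i q"] simp: cinv_cmap U_def)
    ultimately show "q \<in> \<Union>(U ` Q)" by blast
  qed
  moreover have "\<forall>S\<in>U ` Q. openin MT S" using op by blast
  ultimately have "\<exists>F. finite F \<and> F \<subseteq> U ` Q \<and> points A \<subseteq> \<Union>F"
    by (intro compact[unfolded compact_space_alt topspace_MT, rule_format] conjI)
  then obtain F where F: "finite F" "F \<subseteq> U ` Q" "points A \<subseteq> \<Union>F" by (elim exE conjE)
  then obtain P where P: "finite P" "P \<subseteq> Q" "points A \<subseteq> \<Union>(U ` P)"
    using finite_subset_image[OF F(1,2)] by (elim exE conjE) simp
  obtain h where h: "bij_betw h {0..<card P} P" using ex_bij_betw_nat_finite[OF P(1)] by blast
  have hP: "h k \<in> Q" if "k < card P" for k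
    using bij_betwE[OF h] that P(2) by auto
  show ?thesis
  proof (rule that[of "card P" "\<lambda>k. fst (h k)" "\<lambda>k. snd (snd (h k))" "\<lambda>k. fst (snd (h k))"])
    have "U ` h ` {..<card P} = U ` P"
      using bij_betw_imp_surj_on[OF h] by (simp add: lessThan_atLeast0)
    then have eq: "\<Union>(U ` P) = (\<Union>k<card P. U (h k))"
      by (simp add: image_image)
    have sub: "U (h k) \<subseteq> points A" if "k < card P" for k
      using openin_subset[OF op[OF hP[OF that]]] by (simp add: topspace_MT)
    have "points A = (\<Union>k<card P. U (h k))"
      by (rule subset_antisym[OF P(3)[unfolded eq] UN_least]) (simp add: sub)
    then show "points A = (\<Union>k<card P. cinv A (fst (h k)) ` ball (fst (snd (h k))) (snd (snd (h k))))"
      by (simp add: U_def)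
  qed (use hP in \<open>auto simp: Q_def\<close>)
qed

section \<open>Morse functions by linear perturbations in charts\<close>

definition hessian :: "('a \<Rightarrow> real) \<Rightarrow> 'i \<Rightarrow> 'e \<Rightarrow> 'e \<Rightarrow> 'e" where
  "hessian f i x = frechet_derivative (gradient f i) (at x)"

lemma hessian:
  "smooth_function A f \<Longrightarrow> i \<in> charts A \<Longrightarrow> x \<in> cimage A i \<Longrightarrow>
     (gradient f i has_derivative hessian f i x) (at x)"
  unfolding hessian_def by (rule smooth_on_has_derivative[OF smooth_on_gradient])

text \<open>The Morse condition on a part K of one chart, so that it can be secured chart by
  chart.\<close>

definition nondegenerate_on :: "'i \<Rightarrow> 'e set \<Rightarrow> ('a \<Rightarrow> real) \<Rightarrow> bool" where
  "nondegenerate_on i K f \<longleftrightarrow> (\<forall>x\<in>K. gradient f i x = 0 \<longrightarrow> (\<forall>v. v \<noteq> 0 \<longrightarrow> hessian f i x v \<noteq> 0))"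

text \<open>Here \<open>\<phi> b\<close> will be a cut-off b-th coordinate function of a chart, so
  that near the relevant ball the linear function with coefficient vector a is added.\<close>

definition perturb :: "('a \<Rightarrow> real) \<Rightarrow> ('e \<Rightarrow> 'a \<Rightarrow> real) \<Rightarrow> 'e \<Rightarrow> 'a \<Rightarrow> real" where
  "perturb f \<phi> a q = f q + (\<Sum>b\<in>Basis. (a \<bullet> b) * \<phi> b q)"

lemma smooth_function_perturb:
  "smooth_function A f \<Longrightarrow> (\<And>b. smooth_function A (\<phi> b)) \<Longrightarrow> smooth_function A (perturb f \<phi> a)"
  unfolding perturb_def by (intro smooth_function_add smooth_function_sum smooth_function_mult smooth_function_const)

lemma gradient_perturb:
  assumes "smooth_function A f" "\<And>b. smooth_function A (\<phi> b)" "i \<in> charts A" "x \<in> cimage A i"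
  shows "gradient (perturb f \<phi> a) i x = gradient f i x + (\<Sum>b\<in>Basis. (a \<bullet> b) *\<^sub>R gradient (\<phi> b) i x)"
proof (rule gradient_eqI[OF smooth_function_perturb[OF assms(1,2)] assms(3,4)])
  fix v
  have "((\<lambda>x. perturb f \<phi> a (cinv A i x)) has_derivative
      (\<lambda>v. differential f i x v + (\<Sum>b\<in>Basis. (a \<bullet> b) * differential (\<phi> b) i x v))) (at x)"
    unfolding perturb_def
    by (rule has_derivative_add[OF differential[OF assms(1,3,4)] has_derivative_sum[OF
        has_derivative_mult_right[OF differential[OF assms(2,3,4)]]]])
  from fun_cong[OF frechet_derivative_at[OF this], of v] have "differential (perturb f \<phi> a) i x v =
      differential f i x v + (\<Sum>b\<in>Basis. (a \<bullet> b) * differential (\<phi> b) i x v)"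
    by (simp only: differential_def[of "perturb f \<phi> a"])
  then show "differential (perturb f \<phi> a) i x v =
      (gradient f i x + (\<Sum>b\<in>Basis. (a \<bullet> b) *\<^sub>R gradient (\<phi> b) i x)) \<bullet> v"
    by (simp add: differential_eq_gradient assms inner_add_left inner_sum_left)
qed

lemma hessian_perturb:
  assumes "smooth_function A f" "\<And>b. smooth_function A (\<phi> b)" "i \<in> charts A" "x \<in> cimage A i"
  shows "hessian (perturb f \<phi> a) i x v = hessian f i x v + (\<Sum>b\<in>Basis. (a \<bullet> b) *\<^sub>R hessian (\<phi> b) i x v)"
proof -
  have "((\<lambda>x. gradient f i x + (\<Sum>b\<in>Basis. (a \<bullet> b) *\<^sub>R gradient (\<phi> b) i x)) has_derivative
      (\<lambda>v. hessian f i x v + (\<Sum>b\<in>Basis. (a \<bullet> b) *\<^sub>R hessian (\<phi> b) i x v))) (at x)"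
    by (rule has_derivative_add[OF hessian[OF assms(1,3,4)] has_derivative_sum[OF
        has_derivative_scaleR_right[OF hessian[OF assms(2,3,4)]]]])
  then have "(gradient (perturb f \<phi> a) i has_derivative
      (\<lambda>v. hessian f i x v + (\<Sum>b\<in>Basis. (a \<bullet> b) *\<^sub>R hessian (\<phi> b) i x v))) (at x)"
    by (rule has_derivative_transform_within_open[OF _ open_cimage[OF assms(3)] assms(4)])
       (simp add: gradient_perturb assms)
  from fun_cong[OF frechet_derivative_at[OF this], of v] show ?thesis by (simp only: hessian_def[of "perturb f \<phi> a"])
qed

text \<open>Stability by compactness: the triples (a, x, v) with unit v that witness degeneracy form
  a compact set, so the parameters a for which one exists form a closed set, and 0 is not among
  them.\<close>

lemma nondegenerate_on_perturb:
  assumes f: "smooth_function A f" "\<And>b. smooth_function A (\<phi> b)" and i: "i \<in> charts A"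
    and K: "compact K" "K \<subseteq> cimage A i" "nondegenerate_on i K f"
  obtains e where "e > 0" "\<And>a. norm a < e \<Longrightarrow> nondegenerate_on i K (perturb f \<phi> a)"
proof -
  let ?T = "cball (0::'e) 1 \<times> K \<times> sphere (0::'e) 1"
  define g where "g = (\<lambda>(a, x, v::'e). gradient f i x + (\<Sum>b\<in>Basis. (a \<bullet> b) *\<^sub>R gradient (\<phi> b) i x))"
  define h where "h = (\<lambda>(a, x, v). hessian f i x v + (\<Sum>b\<in>Basis. (a \<bullet> b) *\<^sub>R hessian (\<phi> b) i x v))"
  have T: "compact ?T" by (intro compact_Times compact_cball compact_sphere K)
  have cg: "continuous_on ?T (\<lambda>p. gradient u i (fst (snd p)))" if "smooth_function A u" for u
    by (rule continuous_on_compose2[OF smooth_on_imp_continuous_on[OF smooth_on_gradient[OF that i]]])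
       (use K in \<open>auto intro!: continuous_intros\<close>)
  have ch: "continuous_on ?T (\<lambda>p. hessian u i (fst (snd p)) (snd (snd p)))" if "smooth_function A u" for u
  proof -
    have "smooth_on (cimage A i \<times> UNIV) (\<lambda>z. frechet_derivative (gradient u i) (at (fst z)) (snd z))"
      using open_cimage[OF i]
      by (intro smooth_on_frechet_derivative_dir[OF _ _ smooth_on_gradient[OF that i]] open_Times smooth_intros) auto
    from smooth_on_imp_continuous_on[OF this]
    have "continuous_on (cimage A i \<times> UNIV) (\<lambda>z. hessian u i (fst z) (snd z))" by (simp add: hessian_def)
    then show ?thesis
      by (rule continuous_on_compose2[where f = snd]) (use K in \<open>auto intro!: continuous_intros\<close>)
  qed
  have "continuous_on ?T g" "continuous_on ?T h"
    unfolding g_def h_def case_prod_beta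
    by (intro continuous_intros cg ch f)+
  then have "continuous_on ?T (\<lambda>p. (g p, h p))" by (intro continuous_intros)
  then have "closed (?T \<inter> (\<lambda>p. (g p, h p)) -` {0})"
    by (rule continuous_closed_preimage) (auto intro: compact_imp_closed T)
  from compact_Int_closed[OF T this] have "compact (?T \<inter> (\<lambda>p. (g p, h p)) -` {0})"
    by (simp only: Int_left_absorb)
  moreover define Z where "Z = fst ` (?T \<inter> (\<lambda>p. (g p, h p)) -` {0})"
  ultimately have cl: "closed Z"
    unfolding Z_def by (intro compact_imp_closed compact_continuous_image continuous_intros)
  have "0 \<notin> Z"
  proof
    assume "0 \<in> Z"
    then obtain x v where "x \<in> K" "norm v = 1" "gradient f i x = 0" "hessian f i x v = 0"
      by (auto simp: Z_def g_def h_def zero_prod_def)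
    then show False using K(3) unfolding nondegenerate_on_def by (metis norm_zero zero_neq_one)
  qed
  then obtain e where e: "e > 0" "ball 0 e \<subseteq> - Z"
    using openE[OF open_Compl[OF cl]] by blast
  show ?thesis
  proof (rule that[of "min e 1"])
    fix a :: 'e assume a: "norm a < min e 1"
    show "nondegenerate_on i K (perturb f \<phi> a)"
      unfolding nondegenerate_on_def
    proof (intro ballI impI allI notI)
      fix x v :: 'e assume x: "x \<in> K" "gradient (perturb f \<phi> a) i x = 0"
        and v: "v \<noteq> 0" "hessian (perturb f \<phi> a) i x v = 0"
      have xi: "x \<in> cimage A i" using x K by auto
      have "linear (hessian (perturb f \<phi> a) i x)"
        by (rule has_derivative_linear[OF hessian[OF smooth_function_perturb[OF f] i xi]])
      \<comment> \<open>The kernel vector is normalised because \<open>Z\<close> records unit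
        vectors only; without that restriction the witness set would not be compact.\<close>
      then have "hessian (perturb f \<phi> a) i x (inverse (norm v) *\<^sub>R v) = 0" using v by (simp add: linear_cmul)
      then have "(a, x, inverse (norm v) *\<^sub>R v) \<in> ?T \<inter> (\<lambda>p. (g p, h p)) -` {0}"
        using x a v xi by (simp add: g_def h_def gradient_perturb hessian_perturb f i zero_prod_def)
      then have "a \<in> Z" unfolding Z_def by (rule image_eqI[rotated]) simp
      then show False using e a by auto
    qed
  qed (use e in auto)
qed

text \<open>On W the perturbation adds the constant a to the gradient and leaves the Hessian alone.
  A degenerate critical point x therefore makes a = - gradient f x a singular value of the negative
  gradient map, and singular values form a null set.\<close>

lemma negligible_degenerate_perturbations:
  assumes f: "smooth_function A f" "\<And>b. smooth_function A (\<phi> b)" and i: "i \<in> charts A"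
    and W: "open W" "W \<subseteq> cimage A i" "\<And>b x. x \<in> W \<Longrightarrow> \<phi> b (cinv A i x) = x \<bullet> b" and K: "K \<subseteq> W"
  shows "negligible {a. \<not> nondegenerate_on i K (perturb f \<phi> a)}"
proof -
  have grad: "gradient (\<phi> b) i x = b" if "x \<in> W" for b x
  proof (rule gradient_eqI[OF f(2) i])
    fix v
    have "((\<lambda>x. x \<bullet> b) has_derivative (\<lambda>v. v \<bullet> b)) (at x)"
      by (auto intro!: derivative_eq_intros)
    then have "((\<lambda>x. \<phi> b (cinv A i x)) has_derivative (\<lambda>v. v \<bullet> b)) (at x)"
      by (rule has_derivative_transform_within_open[OF _ W(1) that]) (simp add: W)
    from fun_cong[OF frechet_derivative_at[OF this], of v] show "differential (\<phi> b) i x v = b \<bullet> v"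
      by (simp only: differential_def inner_commute)
  qed (use that W in auto)
  have hess: "hessian (\<phi> b) i x v = 0" if "x \<in> W" for b x v
  proof -
    have "(gradient (\<phi> b) i has_derivative (\<lambda>v. 0)) (at x)"
      by (rule has_derivative_transform_within_open[OF has_derivative_const W(1) that]) (simp add: grad)
    from fun_cong[OF frechet_derivative_at[OF this], of v] show ?thesis by (simp only: hessian_def)
  qed
  let ?S = "{x \<in> K. \<exists>v. v \<noteq> 0 \<and> hessian f i x v = 0}"
  have "negligible ((\<lambda>x. - gradient f i x) ` ?S)"
  proof (rule negligible_singular_values)
    show "((\<lambda>x. - gradient f i x) has_derivative (\<lambda>v. - hessian f i x v)) (at x)" if "x \<in> ?S" for x
      using that K W by (intro has_derivative_minus hessian f i) auto
  qed auto
  moreover have "{a. \<not> nondegenerate_on i K (perturb f \<phi> a)} \<subseteq> (\<lambda>x. - gradient f i x) ` ?S"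
  proof
    fix a assume "a \<in> {a. \<not> nondegenerate_on i K (perturb f \<phi> a)}"
    then obtain x v where x: "x \<in> K" "gradient (perturb f \<phi> a) i x = 0" "v \<noteq> 0" "hessian (perturb f \<phi> a) i x v = 0"
      by (auto simp: nondegenerate_on_def)
    have xi: "x \<in> W" "x \<in> cimage A i" using x K W by auto
    have "gradient f i x + a = 0" "hessian f i x v = 0"
      using x(2,4) xi
      by (simp_all add: gradient_perturb hessian_perturb f i grad hess euclidean_representation)
    then have "x \<in> ?S" "a = - gradient f i x" using x by (auto simp: eq_neg_iff_add_eq_0 add.commute)
    then show "a \<in> (\<lambda>x. - gradient f i x) ` ?S" by blast
  qed
  ultimately show ?thesis by (rule negligible_subset)
qed

text \<open>The balls of the cover are treated one by one. The next parameter a is taken outside a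
  null set, for the new ball, and so small that the balls already treated stay nondegenerate.
  Nondegenerate critical points are isolated, hence finitely many in each compact ball.\<close>

lemma Morse_function_exists:
  obtains f where "smooth_function A f" "finite (crit f)"
proof -
  obtain n :: nat and I c r where cov: "\<And>k. k < n \<Longrightarrow> I k \<in> charts A" "\<And>k. k < n \<Longrightarrow> 0 < r k"
    "\<And>k. k < n \<Longrightarrow> cball (c k) (3 * r k) \<subseteq> cimage A (I k)"
    "points A = (\<Union>k<n. cinv A (I k) ` ball (c k) (r k))"
    by (rule chart_cover, rule that)
  have "\<exists>f. smooth_function A f \<and> (\<forall>k<m. nondegenerate_on (I k) (cball (c k) (r k)) f)" if "m \<le> n" for m
    using that
  proof (induction m)
    case 0
    then show ?case using smooth_function_const by auto
  next
    case (Suc m)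
    then obtain f where f: "smooth_function A f" "\<And>k. k < m \<Longrightarrow> nondegenerate_on (I k) (cball (c k) (r k)) f"
      by auto
    have m: "m < n" using Suc by simp
    define i where "i = I m"
    have i: "i \<in> charts A" "0 < r m" "cball (c m) (3 * r m) \<subseteq> cimage A i" using cov m by (auto simp: i_def)
    have "0 < 2 * r m" "2 * r m < 3 * r m" using i(2) by auto
    then obtain u :: "'e \<Rightarrow> real" where u: "smooth_on UNIV u" "\<And>x. 0 \<le> u x" "\<And>x. u x \<le> 1"
        "\<And>x. dist (c m) x \<le> 2 * r m \<Longrightarrow> u x = 1" "\<And>x. dist (c m) x \<ge> 3 * r m \<Longrightarrow> u x = 0"
      by (rule smooth_bump_exists[where c = "c m"]) (rule that)
    define \<phi> where "\<phi> b = (\<lambda>q. if q \<in> cdom A i then u (cmap A i q) * (cmap A i q \<bullet> b) else 0)" for b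
    have \<phi>: "smooth_function A (\<phi> b)" for b
      unfolding \<phi>_def
    proof (rule smooth_function_extend_compact[OF i(1) compact_cball i(3), where u = "\<lambda>x. u x * (x \<bullet> b)"])
      show "smooth_on (cimage A i) (\<lambda>x. u x * (x \<bullet> b))"
        by (intro smooth_intros smooth_on_subset[OF u(1)] open_cimage i subset_UNIV)
    qed (use u in auto)
    let ?W = "ball (c m) (2 * r m)"
    have W: "?W \<subseteq> cimage A i" "cball (c m) (r m) \<subseteq> ?W"
      using i by (auto simp: subset_eq)
    have "\<phi> b (cinv A i x) = x \<bullet> b" if "x \<in> ?W" for b x
      using that W i u by (auto simp: \<phi>_def cinv_in_cdom cmap_cinv subset_eq)
    from negligible_degenerate_perturbations[OF f(1) \<phi> i(1) open_ball W(1) this W(2)]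
    have neg: "negligible {a. \<not> nondegenerate_on i (cball (c m) (r m)) (perturb f \<phi> a)}" .
    have "\<exists>e>0. \<forall>a. norm a < e \<longrightarrow> nondegenerate_on (I k) (cball (c k) (r k)) (perturb f \<phi> a)" if "k < m" for k
    proof -
      have kn: "k < n" using that m by simp
      have "cball (c k) (r k) \<subseteq> cball (c k) (3 * r k)" using cov(2)[of k] that m by auto
      then have "cball (c k) (r k) \<subseteq> cimage A (I k)" using cov(3)[of k] that m by auto
      then show ?thesis
        by (rule nondegenerate_on_perturb[where \<phi> = \<phi>, OF f(1) \<phi> cov(1)[OF kn] compact_cball _ f(2)[OF that]]) auto
    qed
    then have "\<forall>k\<in>{..<m}. \<exists>e>0. \<forall>a. norm a < e \<longrightarrow> nondegenerate_on (I k) (cball (c k) (r k)) (perturb f \<phi> a)"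
      by auto
    from bchoice[OF this] obtain e where e: "\<And>k. k < m \<Longrightarrow> e k > 0"
      "\<And>k a. k < m \<Longrightarrow> norm a < e k \<Longrightarrow> nondegenerate_on (I k) (cball (c k) (r k)) (perturb f \<phi> a)"
      by auto
    \<comment> \<open>The inserted 1 gives the minimum a meaning when no earlier ball
      exists.\<close>
    define d where "d = Min (insert 1 (e ` {..<m}))"
    have d: "d > 0" "\<And>k. k < m \<Longrightarrow> d \<le> e k" using e by (auto simp: d_def)
    \<comment> \<open>A ball is not a null set, so some a in it is both small and good for the new
      ball.\<close>
    have "\<not> negligible (ball (0::'e) d)" using d(1) by (intro open_not_negligible) auto
    then have "\<not> ball 0 d \<subseteq> {a. \<not> nondegenerate_on i (cball (c m) (r m)) (perturb f \<phi> a)}"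
      using negligible_subset[OF neg] by blast
    then obtain a where a: "norm a < d" "nondegenerate_on i (cball (c m) (r m)) (perturb f \<phi> a)" by auto
    have "nondegenerate_on (I k) (cball (c k) (r k)) (perturb f \<phi> a)" if "k < Suc m" for k
    proof (cases "k = m")
      case True then show ?thesis using a by (simp add: i_def)
    next
      case False
      then have "k < m" using that by simp
      then show ?thesis using e(2) d(2) a(1) by (meson less_le_trans)
    qed
    then show ?case
      by (intro exI[of _ "perturb f \<phi> a"] conjI allI impI smooth_function_perturb[OF f(1) \<phi>])
  qed
  from this[OF order.refl]
  obtain f where f: "smooth_function A f" "\<And>k. k < n \<Longrightarrow> nondegenerate_on (I k) (cball (c k) (r k)) f"
    by auto
  have fin: "finite (cball (c k) (r k) \<inter> {x. gradient f (I k) x = 0})" if k: "k < n" for k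
  proof (rule finite_not_islimpt_in_compact[OF compact_cball])
    fix x assume x: "x \<in> cball (c k) (r k)"
    have "cball (c k) (r k) \<subseteq> cball (c k) (3 * r k)" using cov(2)[OF k] by auto
    then have xi: "x \<in> cimage A (I k)" using cov(3)[OF k] x by auto
    note h = hessian[OF f(1) cov(1)[OF k] xi]
    have nonzero: "\<exists>e>0. \<forall>y. dist y x < e \<and> y \<noteq> x \<longrightarrow> gradient f (I k) y \<noteq> 0"
    proof (cases "gradient f (I k) x = 0")
      case True
      have lin: "linear (hessian f (I k) x)" by (rule has_derivative_linear[OF h])
      then have "inj (hessian f (I k) x)"
        using f(2)[OF k, unfolded nondegenerate_on_def, rule_format, OF x True] linear_injective_0[OF lin] by blast
      then obtain B where B: "B > 0" "\<And>v. B * norm v \<le> norm (hessian f (I k) x v)"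
        by (rule linear_inj_bounded_below_pos[OF lin]) (rule that)
      \<comment> \<open>The injective Hessian is bounded below by B. Near x the remainder costs at
        most half of that, so the gradient has no other zero there.\<close>
      have "B/2 > 0" using B by simp
      then obtain e where e: "e > 0" "\<And>y. norm (y - x) < e \<Longrightarrow>
          norm (gradient f (I k) y - gradient f (I k) x - hessian f (I k) x (y - x)) \<le> B/2 * norm (y - x)"
        using h[unfolded has_derivative_at_alt, THEN conjunct2, rule_format, of "B/2"] by auto
      have "y = x" if "dist y x < e" "gradient f (I k) y = 0" for y
      proof -
        have "norm (hessian f (I k) x (y - x)) \<le> B/2 * norm (y - x)"
          using e(2)[of y] that True by (simp add: dist_norm)
        then have "B * norm (y - x) \<le> B/2 * norm (y - x)" using B(2)[of "y - x"] by linarith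
        then have "B * norm (y - x) \<le> 0" by linarith
        then show ?thesis using B(1) by (simp add: mult_le_0_iff)
      qed
      then show ?thesis using e(1) by blast
    next
      case False
      have "isCont (gradient f (I k)) x" by (rule has_derivative_continuous[OF h])
      then have "\<exists>e>0. \<forall>y. dist x y < e \<longrightarrow> gradient f (I k) y \<noteq> 0"
        using False by (rule continuous_at_avoid)
      then show ?thesis by (metis dist_commute)
    qed
    then show "\<not> x islimpt {x. gradient f (I k) x = 0}"
      unfolding islimpt_approachable by blast
  qed
  have "crit f \<subseteq> (\<Union>k<n. cinv A (I k) ` (cball (c k) (r k) \<inter> {x. gradient f (I k) x = 0}))"
  proof
    fix q assume q: "q \<in> crit f"
    then obtain k x where k: "k < n" "x \<in> ball (c k) (r k)" "q = cinv A (I k) x"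
      using cov(4) by (auto simp: crit_def)
    have "ball (c k) (r k) \<subseteq> cball (c k) (3 * r k)" using cov(2)[OF k(1)] by auto
    then have xi: "x \<in> cimage A (I k)" using cov(3)[OF k(1)] k(2) by auto
    then have "gradient f (I k) x = 0"
      using q crit_iff[OF f(1) cov(1)[OF k(1)] cinv_in_cdom[OF cov(1)[OF k(1)] xi]] k cmap_cinv[OF cov(1)[OF k(1)] xi]
      by simp
    then show "q \<in> (\<Union>k<n. cinv A (I k) ` (cball (c k) (r k) \<inter> {x. gradient f (I k) x = 0}))"
      using k by (intro UN_I[of k] image_eqI[of _ _ x]) auto
  qed
  then have "finite (crit f)"
    by (rule finite_subset) (intro finite_UN_I finite_imageI fin, auto)
  with f(1) show ?thesis by (rule that)
qed

end

section \<open>Functions with critical points in a prescribed open set\<close>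

text \<open>Used twice: for bump functions, to keep a pushed identity injective, and for vector
  fields, to have a global Lipschitz constant.\<close>

lemma smooth_compact_support_bounded_derivative:
  fixes f :: "'a::euclidean_space \<Rightarrow> 'b::euclidean_space"
  assumes "smooth_on UNIV f" "compact C" "\<And>x. x \<notin> C \<Longrightarrow> f x = 0"
  obtains L where "L > 0" "\<And>x v. norm (frechet_derivative f (at x) v) \<le> L * norm v"
    "\<And>x y. norm (f x - f y) \<le> L * norm (x - y)"
proof -
  let ?D = "\<lambda>x. frechet_derivative f (at x)"
  note D = smooth_on_has_derivative[OF assms(1) UNIV_I]
  have "\<exists>M\<ge>0. \<forall>x. norm (?D x b) \<le> M" for b
  proof -
    have "continuous_on C (\<lambda>x. ?D x b)"
      by (rule continuous_on_subset[OF smooth_on_imp_continuous_on[OF smooth_on_frechet_derivative[OF assms(1)]]]) simp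
    then have "bounded ((\<lambda>x. ?D x b) ` C)"
      using assms(2) compact_continuous_image compact_imp_bounded by blast
    then obtain M where M: "\<And>x. x \<in> C \<Longrightarrow> norm (?D x b) \<le> M"
      unfolding bounded_iff by blast
    have out: "?D x b = 0" if "x \<notin> C" for x
    proof -
      have "?D x = frechet_derivative (\<lambda>_. 0) (at x)"
        by (rule frechet_derivative_transform_open[of "- C"]) (use that assms in \<open>auto simp: compact_imp_closed\<close>)
      then show ?thesis by simp
    qed
    have "norm (?D x b) \<le> max M 0" for x
    proof (cases "x \<in> C")
      case True
      then show ?thesis using M by (simp add: le_max_iff_disj)
    next
      case False
      then show ?thesis using out by simp
    qed
    then show ?thesis by (intro exI[of _ "max M 0"]) simp
  qed
  then have "\<forall>b. \<exists>M. 0 \<le> M \<and> (\<forall>x. norm (?D x b) \<le> M)" by blast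
  from choice[OF this] obtain M where M: "\<And>b. 0 \<le> M b" "\<And>b x. norm (?D x b) \<le> M b" by blast
  \<comment> \<open>The added 1 makes L positive even if f is constant; L is divided by
    later.\<close>
  define L where "L = (\<Sum>b\<in>Basis. M b) + 1"
  have L: "L > 0" unfolding L_def using M(1) by (intro add_nonneg_pos sum_nonneg) auto
  have bound: "norm (?D x v) \<le> L * norm v" for x v
  proof -
    have "?D x v = (\<Sum>b\<in>Basis. (v \<bullet> b) *\<^sub>R ?D x b)"
      by (rule linear_basis_expansion[OF has_derivative_linear[OF D]])
    then have "norm (?D x v) \<le> (\<Sum>b\<in>Basis. norm ((v \<bullet> b) *\<^sub>R ?D x b))" by (simp only: norm_sum)
    also have "\<dots> \<le> (\<Sum>b\<in>Basis. norm v * M b)"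
    proof (rule sum_mono)
      fix b :: 'a assume "b \<in> Basis"
      then show "norm ((v \<bullet> b) *\<^sub>R ?D x b) \<le> norm v * M b"
        using M(2) by (simp add: mult_mono Basis_le_norm)
    qed
    also have "\<dots> \<le> L * norm v" unfolding L_def distrib_right sum_distrib_right by (simp add: mult.commute)
    finally show ?thesis .
  qed
  have "norm (f x - f y) \<le> L * norm (x - y)" for x y
  proof (rule differentiable_bound[OF convex_UNIV])
    show "(f has_derivative ?D z) (at z within UNIV)" for z using D by simp
    show "onorm (?D z) \<le> L" for z by (rule onorm_le) (simp add: bound)
  qed auto
  with L bound show ?thesis by (rule that)
qed

context closed_manifold
begin

text \<open>What the argument uses of a diffeomorphism: functions pull back to smooth functions, and
  no critical point of f(\<theta> q) arises except over critical points of f. In this form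
  composition is immediate and no inverse map has to be built.\<close>

definition admissible :: "('a \<Rightarrow> 'a) \<Rightarrow> bool" where
  "admissible \<theta> \<longleftrightarrow> continuous_map MT MT \<theta> \<and>
     (\<forall>f. smooth_function A f \<longrightarrow> smooth_function A (\<lambda>q. f (\<theta> q)) \<and>
        (\<forall>q\<in>points A. q \<in> crit (\<lambda>q. f (\<theta> q)) \<longrightarrow> \<theta> q \<in> crit f))"

lemma admissible_in_points: "admissible \<theta> \<Longrightarrow> q \<in> points A \<Longrightarrow> \<theta> q \<in> points A"
  unfolding admissible_def by (metis continuous_map_image_subset_topspace image_subset_iff topspace_MT)

lemma admissible_id: "admissible (\<lambda>q. q)"
  by (simp add: admissible_def)

lemma admissible_compose:
  assumes "admissible \<eta>" "admissible \<theta>"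
  shows "admissible (\<lambda>q. \<eta> (\<theta> q))"
  unfolding admissible_def
proof (intro conjI allI impI ballI)
  show "continuous_map MT MT (\<lambda>q. \<eta> (\<theta> q))"
    using assms continuous_map_compose[of MT MT \<theta> MT \<eta>] by (simp add: admissible_def o_def)
  fix f assume "smooth_function A f"
  then have f: "smooth_function A (\<lambda>q. f (\<eta> q))" using assms(1) unfolding admissible_def by simp
  then show "smooth_function A (\<lambda>q. f (\<eta> (\<theta> q)))"
    using assms(2)[unfolded admissible_def, THEN conjunct2, rule_format, of "\<lambda>q. f (\<eta> q)"] by simp
  fix q assume q: "q \<in> points A" "q \<in> crit (\<lambda>q. f (\<eta> (\<theta> q)))"
  then have "\<theta> q \<in> crit (\<lambda>q. f (\<eta> q))"
    using assms(2)[unfolded admissible_def, THEN conjunct2, rule_format, of "\<lambda>q. f (\<eta> q)"] f by simp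
  then show "\<eta> (\<theta> q) \<in> crit f"
    using assms(1)[unfolded admissible_def, THEN conjunct2, rule_format, of f] \<open>smooth_function A f\<close>
      admissible_in_points[OF assms(2) q(1)] by simp
qed

text \<open>For \<open>w\<close> small compared with the derivative of the bump function \<open>h\<close>, the map
  \<open>z \<mapsto> z + h z *\<^sub>R w\<close> is injective with invertible derivative.\<close>

lemma push_point:
  assumes i: "i \<in> charts A" and \<rho>: "\<rho> > 0" "cball x \<rho> \<subseteq> cimage A i"
  obtains \<delta> where "\<delta> > 0" "\<delta> < \<rho>"
    "\<And>y y'. y \<in> ball x \<delta> \<Longrightarrow> y' \<in> ball x \<delta> \<Longrightarrow> \<exists>\<theta>. admissible \<theta> \<and>
       (\<forall>z\<in>points A. \<theta> z = cinv A i y' \<longrightarrow> z = cinv A i y) \<and>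
       (\<forall>z\<in>points A. \<theta> z \<notin> cinv A i ` cball x \<rho> \<longrightarrow> \<theta> z = z)"
proof -
  have "0 < \<rho>/3" "\<rho>/3 < \<rho>/2" using \<rho> by auto
  then obtain h :: "'e \<Rightarrow> real" where h: "smooth_on UNIV h" "\<And>z. 0 \<le> h z" "\<And>z. h z \<le> 1"
      "\<And>z. dist x z \<le> \<rho>/3 \<Longrightarrow> h z = 1" "\<And>z. dist x z \<ge> \<rho>/2 \<Longrightarrow> h z = 0"
    by (rule smooth_bump_exists[where c = x]) (rule that)
  have "h z = 0" if "z \<notin> cball x (\<rho>/2)" for z using that h(5) by simp
  from smooth_compact_support_bounded_derivative[OF h(1) compact_cball this]
  obtain L where L: "L > 0" "\<And>x v. norm (frechet_derivative h (at x) v) \<le> L * norm v"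
    "\<And>x y. norm (h x - h y) \<le> L * norm (x - y)" by (metis)
  \<comment> \<open>Two points of the \<delta>-ball differ by a vector w shorter than 2 \<delta>.
    The bound \<rho>/5 gives \<rho>/2 + 2 \<delta> < \<rho>, so T keeps the ball; the bound 1/(4 L)
    makes z \<mapsto> h z w Lipschitz with constant 1/2.\<close>
  define \<delta> where "\<delta> = min (\<rho>/5) (1 / (4 * L))"
  have \<delta>: "\<delta> > 0" "\<delta> \<le> \<rho>/5" "L * (2 * \<delta>) \<le> 1/2"
    using \<rho> L(1) by (auto simp: \<delta>_def min_def field_simps)
  show ?thesis
  proof (rule that[of \<delta>])
    fix y y' assume y: "y \<in> ball x \<delta>" "y' \<in> ball x \<delta>"
    define w where "w = y' - y"
    have "norm w \<le> dist x y + dist x y'" unfolding w_def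
      by (metis add.commute dist_commute dist_norm dist_triangle)
    then have w: "norm w < 2 * \<delta>" using y by simp
    have Lw: "L * norm w \<le> 1/2" using mult_left_mono[of "norm w" "2*\<delta>" L] w \<delta>(3) L(1) by linarith
    define T where "T z = z + h z *\<^sub>R w" for z
    have T_in: "T z \<in> ball x \<rho>" if "z \<in> cball x (\<rho>/2)" for z
    proof -
      have "norm (h z *\<^sub>R w) \<le> norm w" using h(2)[of z] h(3)[of z] by (simp add: mult_left_le_one_le)
      then have "dist z (T z) < 2 * \<delta>" using w by (simp add: T_def dist_norm)
      then have "dist x (T z) < \<rho>/2 + 2 * \<delta>" using that dist_triangle[of x "T z" z] by simp
      then show ?thesis using \<delta> \<rho> by simp
    qed
    have T_out: "T z = z" if "z \<notin> cball x (\<rho>/2)" for z using that h(5)[of z] by (simp add: T_def)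
    have T_cimage: "T z \<in> cimage A i" if "z \<in> cimage A i" for z
    proof (cases "z \<in> cball x (\<rho>/2)")
      case True
      then show ?thesis using T_in[of z] \<rho>(2) by auto
    next
      case False
      then show ?thesis using T_out that by simp
    qed
    \<comment> \<open>T is the identity plus a map with Lipschitz constant 1/2.\<close>
    have T_inj: "z = z'" if "T z = T z'" for z z'
    proof -
      have "z - z' = (h z' - h z) *\<^sub>R w" using that by (simp add: T_def algebra_simps)
      then have "norm (z - z') = \<bar>h z' - h z\<bar> * norm w" by simp
      also have "\<dots> \<le> L * norm (z' - z) * norm w"
        using L(3)[of z' z] by (intro mult_right_mono) auto
      also have "\<dots> = (L * norm w) * norm (z - z')" by (simp add: norm_minus_commute)
      also have "\<dots> \<le> 1/2 * norm (z - z')" using Lw by (intro mult_right_mono) auto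
      finally show ?thesis by simp
    qed
    define DT where "DT z v = v + frechet_derivative h (at z) v *\<^sub>R w" for z v
    have DT: "(T has_derivative DT z) (at z)" for z
      unfolding T_def[abs_def] DT_def[abs_def]
      by (intro has_derivative_add has_derivative_ident has_derivative_scaleR_left
          smooth_on_has_derivative[OF h(1)] UNIV_I)
    \<comment> \<open>The same estimate on derivatives excludes a kernel, and in finite dimension
      injectivity gives surjectivity.\<close>
    have DT_surj: "surj (DT z)" for z
    proof -
      have lin: "linear (DT z)" by (rule has_derivative_linear[OF DT])
      have "v = 0" if "DT z v = 0" for v
      proof -
        have "v = - (frechet_derivative h (at z) v *\<^sub>R w)" using that by (simp add: DT_def eq_neg_iff_add_eq_0)
        then have "norm v = \<bar>frechet_derivative h (at z) v\<bar> * norm w" by (metis norm_minus_cancel norm_scaleR)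
        also have "\<dots> \<le> L * norm v * norm w" using L(2)[of z v] by (intro mult_right_mono) auto
        also have "\<dots> = (L * norm w) * norm v" by simp
        also have "\<dots> \<le> 1/2 * norm v" using Lw by (intro mult_right_mono) auto
        finally show ?thesis by simp
      qed
      then have "inj (DT z)" using linear_injective_0[OF lin] by blast
      then show ?thesis using linear_injective_imp_surjective[OF lin] by blast
    qed
    have T_smooth: "smooth_on UNIV T"
      unfolding T_def[abs_def] by (intro smooth_intros h open_UNIV)
    define C where "C = cinv A i ` cball x (\<rho>/2)"
    have sub: "cball x (\<rho>/2) \<subseteq> cball x \<rho>" using \<rho>(1) by auto
    have C: "closedin MT C" "C \<subseteq> cdom A i"
      unfolding C_def using \<rho>(2) sub cinv_in_cdom[OF i]
      by (auto intro!: compactin_imp_closedin[OF Hausdorff] compactin_cinv_image i)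
    have Co: "openin MT (points A - C)" using C(1) topspace_MT by (metis closedin_def)
    define \<theta> where "\<theta> q = (if q \<in> cdom A i then cinv A i (T (cmap A i q)) else q)" for q
    have \<theta>_chart: "\<theta> (cinv A i z) = cinv A i (T z)" if "z \<in> cimage A i" for z
      using that i by (simp add: \<theta>_def cinv_in_cdom cmap_cinv)
    have \<theta>_out: "\<theta> q = q" if "q \<notin> C" for q
    proof (cases "q \<in> cdom A i")
      case True
      have "cmap A i q \<notin> cball x (\<rho>/2)"
      proof
        assume "cmap A i q \<in> cball x (\<rho>/2)"
        then have "cinv A i (cmap A i q) \<in> C" unfolding C_def by (rule imageI)
        then show False using that True i by (simp add: cinv_cmap)
      qed
      then show ?thesis using True i T_out by (simp add: \<theta>_def cinv_cmap)
    qed (simp add: \<theta>_def)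
    have \<theta>_points: "\<theta> q \<in> points A" if "q \<in> points A" for q
    proof (cases "q \<in> cdom A i")
      case True
      then have "\<theta> q \<in> cdom A i"
        using cinv_in_cdom[OF i T_cimage[OF cmap_in_cimage[OF True]]] by (simp add: \<theta>_def)
      then show ?thesis using cdom_subset_points[OF i] by auto
    qed (use that in \<open>simp add: \<theta>_def\<close>)
    have cont: "continuous_map MT MT \<theta>"
      unfolding continuous_map topspace_MT
    proof (intro conjI allI impI)
      show "\<theta> ` points A \<subseteq> points A" using \<theta>_points by auto
      fix V assume V: "openin MT V"
      let ?W = "cimage A i \<inter> T -` (cmap A i ` (V \<inter> cdom A i))"
      have "open ?W"
        using V i smooth_on_imp_continuous_on[OF T_smooth] open_cimage[OF i]
        by (intro continuous_open_preimage) (auto simp: openin_iff intro: continuous_on_subset)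
      then have 1: "openin MT {q \<in> cdom A i. cmap A i q \<in> ?W}" by (rule openin_chart_preimage[OF i])
      \<comment> \<open>In the chart \<theta> is T, off C it is the identity; each description
        contributes an open set, and together they exhaust the preimage.\<close>
      have "{q \<in> points A. \<theta> q \<in> V} = {q \<in> cdom A i. cmap A i q \<in> ?W} \<union> (V \<inter> (points A - C))" (is "?l = ?r")
      proof (rule set_eqI)
        fix q
        show "q \<in> ?l \<longleftrightarrow> q \<in> ?r"
        proof (cases "q \<in> cdom A i")
          case True
          have qp: "q \<in> points A" using True cdom_subset_points[OF i] by auto
          have Tq: "T (cmap A i q) \<in> cimage A i" by (rule T_cimage[OF cmap_in_cimage[OF True]])
          have "T (cmap A i q) \<in> cmap A i ` (V \<inter> cdom A i) \<longleftrightarrow> \<theta> q \<in> V"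
          proof
            assume "T (cmap A i q) \<in> cmap A i ` (V \<inter> cdom A i)"
            then obtain p where "p \<in> V" "p \<in> cdom A i" "T (cmap A i q) = cmap A i p" by auto
            then show "\<theta> q \<in> V" using True i by (simp add: \<theta>_def cinv_cmap)
          next
            assume "\<theta> q \<in> V"
            then have "cinv A i (T (cmap A i q)) \<in> V" using True by (simp add: \<theta>_def)
            then show "T (cmap A i q) \<in> cmap A i ` (V \<inter> cdom A i)"
              using cmap_cinv[OF i Tq] cinv_in_cdom[OF i Tq] by (metis IntI image_eqI)
          qed
          moreover have "q \<in> V \<Longrightarrow> q \<notin> C \<Longrightarrow> \<theta> q \<in> V" using \<theta>_out by simp
          ultimately show ?thesis using True qp cmap_in_cimage[OF True] by auto
        next
          case False
          then have "q \<notin> C" using C(2) by auto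
          then show ?thesis using False \<theta>_out by auto
        qed
      qed
      moreover have "openin MT (V \<inter> (points A - C))" using V Co by (rule openin_Int)
      ultimately show "openin MT {q \<in> points A. \<theta> q \<in> V}" using 1 by (simp add: openin_Un)
    qed
    have away: "cmap A j ` ((points A - C) \<inter> cdom A j) = {z \<in> cimage A j. cinv A j z \<notin> C}"
      "open {z \<in> cimage A j. cinv A j z \<notin> C}" if j: "j \<in> charts A" for j
    proof -
      show "cmap A j ` ((points A - C) \<inter> cdom A j) = {z \<in> cimage A j. cinv A j z \<notin> C}"
        using cdom_subset_points[OF j] by (auto simp: cimage_def cinv_cmap j)
      then show "open {z \<in> cimage A j. cinv A j z \<notin> C}" using Co j unfolding openin_iff by metis
    qed
    have smooth: "smooth_function A (\<lambda>q. f (\<theta> q))" if f: "smooth_function A f" for f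
    proof (rule smooth_functionI, rule smooth_on_local)
      fix j z assume j: "j \<in> charts A" and z: "z \<in> cimage A j"
      show "\<exists>S. open S \<and> z \<in> S \<and> smooth_on S (\<lambda>x. f (\<theta> (cinv A j x)))"
      proof (cases "cinv A j z \<in> cdom A i")
        case True
        have o: "open (overlap j i)" by (rule open_overlap[OF j i])
        have \<tau>: "\<tau> j i ` overlap j i \<subseteq> cimage A i"
          using transition_in_overlap[OF j i] overlap_subset by blast
        have "smooth_on (overlap j i) (\<lambda>y. T (\<tau> j i y))"
          by (rule smooth_on_compose[OF o smooth_on_transition[OF j i] T_smooth]) simp
        then have "smooth_on (overlap j i) (\<lambda>y. f (cinv A i (T (\<tau> j i y))))"
          by (rule smooth_on_compose[OF o _ smooth_functionD[OF f i]]) (use \<tau> T_cimage in auto)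
        then have "smooth_on (overlap j i) (\<lambda>x. f (\<theta> (cinv A j x)))"
        proof (rule smooth_on_cong[OF o, rotated])
          fix y assume y: "y \<in> overlap j i"
          have "\<theta> (cinv A i (\<tau> j i y)) = cinv A i (T (\<tau> j i y))" using \<tau> y by (intro \<theta>_chart) auto
          then show "f (cinv A i (T (\<tau> j i y))) = f (\<theta> (cinv A j y))" using cinv_transition[OF j i y] by simp
        qed
        then show ?thesis using o True z j by (auto simp: overlap_iff)
      next
        case False
        let ?S = "{z \<in> cimage A j. cinv A j z \<notin> C}"
        have "smooth_on ?S (\<lambda>x. f (cinv A j x))"
          by (rule smooth_on_subset[OF smooth_functionD[OF f j]]) auto
        then have "smooth_on ?S (\<lambda>x. f (\<theta> (cinv A j x)))"
          by (rule smooth_on_cong[OF away(2)[OF j], rotated]) (simp add: \<theta>_out)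
        moreover have "z \<in> ?S" using False C(2) z by auto
        ultimately show ?thesis using away(2)[OF j] by blast
      qed
    qed
    have crit: "\<theta> q \<in> crit f" if f: "smooth_function A f" and q: "q \<in> points A" "q \<in> crit (\<lambda>q. f (\<theta> q))" for f q
    proof (cases "q \<in> cdom A i")
      case True
      let ?z = "cmap A i q"
      have z: "?z \<in> cimage A i" by (rule cmap_in_cimage[OF True])
      have "((\<lambda>z. f (cinv A i (T z))) has_derivative (\<lambda>v. differential f i (T ?z) (DT ?z v))) (at ?z)"
        using diff_chain_at[OF DT differential[OF f i T_cimage[OF z]]] by (simp add: o_def)
      then have "((\<lambda>z. f (\<theta> (cinv A i z))) has_derivative (\<lambda>v. differential f i (T ?z) (DT ?z v))) (at ?z)"
        by (rule has_derivative_transform_within_open[OF _ open_cimage[OF i] z]) (simp add: \<theta>_chart)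
      from frechet_derivative_at[OF this]
      have "differential (\<lambda>q. f (\<theta> q)) i ?z v = differential f i (T ?z) (DT ?z v)" for v
        unfolding differential_def[of "\<lambda>q. f (\<theta> q)"] by metis
      moreover have "gradient (\<lambda>q. f (\<theta> q)) i ?z = 0" using crit_iff[OF smooth[OF f] i True] q(2) by simp
      ultimately have "differential f i (T ?z) (DT ?z v) = 0" for v
        using gradient_eq_0_iff[OF smooth[OF f] i z] by simp
      \<comment> \<open>Surjectivity of the derivative: df vanishes on its whole image, hence
        everywhere.\<close>
      then have "differential f i (T ?z) u = 0" for u using DT_surj[of ?z] by (metis surjD)
      then have "gradient f i (T ?z) = 0" using gradient_eq_0_iff[OF f i T_cimage[OF z]] by simp
      then have "cinv A i (T ?z) \<in> crit f"
        using crit_iff[OF f i cinv_in_cdom[OF i T_cimage[OF z]]] cmap_cinv[OF i T_cimage[OF z]] by simp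
      then show ?thesis using True by (simp add: \<theta>_def)
    next
      case False
      then have qC: "q \<notin> C" using C(2) by auto
      obtain j where j: "j \<in> charts A" "q \<in> cdom A j" using q(1) by (auto simp: points_def)
      have "differential (\<lambda>q. f (\<theta> q)) j (cmap A j q) = differential f j (cmap A j q)"
        unfolding differential_def
        by (rule frechet_derivative_transform_open[OF away(2)[OF j(1)]])
           (use j qC in \<open>auto simp: \<theta>_out cinv_cmap cmap_in_cimage\<close>)
      then have "gradient f j (cmap A j q) = gradient (\<lambda>q. f (\<theta> q)) j (cmap A j q)" by (simp add: gradient_def)
      also have "\<dots> = 0" using crit_iff[OF smooth[OF f] j] q(2) by simp
      finally show ?thesis using crit_iff[OF f j] \<theta>_out[OF qC] by simp
    qed
    have yi: "y \<in> cimage A i" "y' \<in> cimage A i" using y \<delta>(2) \<rho> by (auto simp: subset_eq)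
    have "h y = 1" using y(1) \<delta>(2) \<rho> by (intro h(4)) simp
    then have Ty: "T y = y'" by (simp add: T_def w_def)
    have uniq: "z = cinv A i y" if "\<theta> z = cinv A i y'" for z
    proof (cases "z \<in> cdom A i")
      case True
      then have "cinv A i (T (cmap A i z)) = cinv A i y'" using that by (simp add: \<theta>_def)
      then have "T (cmap A i z) = y'"
        using cmap_cinv[OF i T_cimage[OF cmap_in_cimage[OF True]]] cmap_cinv[OF i yi(2)] by metis
      then have "cmap A i z = y" using T_inj Ty by metis
      then show ?thesis using cinv_cmap[OF i True] by simp
    next
      case False
      then show ?thesis using that cinv_in_cdom[OF i yi(2)] by (simp add: \<theta>_def)
    qed
    have outside: "\<theta> z = z" if "\<theta> z \<notin> cinv A i ` cball x \<rho>" for z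
    proof (rule ccontr)
      assume "\<theta> z \<noteq> z"
      then have "z \<in> C" using \<theta>_out by blast
      then obtain u where u: "u \<in> cball x (\<rho>/2)" "z = cinv A i u" by (auto simp: C_def)
      have "u \<in> cimage A i" using u(1) sub \<rho>(2) by blast
      then have "\<theta> z = cinv A i (T u)" using \<theta>_chart u(2) by simp
      moreover have "T u \<in> cball x \<rho>" using T_in[OF u(1)] by auto
      ultimately show False using that by blast
    qed
    have "admissible \<theta>" unfolding admissible_def using cont smooth crit by blast
    then show "\<exists>\<theta>. admissible \<theta> \<and> (\<forall>z\<in>points A. \<theta> z = cinv A i y' \<longrightarrow> z = cinv A i y) \<and>
       (\<forall>z\<in>points A. \<theta> z \<notin> cinv A i ` cball x \<rho> \<longrightarrow> \<theta> z = z)"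
      using uniq outside by blast
  qed (use \<delta> \<rho> in auto)
qed

text \<open>The complement is the image of the compact set \<open>points A - U\<close>, and compact
  sets are closed in a Hausdorff space.\<close>

lemma preimage_in_open_is_open:
  assumes "admissible \<theta>" "openin MT U"
  shows "openin MT {v \<in> points A. \<forall>z\<in>points A. \<theta> z = v \<longrightarrow> z \<in> U}"
proof -
  have "closedin MT (points A - U)" using assms(2) topspace_MT by (metis openin_closedin_eq)
  then have "compactin MT (points A - U)" using compact closedin_compact_space by blast
  then have "compactin MT (\<theta> ` (points A - U))"
    using assms(1) image_compactin unfolding admissible_def by blast
  then have "closedin MT (\<theta> ` (points A - U))" using compactin_imp_closedin[OF Hausdorff] by blast
  then have "openin MT (points A - \<theta> ` (points A - U))" using topspace_MT by (metis closedin_def)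
  moreover have "{v \<in> points A. \<forall>z\<in>points A. \<theta> z = v \<longrightarrow> z \<in> U} = points A - \<theta> ` (points A - U)" by auto
  ultimately show ?thesis by simp
qed

text \<open>Induction over P. With P already dealt with, the positions x for which P and x can be
  handled together form a set Z that is open and closed, hence all of the connected manifold. Points
  of P are interior to Z, so the argument never needs the complement of P to be connected, which it
  need not be in dimension one.\<close>

lemma move_finite_set:
  assumes U: "openin MT U" "U \<noteq> {}"
  shows "finite P \<Longrightarrow> P \<subseteq> points A \<Longrightarrow> \<exists>\<theta>. admissible \<theta> \<and> (\<forall>z\<in>points A. \<theta> z \<in> P \<longrightarrow> z \<in> U)"
proof (induction P rule: finite_induct)
  case empty
  then show ?case using admissible_id by auto
next
  case (insert p P)
  then obtain \<theta>0 where \<theta>0: "admissible \<theta>0" "\<And>z. z \<in> points A \<Longrightarrow> \<theta>0 z \<in> P \<Longrightarrow> z \<in> U" by auto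
  define Z where "Z = {x \<in> points A. \<exists>\<theta>. admissible \<theta> \<and> (\<forall>z\<in>points A. \<theta> z \<in> insert x P \<longrightarrow> z \<in> U)}"
  \<comment> \<open>The positions for which the old map \<theta>0 already works; V is open and
    contains P.\<close>
  define V where "V = {v \<in> points A. \<forall>z\<in>points A. \<theta>0 z = v \<longrightarrow> z \<in> U}"
  have V: "openin MT V" unfolding V_def by (rule preimage_in_open_is_open[OF \<theta>0(1) U(1)])
  have VZ: "V \<subseteq> Z" using \<theta>0 by (auto simp: V_def Z_def)
  have PV: "P \<subseteq> V" using \<theta>0 insert.prems by (auto simp: V_def)
  \<comment> \<open>Local homogeneity: off P, membership in Z passes between any two points of a
    small neighbourhood. This gives openness of Z and of its complement at once.\<close>
  have local: "\<exists>N. openin MT N \<and> x \<in> N \<and> (\<forall>a\<in>N. \<forall>b\<in>N. a \<in> Z \<longrightarrow> b \<in> Z)" if x: "x \<in> points A" "x \<notin> P" for x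
  proof -
    obtain i where i: "i \<in> charts A" "x \<in> cdom A i" using x(1) by (auto simp: points_def)
    let ?x = "cmap A i x"
    have "finite (cmap A i ` (P \<inter> cdom A i))" using insert.hyps by simp
    \<comment> \<open>The chart ball avoids P, so that pushing x inside it leaves the points of P
      and their preimages where they are.\<close>
    then have "open (cimage A i - cmap A i ` (P \<inter> cdom A i))"
      by (intro open_Diff open_cimage i finite_imp_closed)
    moreover have "?x \<in> cimage A i - cmap A i ` (P \<inter> cdom A i)"
      using i x inj_cmap[OF i(1)] by (auto simp: cimage_def inj_on_def)
    ultimately obtain \<rho> where \<rho>: "\<rho> > 0" "cball ?x \<rho> \<subseteq> cimage A i - cmap A i ` (P \<inter> cdom A i)"
      using open_contains_cball by blast
    have \<rho>i: "cball ?x \<rho> \<subseteq> cimage A i" using \<rho>(2) by blast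
    have Pout: "q \<notin> cinv A i ` cball ?x \<rho>" if "q \<in> P" for q
    proof
      assume "q \<in> cinv A i ` cball ?x \<rho>"
      then obtain u where u: "u \<in> cball ?x \<rho>" "q = cinv A i u" by auto
      then have "u \<in> cimage A i" using \<rho>i by auto
      then have "u = cmap A i q" "q \<in> cdom A i" using u(2) i by (auto simp: cmap_cinv cinv_in_cdom)
      then show False using that u(1) \<rho>(2) by blast
    qed
    obtain \<delta> where \<delta>: "\<delta> > 0" "\<delta> < \<rho>" "\<And>y y'. y \<in> ball ?x \<delta> \<Longrightarrow> y' \<in> ball ?x \<delta> \<Longrightarrow> \<exists>\<theta>. admissible \<theta> \<and>
       (\<forall>z\<in>points A. \<theta> z = cinv A i y' \<longrightarrow> z = cinv A i y) \<and>
       (\<forall>z\<in>points A. \<theta> z \<notin> cinv A i ` cball ?x \<rho> \<longrightarrow> \<theta> z = z)"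
      by (rule push_point[OF i(1) \<rho>(1) \<rho>i]) (rule that)
    have sub: "ball ?x \<delta> \<subseteq> cball ?x \<rho>" using \<delta>(2) by auto
    have "openin MT (cinv A i ` ball ?x \<delta>)" using sub \<rho>i i by (intro openin_cinv_image) auto
    moreover have "x \<in> cinv A i ` ball ?x \<delta>"
      using \<delta>(1) i by (intro image_eqI[of _ _ ?x]) (auto simp: cinv_cmap)
    moreover have "b \<in> Z" if ab: "a \<in> cinv A i ` ball ?x \<delta>" "b \<in> cinv A i ` ball ?x \<delta>" and a: "a \<in> Z" for a b
    proof -
      obtain y y' where y: "y \<in> ball ?x \<delta>" "a = cinv A i y" "y' \<in> ball ?x \<delta>" "b = cinv A i y'" using ab by auto
      obtain \<eta> where \<eta>: "admissible \<eta>" "\<And>z. z \<in> points A \<Longrightarrow> \<eta> z = b \<Longrightarrow> z = a"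
        "\<And>z. z \<in> points A \<Longrightarrow> \<eta> z \<notin> cinv A i ` cball ?x \<rho> \<Longrightarrow> \<eta> z = z"
        using \<delta>(3)[OF y(1,3)] y(2,4) by blast
      obtain \<theta> where \<theta>: "admissible \<theta>" "\<And>z. z \<in> points A \<Longrightarrow> \<theta> z \<in> insert a P \<Longrightarrow> z \<in> U"
        using a by (auto simp: Z_def)
      \<comment> \<open>First \<theta>, then the push \<eta>: only a is sent to b, and only points
        of P are sent to P, so \<theta> z already lies in P or equals a.\<close>
      have "z \<in> U" if z: "z \<in> points A" "\<eta> (\<theta> z) \<in> insert b P" for z
      proof -
        have tz: "\<theta> z \<in> points A" by (rule admissible_in_points[OF \<theta>(1) z(1)])
        have "\<theta> z \<in> insert a P"
        proof (cases "\<eta> (\<theta> z) = b")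
          case True
          then show ?thesis using \<eta>(2)[OF tz] by simp
        next
          case False
          then have "\<eta> (\<theta> z) \<in> P" using z(2) by simp
          then show ?thesis using \<eta>(3)[OF tz] Pout by auto
        qed
        then show ?thesis using \<theta>(2) z(1) by blast
      qed
      moreover have "cinv A i y' \<in> points A"
        using y(3) sub \<rho>i cinv_in_cdom[OF i(1)] cdom_subset_points[OF i(1)] by blast
      ultimately show ?thesis
        unfolding Z_def y(4)[symmetric] using admissible_compose[OF \<eta>(1) \<theta>(1)] y(4) by blast
    qed
    ultimately show ?thesis by blast
  qed
  have Zp: "Z \<subseteq> points A" by (auto simp: Z_def)
  have "openin MT Z"
  proof (subst openin_subopen, intro ballI)
    fix x assume x: "x \<in> Z"
    show "\<exists>T. openin MT T \<and> x \<in> T \<and> T \<subseteq> Z"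
    proof (cases "x \<in> P")
      case True
      then show ?thesis using V VZ PV by blast
    next
      case False
      then show ?thesis using local[of x] x Zp by blast
    qed
  qed
  moreover have "openin MT (points A - Z)"
  proof (subst openin_subopen, intro ballI)
    fix x assume x: "x \<in> points A - Z"
    then have "x \<notin> P" using PV VZ by blast
    then obtain N where N: "openin MT N" "x \<in> N" "\<And>a b. a \<in> N \<Longrightarrow> b \<in> N \<Longrightarrow> a \<in> Z \<Longrightarrow> b \<in> Z"
      using local[of x] x by blast
    have "N \<subseteq> points A" using openin_subset[OF N(1)] topspace_MT by simp
    then show "\<exists>T. openin MT T \<and> x \<in> T \<and> T \<subseteq> points A - Z"
      using N x by blast
  qed
  ultimately have "closedin MT Z" "openin MT Z" using Zp topspace_MT by (auto simp: closedin_def)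
  then have "Z = {} \<or> Z = points A"
    using connected topspace_MT by (metis connected_space_clopen_in)
  moreover have "Z \<noteq> {}"
  proof (cases "P = {}")
    case True
    obtain u where u: "u \<in> U" using U(2) by blast
    moreover have "u \<in> points A" using u openin_subset[OF U(1)] topspace_MT by auto
    ultimately have "u \<in> Z" unfolding Z_def using True admissible_id by auto
    then show ?thesis by blast
  next
    case False
    then show ?thesis using PV VZ by blast
  qed
  ultimately have "p \<in> Z" using insert.prems by blast
  then show ?case by (auto simp: Z_def)
qed

text \<open>Precomposing a function with finitely many critical points by a map that takes only
  points of U to them.\<close>

lemma smooth_function_crit_subset:
  assumes "openin MT U" "U \<noteq> {}"
  obtains g where "smooth_function A g" "crit g \<subseteq> U"
proof -
  obtain f where f: "smooth_function A f" "finite (crit f)" by (rule Morse_function_exists)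
  have "crit f \<subseteq> points A" by (auto simp: crit_def)
  then obtain \<theta> where \<theta>: "admissible \<theta>" "\<And>z. z \<in> points A \<Longrightarrow> \<theta> z \<in> crit f \<Longrightarrow> z \<in> U"
    using move_finite_set[OF assms f(2)] by blast
  show ?thesis
  proof (rule that[of "\<lambda>q. f (\<theta> q)"])
    show "smooth_function A (\<lambda>q. f (\<theta> q))" using \<theta>(1) f(1) by (simp add: admissible_def)
    show "crit (\<lambda>q. f (\<theta> q)) \<subseteq> U"
    proof
      fix q assume q: "q \<in> crit (\<lambda>q. f (\<theta> q))"
      then have "q \<in> points A" by (simp add: crit_def)
      moreover from this have "\<theta> q \<in> crit f" using \<theta>(1) f(1) q by (simp add: admissible_def)
      ultimately show "q \<in> U" by (rule \<theta>(2))
    qed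
  qed
qed

end

section \<open>The cotangent bundle as a manifold\<close>

context atlas
begin

abbreviation "TM \<equiv> cotangent_bundle A"

lemma charts_TM [simp]: "charts TM = charts A"
  by (simp add: cotangent_bundle_def)

lemma cdom_TM: "w \<in> cdom TM i \<longleftrightarrow> fst w \<in> cdom A i \<and> snd w \<in> cotangent_space A (fst w)"
  by (auto simp: cotangent_bundle_def)

lemma cmap_TM: "cmap TM i w = (cmap A i (fst w), snd w i)"
  by (simp add: cotangent_bundle_def case_prod_beta)

lemma points_TM: "w \<in> points TM \<longleftrightarrow> fst w \<in> points A \<and> snd w \<in> cotangent_space A (fst w)"
  by (auto simp: points_def cdom_TM)

lemma cimage_TM: "i \<in> charts A \<Longrightarrow> cimage TM i = cimage A i \<times> UNIV"
  by (rule cimage_cotangent_chart[OF smooth_atlas])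

lemma inj_cmap_TM: "i \<in> charts A \<Longrightarrow> inj_on (cmap TM i) (cdom TM i)"
  by (rule inj_on_cotangent_chart[OF smooth_atlas]) simp

lemma cinv_TM:
  assumes "i \<in> charts A" "x \<in> cimage A i"
  shows "cinv TM i (x, y) \<in> cdom TM i" "cmap TM i (cinv TM i (x, y)) = (x, y)"
    "fst (cinv TM i (x, y)) = cinv A i x" "snd (cinv TM i (x, y)) i = y"
proof -
  have "(x, y) \<in> cmap TM i ` cdom TM i" using cimage_TM[OF assms(1)] assms(2) by (simp add: cimage_def)
  then show 1: "cinv TM i (x, y) \<in> cdom TM i" and 2: "cmap TM i (cinv TM i (x, y)) = (x, y)"
    unfolding cinv_def
    using the_inv_into_into[OF inj_cmap_TM[OF assms(1)]] f_the_inv_into_f[OF inj_cmap_TM[OF assms(1)]] by auto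
  have "cmap A i (fst (cinv TM i (x, y))) = x" "snd (cinv TM i (x, y)) i = y"
    using 2 by (auto simp: cmap_TM)
  then show "fst (cinv TM i (x, y)) = cinv A i x" "snd (cinv TM i (x, y)) i = y"
    using 1 cinv_cmap[OF assms(1), of "fst (cinv TM i (x, y))"] by (auto simp: cdom_TM)
qed

section \<open>Changes of charts in the cotangent bundle\<close>

lemma covector_transition:
  assumes "p \<in> cotangent_space A q" "i \<in> charts A" "j \<in> charts A" "q \<in> cdom A i" "q \<in> cdom A j"
  shows "p i \<bullet> v = p j \<bullet> dtau i j (cmap A i q) v"
  using assms unfolding cotangent_space_def dtau_def by blast

lemma covector_component:
  assumes "p \<in> cotangent_space A q" "i \<in> charts A" "j \<in> charts A" "q \<in> cdom A i" "q \<in> cdom A j"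
  shows "p j = (\<Sum>b\<in>Basis. (p i \<bullet> dtau j i (cmap A j q) b) *\<^sub>R b)"
proof -
  have "p j = (\<Sum>b\<in>Basis. (p j \<bullet> b) *\<^sub>R b)" by (simp add: euclidean_representation)
  then show ?thesis using covector_transition[OF assms(1,3,2,5,4)] by simp
qed

lemma overlap_TM:
  assumes "i \<in> charts A" "j \<in> charts A"
  shows "cmap TM i ` (cdom TM i \<inter> cdom TM j) = overlap i j \<times> UNIV"
proof
  show "cmap TM i ` (cdom TM i \<inter> cdom TM j) \<subseteq> overlap i j \<times> UNIV"
    by (auto simp: cmap_TM cdom_TM overlap_def)
  show "overlap i j \<times> UNIV \<subseteq> cmap TM i ` (cdom TM i \<inter> cdom TM j)"
  proof
    fix z :: "'e \<times> 'e" assume "z \<in> overlap i j \<times> UNIV"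
    then obtain x y where z: "z = (x, y)" "x \<in> overlap i j" by auto
    then have x: "x \<in> cimage A i" "cinv A i x \<in> cdom A j" using overlap_iff[OF assms(1)] by auto
    note c = cinv_TM[OF assms(1) x(1), of y]
    have "cinv TM i (x, y) \<in> cdom TM j" using c x by (simp add: cdom_TM)
    then show "z \<in> cmap TM i ` (cdom TM i \<inter> cdom TM j)"
      using c z(1) by (intro image_eqI[of _ _ "cinv TM i (x, y)"]) auto
  qed
qed

text \<open>The fibre part is the inverse transpose of the derivative of the base transition,
  written in the basis so that its smoothness in both variables can be read off.\<close>

lemma transition_TM:
  assumes i: "i \<in> charts A" and j: "j \<in> charts A" and x: "x \<in> overlap i j"
  shows "transition TM i j (x, y) = (\<tau> i j x, \<Sum>b\<in>Basis. (y \<bullet> dtau j i (\<tau> i j x) b) *\<^sub>R b)"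
proof -
  have x': "x \<in> cimage A i" "cinv A i x \<in> cdom A j" "cinv A i x \<in> cdom A i"
    using x overlap_iff[OF i] cinv_in_cdom[OF i] by auto
  note c = cinv_TM[OF i x'(1), of y]
  have p: "snd (cinv TM i (x, y)) \<in> cotangent_space A (cinv A i x)" using c by (simp add: cdom_TM)
  show ?thesis
    using covector_component[OF p i j x'(3,2)] c(3,4) by (simp add: transition_def cmap_TM)
qed

lemma smooth_on_transition_TM:
  assumes i: "i \<in> charts A" and j: "j \<in> charts A"
  shows "smooth_on (overlap i j \<times> UNIV) (transition TM i j)"
proof (rule smooth_on_cong)
  show o: "open (overlap i j \<times> (UNIV :: 'e set))" by (intro open_Times open_overlap i j open_UNIV)
  have fst: "smooth_on (overlap i j \<times> (UNIV :: 'e set)) fst"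
    by (rule smooth_on_bounded_linear_fun[OF o bounded_linear_fst])
  have snd: "smooth_on (overlap i j \<times> (UNIV :: 'e set)) snd"
    by (rule smooth_on_bounded_linear_fun[OF o bounded_linear_snd])
  have t: "smooth_on (overlap i j \<times> (UNIV :: 'e set)) (\<lambda>z. \<tau> i j (fst z))"
    by (rule smooth_on_compose[OF o fst smooth_on_transition[OF i j]]) auto
  have "smooth_on (overlap i j \<times> (UNIV :: 'e set)) (\<lambda>z. dtau j i (\<tau> i j (fst z)) b)" for b
    unfolding dtau_def
    by (rule smooth_on_compose[OF o t smooth_on_frechet_derivative[OF smooth_on_transition[OF j i]]])
       (use transition_in_overlap[OF i j] in auto)
  then show "smooth_on (overlap i j \<times> (UNIV :: 'e set))
      (\<lambda>z. (\<tau> i j (fst z), \<Sum>b\<in>Basis. (snd z \<bullet> dtau j i (\<tau> i j (fst z)) b) *\<^sub>R b))"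
    by (intro smooth_on_Pair smooth_on_sum smooth_on_scaleR smooth_on_inner smooth_on_const o t snd)
  show "(\<tau> i j (fst z), \<Sum>b\<in>Basis. (snd z \<bullet> dtau j i (\<tau> i j (fst z)) b) *\<^sub>R b) = transition TM i j z"
    if "z \<in> overlap i j \<times> UNIV" for z
    using that transition_TM[OF i j, of "fst z" "snd z"] by auto
qed

lemma atlas_TM: "atlas TM"
proof
  show "Defs.smooth_atlas TM"
    unfolding smooth_atlas_def
    by (simp add: inj_cmap_TM overlap_TM open_Times open_overlap smooth_on_transition_TM)
qed

text \<open>Invariance of the canonical form. Differentiating the identity that pairing a covector
  with a vector does not depend on the chart produces second derivatives of the base transition;
  being symmetric, they cancel in the antisymmetric expression. The \<sigma> part is the
  transformation law of a two-form.\<close>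

lemma twisted_form_transition:
  assumes \<sigma>: "two_form A \<sigma>" and i: "i \<in> charts A" and j: "j \<in> charts A" and z: "z \<in> overlap i j \<times> UNIV"
    and D: "(transition TM i j has_derivative D) (at z)"
  shows "twisted_form \<sigma> j (transition TM i j z) (D \<xi>) (D \<eta>) = twisted_form \<sigma> i z \<xi> \<eta>"
proof -
  obtain x y where xy: "z = (x, y)" "x \<in> overlap i j" using z by auto
  have o: "open (overlap i j \<times> (UNIV :: 'e set))" by (intro open_Times open_overlap i j open_UNIV)
  define P where "P = snd (transition TM i j z)"
  define h where "h u v = frechet_derivative (\<lambda>x. dtau i j x v) (at x) u" for u v
  have fstD: "fst (D \<xi>) = dtau i j x (fst \<xi>)" for \<xi>
  proof -
    have 1: "((\<lambda>z. fst (transition TM i j z)) has_derivative (\<lambda>\<xi>. fst (D \<xi>))) (at z)"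
      by (rule has_derivative_fst[OF D])
    have "(\<tau> i j has_derivative dtau i j x) (at (fst z))" using dtau[OF i j xy(2)] xy(1) by simp
    from diff_chain_at[OF bounded_linear_imp_has_derivative[OF bounded_linear_fst] this]
    have "((\<lambda>z. \<tau> i j (fst z)) has_derivative (\<lambda>\<xi>. dtau i j x (fst \<xi>))) (at z)" by (simp add: o_def)
    then have 2: "((\<lambda>z. fst (transition TM i j z)) has_derivative (\<lambda>\<xi>. dtau i j x (fst \<xi>))) (at z)"
      by (rule has_derivative_transform_within_open[OF _ o z]) (use transition_TM[OF i j] in auto)
    show ?thesis using has_derivative_unique[OF 1 2] by metis
  qed
  \<comment> \<open>The identity to be differentiated in z', with v fixed.\<close>
  have pair: "snd (transition TM i j z') \<bullet> dtau i j (fst z') v = snd z' \<bullet> v" if z': "z' \<in> overlap i j \<times> UNIV" for z' v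
  proof -
    have x': "fst z' \<in> cimage A i" "cinv A i (fst z') \<in> cdom A j" "cinv A i (fst z') \<in> cdom A i"
      using z' overlap_iff[OF i] cinv_in_cdom[OF i] by auto
    note c = cinv_TM[OF i x'(1), of "snd z'"]
    have p: "snd (cinv TM i z') \<in> cotangent_space A (cinv A i (fst z'))" using c by (simp add: cdom_TM)
    show ?thesis
      using covector_transition[OF p i j x'(3,2), of v] c(4) cmap_cinv[OF i x'(1)]
      by (simp add: transition_def cmap_TM)
  qed
  have sndD: "snd (D \<xi>) \<bullet> dtau i j x v + P \<bullet> h (fst \<xi>) v = snd \<xi> \<bullet> v" for \<xi> v
  proof -
    have "((\<lambda>x. dtau i j x v) has_derivative (\<lambda>u. h u v)) (at (fst z))"
      using smooth_on_has_derivative[OF smooth_on_frechet_derivative[OF smooth_on_transition[OF i j]] xy(2), of v]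
      by (simp add: h_def[abs_def] dtau_def xy(1))
    from diff_chain_at[OF bounded_linear_imp_has_derivative[OF bounded_linear_fst] this]
    have d: "((\<lambda>z. dtau i j (fst z) v) has_derivative (\<lambda>\<xi>. h (fst \<xi>) v)) (at z)" by (simp add: o_def)
    have 1: "((\<lambda>z. snd (transition TM i j z) \<bullet> dtau i j (fst z) v) has_derivative
        (\<lambda>\<xi>. snd (transition TM i j z) \<bullet> h (fst \<xi>) v + snd (D \<xi>) \<bullet> dtau i j (fst z) v)) (at z)"
      by (rule has_derivative_inner[OF has_derivative_snd[OF D] d])
    have "((\<lambda>z. snd z \<bullet> v) has_derivative (\<lambda>\<xi>. snd \<xi> \<bullet> v)) (at z)"
      by (intro has_derivative_inner_left has_derivative_snd has_derivative_ident)
    then have 2: "((\<lambda>z. snd (transition TM i j z) \<bullet> dtau i j (fst z) v) has_derivative (\<lambda>\<xi>. snd \<xi> \<bullet> v)) (at z)"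
      by (rule has_derivative_transform_within_open[OF _ o z]) (simp add: pair)
    have "snd (transition TM i j z) \<bullet> h (fst \<xi>) v + snd (D \<xi>) \<bullet> dtau i j (fst z) v = snd \<xi> \<bullet> v"
      using has_derivative_unique[OF 1 2] by metis
    then show ?thesis by (simp add: P_def xy(1))
  qed
  have sym: "P \<bullet> h u v = P \<bullet> h v u" for u v
  proof -
    have d1: "frechet_derivative (\<lambda>x. P \<bullet> \<tau> i j x) (at x') w = P \<bullet> dtau i j x' w" if "x' \<in> overlap i j" for x' w
      using frechet_derivative_at[OF has_derivative_inner_right[OF dtau[OF i j that]], of P] by metis
    have d2: "frechet_derivative (\<lambda>y. frechet_derivative (\<lambda>x. P \<bullet> \<tau> i j x) (at y) w) (at x) w' = P \<bullet> h w' w" for w w'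
    proof -
      have "((\<lambda>x. dtau i j x w) has_derivative (\<lambda>u. h u w)) (at x)"
        using smooth_on_has_derivative[OF smooth_on_frechet_derivative[OF smooth_on_transition[OF i j]] xy(2), of w]
        by (simp add: h_def[abs_def] dtau_def)
      from has_derivative_inner_right[OF this, of P]
      have "((\<lambda>y. frechet_derivative (\<lambda>x. P \<bullet> \<tau> i j x) (at y) w) has_derivative (\<lambda>u. P \<bullet> h u w)) (at x)"
        by (rule has_derivative_transform_within_open[OF _ open_overlap[OF i j] xy(2)]) (simp add: d1)
      from frechet_derivative_at[OF this] show ?thesis by metis
    qed
    have "smooth_on (overlap i j) (\<lambda>x. P \<bullet> \<tau> i j x)"
      by (intro smooth_on_inner smooth_on_const open_overlap smooth_on_transition i j)
    from frechet_derivative_commute[OF open_overlap[OF i j] this xy(2)] show ?thesis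
      by (simp add: d2)
  qed
  have s: "\<sigma> j (\<tau> i j x) (dtau i j x u) (dtau i j x v) = \<sigma> i x u v" for u v
    using \<sigma> i j xy(2) unfolding two_form_def overlap_def dtau_def by metis
  have "fst (transition TM i j z) = \<tau> i j x" using transition_TM[OF i j xy(2)] xy(1) by simp
  then show ?thesis
    using sndD[of \<xi> "fst \<eta>"] sndD[of \<eta> "fst \<xi>"] sym[of "fst \<xi>" "fst \<eta>"] s[of "fst \<xi>" "fst \<eta>"]
    by (simp add: twisted_form_def dp_wedge_dq_def pullback_pi_def fstD xy(1))
qed

text \<open>The clause of \<open>hamiltonian_flow\<close> for one curve, one time and one
  chart.\<close>

definition hamilton_eq ::
    "('i, 'e) form2 \<Rightarrow> ('a \<times> ('i \<Rightarrow> 'e) \<Rightarrow> real) \<Rightarrow> (real \<Rightarrow> 'a \<times> ('i \<Rightarrow> 'e)) \<Rightarrow> real \<Rightarrow> 'i \<Rightarrow> bool" where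
  "hamilton_eq \<sigma> G c t i \<longleftrightarrow>
     (\<exists>\<xi>. ((\<lambda>s. cmap TM i (c s)) has_vector_derivative \<xi>) (at t) \<and>
        (\<forall>v. twisted_form \<sigma> i (cmap TM i (c t)) \<xi> v =
           - frechet_derivative (G \<circ> cinv TM i) (at (cmap TM i (c t))) v))"

text \<open>The velocity, the form and dG all transform correctly, so at each time it suffices to
  verify Hamilton's equation in a single chart.\<close>

lemma hamilton_eq_transition:
  assumes \<sigma>: "two_form A \<sigma>" and G: "smooth_function TM G"
    and c: "continuous_map euclideanreal (manifold_topology TM) c"
    and i: "i \<in> charts A" "c t \<in> cdom TM i" and j: "j \<in> charts A" "c t \<in> cdom TM j"
    and ham: "hamilton_eq \<sigma> G c t i"
  shows "hamilton_eq \<sigma> G c t j"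
proof -
  interpret T: atlas TM by (rule atlas_TM)
  let ?z = "cmap TM i (c t)" and ?T = "transition TM i j"
  obtain \<xi> where \<xi>: "((\<lambda>s. cmap TM i (c s)) has_vector_derivative \<xi>) (at t)"
    "\<And>v. twisted_form \<sigma> i ?z \<xi> v = - frechet_derivative (\<lambda>x. G (cinv TM i x)) (at ?z) v"
    using ham unfolding hamilton_eq_def o_def by blast
  have i': "i \<in> charts TM" and j': "j \<in> charts TM" using i j by simp_all
  have zT: "?z \<in> T.overlap i j" by (rule T.cmap_in_overlap[OF i(2) j(2)])
  have z: "?z \<in> overlap i j \<times> UNIV" using zT overlap_TM[OF i(1) j(1)] unfolding T.overlap_def by simp
  have Tz: "?T ?z = cmap TM j (c t)" by (rule T.transition_cmap[OF i' i(2)])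
  note D = T.dtau[OF i' j' zT]
  have "((\<lambda>s. ?T (cmap TM i (c s))) has_vector_derivative T.dtau i j ?z \<xi>) (at t)"
  proof -
    have "((\<lambda>s. cmap TM i (c s)) has_derivative (\<lambda>h. h *\<^sub>R \<xi>)) (at t)"
      using \<xi>(1) by (simp add: has_vector_derivative_def)
    from diff_chain_at[OF this D] show ?thesis
      using has_derivative_linear[OF D] by (simp add: has_vector_derivative_def o_def linear_cmul)
  qed
  then have 1: "((\<lambda>s. cmap TM j (c s)) has_vector_derivative T.dtau i j ?z \<xi>) (at t)"
  proof (rule has_vector_derivative_transform_within_open)
    show "open {s. c s \<in> cdom TM i}" by (rule T.curve_in_chart(1)[OF i' c])
    show "?T (cmap TM i (c s)) = cmap TM j (c s)" if "s \<in> {s. c s \<in> cdom TM i}" for s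
      using that by (intro T.transition_cmap[OF i']) simp
  qed (use i in simp)
  have "twisted_form \<sigma> j (cmap TM j (c t)) (T.dtau i j ?z \<xi>) v =
      - frechet_derivative (\<lambda>x. G (cinv TM j x)) (at (cmap TM j (c t))) v" for v
  proof -
    \<comment> \<open>The test vector v is transported back to chart i; every v arises as the image
      of some u because the transition derivative is invertible.\<close>
    define u where "u = T.dtau j i (?T ?z) v"
    have zT': "?T ?z \<in> T.overlap j i" by (rule T.transition_in_overlap[OF i' j' zT])
    have "transition TM j i (?T ?z) = ?z" using T.transition_cmap[OF j' j(2)] Tz by simp
    then have v: "T.dtau i j ?z u = v"
      using T.dtau_inverse[OF j' i' zT', of v] by (simp add: u_def)
    have "twisted_form \<sigma> j (?T ?z) (T.dtau i j ?z \<xi>) (T.dtau i j ?z u) = twisted_form \<sigma> i ?z \<xi> u"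
      by (rule twisted_form_transition[OF \<sigma> i(1) j(1) z D])
    also have "\<dots> = - T.differential G i ?z u" by (simp add: \<xi>(2) T.differential_def)
    also have "\<dots> = - T.differential G j (?T ?z) (T.dtau i j ?z u)"
      by (simp add: T.differential_transition[OF G i' j' zT])
    finally show ?thesis by (simp add: v Tz T.differential_def)
  qed
  with 1 show ?thesis unfolding hamilton_eq_def o_def by blast
qed

end

section \<open>Integral curves of Lipschitz vector fields\<close>

text \<open>Picard iteration for \<open>u t = exp (- 2 L t) (\<gamma> t - z)\<close>; the exponential weight makes the
  integral operator a contraction on all of \<open>[0, 1]\<close>.\<close>

lemma integral_curve_exists:
  fixes X :: "'a::euclidean_space \<Rightarrow> 'a"
  assumes L: "L > 0" "\<And>x y. norm (X x - X y) \<le> L * norm (x - y)"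
  obtains \<gamma> where "\<gamma> 0 = z" "\<And>t. t \<in> {0..1} \<Longrightarrow> (\<gamma> has_vector_derivative X (\<gamma> t)) (at t within {0..1::real})"
proof -
  have contX: "continuous_on UNIV X"
  proof (rule continuous_on_eq_continuous_within[THEN iffD2], intro ballI)
    have "L-lipschitz_on UNIV X" using L by (intro lipschitz_onI) (auto simp: dist_norm)
    then show "continuous (at x within UNIV) X" for x
      using lipschitz_on_continuous_on continuous_on_eq_continuous_within by blast
  qed
  \<comment> \<open>Clamping time to [0, 1] makes the iterates bounded continuous functions on the
    whole line, a complete space in which the Banach fixed point theorem applies.\<close>
  define c where "c t = max 0 (min 1 t)" for t :: real
  have c01: "c t \<in> {0..1}" for t by (auto simp: c_def)
  have cc: "continuous_on UNIV c" unfolding c_def by (intro continuous_intros)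
  define f where "f u s = X (z + exp (2 * L * s) *\<^sub>R apply_bcontfun u s)" for u :: "real \<Rightarrow>\<^sub>C 'a" and s
  have contf: "continuous_on S (f u)" for u S
  proof -
    have "continuous_on UNIV (apply_bcontfun u)" using continuous_on_apply_bcontfun by blast
    then have "continuous_on S (\<lambda>s. z + exp (2 * L * s) *\<^sub>R apply_bcontfun u s)"
      by (intro continuous_intros) (auto intro: continuous_on_subset)
    then show ?thesis unfolding f_def by (rule continuous_on_compose2[OF contX]) auto
  qed
  \<comment> \<open>The integral equation for \<gamma>, rewritten for the weighted u; a fixed point
    of J solves it on [0, 1].\<close>
  define J where "J u t = exp (- (2 * L * c t)) *\<^sub>R integral {0..c t} (f u)" for u t
  have contJ: "continuous_on UNIV (J u)" for u
  proof -
    have "continuous_on {0..1} (\<lambda>x. integral {0..x} (f u))"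
      by (rule indefinite_integral_continuous_1[OF integrable_continuous_interval[OF contf]])
    then have "continuous_on UNIV (\<lambda>t. integral {0..c t} (f u))"
      by (rule continuous_on_compose2[OF _ cc]) (use c01 in auto)
    then show ?thesis unfolding J_def by (intro continuous_intros cc)
  qed
  have bddJ: "bounded (range (J u))" for u
  proof -
    have "J u t = J u (c t)" for t by (simp add: J_def c_def)
    then have "range (J u) \<subseteq> J u ` {0..1}" using c01 by blast
    moreover have "bounded (J u ` {0..1})"
      by (intro compact_imp_bounded compact_continuous_image continuous_on_subset[OF contJ]) auto
    ultimately show ?thesis by (rule bounded_subset[rotated])
  qed
  have J: "apply_bcontfun (Bcontfun (J u)) = J u" for u
    by (rule Bcontfun_inverse) (use contJ bddJ in \<open>auto simp: bcontfun_def\<close>)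
  \<comment> \<open>The weight enters as exp(-2 L c) times the integral of L exp(2 L s) over [0, c],
    which is at most 1/2.\<close>
  have contr: "dist (Bcontfun (J u)) (Bcontfun (J v)) \<le> 1/2 * dist u v" for u v
  proof (rule dist_bound)
    fix t
    let ?c = "c t"
    have int: "f w integrable_on {0..?c}" for w by (rule integrable_continuous_interval[OF contf])
    have hi: "((\<lambda>s. L * exp (2 * L * s) * dist u v) has_integral
        exp (2 * L * ?c) / 2 * dist u v - exp (2 * L * 0) / 2 * dist u v) {0..?c}"
      using c01[of t] by (intro fundamental_theorem_of_calculus)
        (auto intro!: derivative_eq_intros simp: has_real_derivative_iff_has_vector_derivative[symmetric])
    have pt: "norm (f u s - f v s) \<le> L * exp (2 * L * s) * dist u v" for s
    proof -
      have "norm (f u s - f v s) \<le> L * norm (exp (2 * L * s) *\<^sub>R apply_bcontfun u s - exp (2 * L * s) *\<^sub>R apply_bcontfun v s)"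
        unfolding f_def by (rule order_trans[OF L(2)]) simp
      also have "\<dots> = L * exp (2 * L * s) * dist (apply_bcontfun u s) (apply_bcontfun v s)"
        by (simp add: scaleR_diff_right[symmetric] dist_norm)
      also have "\<dots> \<le> L * exp (2 * L * s) * dist u v"
        using L(1) dist_bounded[of u s v] by (intro mult_left_mono) auto
      finally show ?thesis .
    qed
    have "norm (integral {0..?c} (f u) - integral {0..?c} (f v)) = norm (integral {0..?c} (\<lambda>s. f u s - f v s))"
      by (simp add: integral_diff int)
    also have "\<dots> \<le> integral {0..?c} (\<lambda>s. L * exp (2 * L * s) * dist u v)"
      by (rule integral_norm_bound_integral[OF integrable_diff[OF int int] has_integral_integrable[OF hi] pt])
    also have "\<dots> = exp (2 * L * ?c) / 2 * dist u v - 1/2 * dist u v"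
      using integral_unique[OF hi] by simp
    finally have "norm (integral {0..?c} (f u) - integral {0..?c} (f v)) \<le> exp (2 * L * ?c) / 2 * dist u v"
      using zero_le_dist[of u v] by linarith
    then have "exp (- (2 * L * ?c)) * norm (integral {0..?c} (f u) - integral {0..?c} (f v))
        \<le> exp (- (2 * L * ?c)) * (exp (2 * L * ?c) / 2 * dist u v)"
      by (intro mult_left_mono) auto
    also have "\<dots> = 1/2 * dist u v" by (simp add: exp_minus)
    finally show "dist (apply_bcontfun (Bcontfun (J u)) t) (apply_bcontfun (Bcontfun (J v)) t) \<le> 1/2 * dist u v"
      by (simp add: J J_def dist_norm scaleR_diff_right[symmetric])
  qed
  have "\<exists>!u. Bcontfun (J u) = u"
    by (rule banach_fix_type[of "1/2"]) (use contr in auto)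
  then obtain u where "Bcontfun (J u) = u" by blast
  then have u: "apply_bcontfun u t = J u t" for t using J[of u] by simp
  define \<gamma> where "\<gamma> t = z + integral {0..t} (f u)" for t
  have \<gamma>: "\<gamma> t = z + exp (2 * L * t) *\<^sub>R apply_bcontfun u t" if "t \<in> {0..1}" for t
    using that by (simp add: \<gamma>_def u J_def c_def exp_minus)
  show ?thesis
  proof (rule that[of \<gamma>])
    show "\<gamma> 0 = z" by (simp add: \<gamma>_def)
    fix t :: real assume t: "t \<in> {0..1}"
    have "((\<lambda>t. z + integral {0..t} (f u)) has_vector_derivative 0 + f u t) (at t within {0..1})"
      by (intro has_vector_derivative_add has_vector_derivative_const integral_has_vector_derivative contf t)
    then show "(\<gamma> has_vector_derivative X (\<gamma> t)) (at t within {0..1})"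
      using \<gamma>[OF t] by (simp add: \<gamma>_def[abs_def] f_def)
  qed
qed

text \<open>A curve that leaves \<open>C\<close> at a zero \<open>p\<close> of the field would have been at \<open>p\<close> from the start,
  by Gronwall's argument for \<open>exp (2 L s) |\<gamma> s - p|\<^sup>2\<close>.\<close>

lemma integral_curve_in_compact:
  fixes X :: "'a::euclidean_space \<Rightarrow> 'a"
  assumes X: "smooth_on UNIV X" and C: "compact C" "\<And>x. x \<notin> C \<Longrightarrow> X x = 0" and z: "z \<in> C"
  obtains \<gamma> where "\<gamma> 0 = z" "\<And>t. t \<in> {0..1} \<Longrightarrow> \<gamma> t \<in> C"
    "\<And>t. t \<in> {0..1} \<Longrightarrow> (\<gamma> has_vector_derivative X (\<gamma> t)) (at t within {0..1::real})"
proof -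
  obtain L where L: "L > 0" "\<And>x v. norm (frechet_derivative X (at x) v) \<le> L * norm v"
    "\<And>x y. norm (X x - X y) \<le> L * norm (x - y)"
    using smooth_compact_support_bounded_derivative[OF X C] by blast
  obtain \<gamma> where \<gamma>: "\<gamma> 0 = z" "\<And>t. t \<in> {0..1} \<Longrightarrow> (\<gamma> has_vector_derivative X (\<gamma> t)) (at t within {0..1::real})"
    by (rule integral_curve_exists[OF L(1,3)]) (rule that)
  have "\<gamma> t \<in> C" if t: "t \<in> {0..1}" for t
  proof (rule ccontr)
    assume nC: "\<gamma> t \<notin> C"
    define p where "p = \<gamma> t"
    have Xp: "X p = 0" using C(2) nC by (simp add: p_def)
    define g where "g s = exp (2 * L * s) * ((\<gamma> s - p) \<bullet> (\<gamma> s - p))" for s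
    have cont: "continuous_on {0..t} g"
    proof -
      have "continuous_on {0..1} \<gamma>"
        unfolding continuous_on_eq_continuous_within
        by (intro ballI has_vector_derivative_continuous[OF \<gamma>(2)])
      then have "continuous_on {0..t} \<gamma>" by (rule continuous_on_subset) (use t in auto)
      then show ?thesis unfolding g_def by (intro continuous_intros)
    qed
    have "g 0 \<le> g t"
    proof (rule DERIV_nonneg_imp_increasing_open[OF _ _ cont])
      fix s assume s: "0 < s" "s < t"
      have "at s within {0..1} = at s" using s t by (intro at_within_interior) auto
      then have d: "(\<gamma> has_vector_derivative X (\<gamma> s)) (at s)" using \<gamma>(2)[of s] s t by auto
      let ?d = "exp (2 * L * s) * (2 * L * ((\<gamma> s - p) \<bullet> (\<gamma> s - p)) + 2 * ((\<gamma> s - p) \<bullet> X (\<gamma> s)))"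
      have dn: "((\<lambda>s. (\<gamma> s - p) \<bullet> (\<gamma> s - p)) has_real_derivative 2 * ((\<gamma> s - p) \<bullet> X (\<gamma> s))) (at s)"
      proof -
        have d': "((\<lambda>s. \<gamma> s - p) has_derivative (\<lambda>h. h *\<^sub>R X (\<gamma> s))) (at s)"
          using d by (auto simp: has_vector_derivative_def intro!: derivative_eq_intros)
        have "(\<lambda>h. (\<gamma> s - p) \<bullet> (h *\<^sub>R X (\<gamma> s)) + (h *\<^sub>R X (\<gamma> s)) \<bullet> (\<gamma> s - p)) = (*) (2 * ((\<gamma> s - p) \<bullet> X (\<gamma> s)))"
          by (rule ext) (simp add: inner_commute[of "X (\<gamma> s)"])
        with has_derivative_inner[OF d' d'] show ?thesis
          by (simp only: has_field_derivative_def)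
      qed
      have de: "((\<lambda>s. exp (2 * L * s)) has_real_derivative exp (2 * L * s) * (2 * L)) (at s)"
        by (auto intro!: derivative_eq_intros)
      have "exp (2 * L * s) * (2 * ((\<gamma> s - p) \<bullet> X (\<gamma> s))) + exp (2 * L * s) * (2 * L) * ((\<gamma> s - p) \<bullet> (\<gamma> s - p)) = ?d"
        by (simp only: distrib_left mult.assoc add.commute)
      with DERIV_mult'[OF de dn] have "(g has_real_derivative ?d) (at s)"
        by (simp only: g_def[abs_def])
      moreover have "?d \<ge> 0"
      proof (intro mult_nonneg_nonneg)
        \<comment> \<open>Since X p = 0, the Lipschitz bound makes the change of the squared
          distance no worse than what the weight exp(2 L s) compensates.\<close>
        have "\<bar>(\<gamma> s - p) \<bullet> X (\<gamma> s)\<bar> \<le> norm (\<gamma> s - p) * norm (X (\<gamma> s) - X p)"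
          using Cauchy_Schwarz_ineq2[of "\<gamma> s - p" "X (\<gamma> s)"] Xp by simp
        also have "\<dots> \<le> norm (\<gamma> s - p) * (L * norm (\<gamma> s - p))"
          by (intro mult_left_mono L(3)) auto
        also have "\<dots> = L * ((\<gamma> s - p) \<bullet> (\<gamma> s - p))"
          by (simp add: power2_norm_eq_inner[symmetric] power2_eq_square)
        finally show "2 * L * ((\<gamma> s - p) \<bullet> (\<gamma> s - p)) + 2 * ((\<gamma> s - p) \<bullet> X (\<gamma> s)) \<ge> 0" by linarith
      qed auto
      ultimately show "\<exists>y. (g has_real_derivative y) (at s) \<and> y \<ge> 0" by blast
    qed (use t in auto)
    moreover have "g t = 0" by (simp add: g_def p_def)
    ultimately have "(\<gamma> 0 - p) \<bullet> (\<gamma> 0 - p) \<le> 0" by (simp add: g_def)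
    then have "\<gamma> 0 - p = 0" using inner_gt_zero_iff[of "\<gamma> 0 - p"] by linarith
    then have "\<gamma> 0 = p" by (simp only: right_minus_eq)
    then show False using z nC \<gamma>(1) by (simp add: p_def)
  qed
  with \<gamma> show ?thesis by (intro that)
qed

section \<open>Hamiltonian flows on the cotangent bundle\<close>

context atlas
begin

lemma twisted_form_zero:
  assumes \<sigma>: "two_form A \<sigma>" and i: "i \<in> charts A" "fst z \<in> cimage A i"
  shows "twisted_form \<sigma> i z 0 v = 0"
proof -
  have "linear (\<sigma> i (fst z) u)" "\<sigma> i (fst z) 0 u = - \<sigma> i (fst z) u 0" for u
    using \<sigma> i unfolding two_form_def by blast+
  then have "\<sigma> i (fst z) 0 u = 0" for u using linear_0 by fastforce
  then show ?thesis by (simp add: twisted_form_def dp_wedge_dq_def pullback_pi_def)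
qed

text \<open>Hamilton's equations with a magnetic term, in coordinates: q' = dF/dp and p' = - dF/dq -
  \<sigma>(q', .), obtained by solving the equation for the twisted form.\<close>

definition ham_field ::
    "('i, 'e) form2 \<Rightarrow> 'i \<Rightarrow> ('e \<times> 'e \<Rightarrow> real) \<Rightarrow> 'e \<times> 'e \<Rightarrow> 'e \<times> 'e" where
  "ham_field \<sigma> i F z = (let dF = frechet_derivative F (at z) in
     (\<Sum>b\<in>Basis. dF (0, b) *\<^sub>R b,
      \<Sum>k\<in>Basis. (- dF (k, 0) - (\<Sum>b\<in>Basis. dF (0, b) * \<sigma> i (fst z) b k)) *\<^sub>R k))"

lemma twisted_form_ham_field:
  assumes \<sigma>: "two_form A \<sigma>" and i: "i \<in> charts A" "fst z \<in> cimage A i"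
    and F: "linear (frechet_derivative F (at z))"
  shows "twisted_form \<sigma> i z (ham_field \<sigma> i F z) v = - frechet_derivative F (at z) v"
proof -
  let ?d = "frechet_derivative F (at z)" and ?s = "\<sigma> i (fst z)"
  have lin: "linear (?s u)" and anti: "?s v u = - ?s u v" for u v
    using \<sigma> i unfolding two_form_def by blast+
  \<comment> \<open>\<open>two_form\<close> provides linearity in the second slot; antisymmetry
    carries it to the first.\<close>
  have lin': "?s (\<Sum>b\<in>Basis. a b *\<^sub>R b) u = (\<Sum>b\<in>Basis. a b * ?s b u)" for a u
  proof -
    have "?s (\<Sum>b\<in>Basis. a b *\<^sub>R b) u = - ?s u (\<Sum>b\<in>Basis. a b *\<^sub>R b)" by (rule anti)
    also have "?s u (\<Sum>b\<in>Basis. a b *\<^sub>R b) = (\<Sum>b\<in>Basis. a b * ?s u b)"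
      using lin[of u] by (simp add: linear_sum linear_cmul)
    also have "- (\<Sum>b\<in>Basis. a b * ?s u b) = (\<Sum>b\<in>Basis. a b * ?s b u)"
      by (subst sum_negf[symmetric]) (simp add: anti[of u])
    finally show ?thesis .
  qed
  have expand_s: "?s b u = (\<Sum>k\<in>Basis. (u \<bullet> k) * ?s b k)" for b u
    using linear_basis_expansion[OF lin, of b u] by simp
  have lf: "linear (\<lambda>u. ?d (u, 0))" "linear (\<lambda>u. ?d (0, u))"
    using linear_compose[OF _ F, of "\<lambda>u. (u, 0)"] linear_compose[OF _ F, of "\<lambda>u. (0, u)"]
    by (auto simp: o_def linear_iff)
  have dfst: "?d (u, 0) = (\<Sum>k\<in>Basis. (u \<bullet> k) * ?d (k, 0))" for u
    using linear_basis_expansion[OF lf(1), of u] by simp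
  have dsnd: "?d (0, u) = (\<Sum>k\<in>Basis. (u \<bullet> k) * ?d (0, k))" for u
    using linear_basis_expansion[OF lf(2), of u] by simp
  have "?d v = ?d ((fst v, 0) + (0, snd v))" by simp
  also have "\<dots> = ?d (fst v, 0) + ?d (0, snd v)" using F by (simp only: linear_add)
  finally have dv: "?d v = ?d (fst v, 0) + ?d (0, snd v)" .
  have 1: "snd (ham_field \<sigma> i F z) \<bullet> fst v = - ?d (fst v, 0) - (\<Sum>b\<in>Basis. ?d (0, b) * ?s b (fst v))"
  proof -
    have "snd (ham_field \<sigma> i F z) \<bullet> fst v =
        (\<Sum>k\<in>Basis. (- ?d (k, 0) - (\<Sum>b\<in>Basis. ?d (0, b) * ?s b k)) * (fst v \<bullet> k))"
      by (simp add: ham_field_def Let_def inner_sum_left inner_commute[of "fst v"])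
    also have "\<dots> = - (\<Sum>k\<in>Basis. (fst v \<bullet> k) * ?d (k, 0)) - (\<Sum>k\<in>Basis. \<Sum>b\<in>Basis. ?d (0, b) * ((fst v \<bullet> k) * ?s b k))"
      by (simp add: left_diff_distrib right_diff_distrib sum_subtractf sum_distrib_left sum_distrib_right sum_negf ac_simps)
    also have "(\<Sum>k\<in>Basis. \<Sum>b\<in>Basis. ?d (0, b) * ((fst v \<bullet> k) * ?s b k)) = (\<Sum>b\<in>Basis. ?d (0, b) * ?s b (fst v))"
      unfolding expand_s[of _ "fst v"] sum_distrib_left by (rule sum.swap)
    finally show ?thesis by (simp only: dfst[symmetric])
  qed
  have 2: "snd v \<bullet> fst (ham_field \<sigma> i F z) = ?d (0, snd v)"
    unfolding dsnd[of "snd v"] by (simp add: ham_field_def Let_def inner_sum_right mult.commute)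
  have 3: "?s (fst (ham_field \<sigma> i F z)) (fst v) = (\<Sum>b\<in>Basis. ?d (0, b) * ?s b (fst v))"
    by (simp add: ham_field_def Let_def lin')
  show ?thesis
    by (simp add: twisted_form_def dp_wedge_dq_def pullback_pi_def 1 2 3 dv)
qed

lemma smooth_on_ham_field:
  assumes \<sigma>: "two_form A \<sigma>" and i: "i \<in> charts A" and F: "smooth_on (cimage A i \<times> UNIV) F"
  shows "smooth_on (cimage A i \<times> UNIV) (ham_field \<sigma> i F)"
proof -
  have o: "open (cimage A i \<times> (UNIV :: 'e set))" by (intro open_Times open_cimage i open_UNIV)
  have s: "smooth_on (cimage A i \<times> (UNIV :: 'e set)) (\<lambda>z. \<sigma> i (fst z) b k)" for b k
  proof (rule smooth_on_compose[OF o smooth_on_bounded_linear_fun[OF o bounded_linear_fst]])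
    show "smooth_on (cimage A i) (\<lambda>x. \<sigma> i x b k)" using \<sigma> i unfolding two_form_def by blast
  qed auto
  show ?thesis
    unfolding ham_field_def[abs_def] Let_def
    by (intro smooth_on_Pair smooth_on_sum smooth_on_scaleR smooth_on_diff smooth_on_minus smooth_on_mult
        smooth_on_frechet_derivative F s smooth_on_const o)
qed

lemma hamilton_eq_cong:
  assumes "hamilton_eq \<sigma> G c t i" "open S" "t \<in> S" "\<And>s. s \<in> S \<Longrightarrow> c s = c' s"
  shows "hamilton_eq \<sigma> G c' t i"
proof -
  obtain \<xi> where \<xi>: "((\<lambda>s. cmap TM i (c s)) has_vector_derivative \<xi>) (at t)"
    "\<And>v. twisted_form \<sigma> i (cmap TM i (c t)) \<xi> v = - frechet_derivative (G \<circ> cinv TM i) (at (cmap TM i (c t))) v"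
    using assms(1) unfolding hamilton_eq_def by blast
  have "((\<lambda>s. cmap TM i (c' s)) has_vector_derivative \<xi>) (at t)"
    by (rule has_vector_derivative_transform_within_open[OF \<xi>(1) assms(2,3)]) (simp add: assms(4))
  then show ?thesis
    unfolding hamilton_eq_def using \<xi>(2)[unfolded assms(4)[OF assms(3)]] by (intro exI[of _ \<xi>]) blast
qed

end

text \<open>The half-lines overlap in (a, b), so preimages are unions of two open sets.\<close>

lemma continuous_map_paste:
  fixes a b :: real
  assumes "continuous_map euclideanreal X c" "continuous_map euclideanreal X d" "a < b"
    and "\<And>t. t < b \<Longrightarrow> e t = c t" "\<And>t. t > a \<Longrightarrow> e t = d t"
  shows "continuous_map euclideanreal X e"
  unfolding continuous_map
proof (intro conjI allI impI)
  have *: "t < b \<or> t > a" for t using assms(3) by linarith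
  show "e ` topspace euclideanreal \<subseteq> topspace X"
    using assms(1,2,4,5) * unfolding continuous_map by (auto simp: image_subset_iff) (metis)
  fix U assume U: "openin X U"
  have "open {t. c t \<in> U}" "open {t. d t \<in> U}"
    using openin_continuous_map_preimage[OF assms(1) U] openin_continuous_map_preimage[OF assms(2) U] by auto
  then have "open (({..<b} \<inter> {t. c t \<in> U}) \<union> ({a<..} \<inter> {t. d t \<in> U}))"
    by (intro open_Un open_Int open_lessThan open_greaterThan)
  moreover have "{t. e t \<in> U} = ({..<b} \<inter> {t. c t \<in> U}) \<union> ({a<..} \<inter> {t. d t \<in> U})"
  proof (rule set_eqI)
    fix t
    show "t \<in> {t. e t \<in> U} \<longleftrightarrow> t \<in> ({..<b} \<inter> {t. c t \<in> U}) \<union> ({a<..} \<inter> {t. d t \<in> U})"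
      using *[of t] assms(4)[of t] assms(5)[of t] by (cases "t < b"; cases "t > a") auto
  qed
  ultimately show "openin euclideanreal {t \<in> topspace euclideanreal. e t \<in> U}" by simp
qed

context closed_manifold
begin

interpretation T: atlas TM by (rule atlas_TM)

text \<open>Continuity of the bundle projection.\<close>

lemma openin_TM_fst:
  assumes V: "openin MT V"
  shows "openin T.MT {w \<in> points TM. fst w \<in> V}"
  unfolding T.openin_iff
proof (intro conjI ballI)
  fix i assume "i \<in> charts TM"
  then have i: "i \<in> charts A" by simp
  have "cmap TM i ` ({w \<in> points TM. fst w \<in> V} \<inter> cdom TM i) = cmap A i ` (V \<inter> cdom A i) \<times> UNIV" (is "?l = ?r")
  proof
    show "?l \<subseteq> ?r" by (auto simp: cmap_TM cdom_TM)
    show "?r \<subseteq> ?l"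
    proof
      fix z assume "z \<in> ?r"
      then obtain q y where q: "q \<in> V" "q \<in> cdom A i" "z = (cmap A i q, y)" by auto
      note c = cinv_TM[OF i cmap_in_cimage[OF q(2)], of y]
      have "cinv TM i z \<in> cdom TM i" "fst (cinv TM i z) = q" "cmap TM i (cinv TM i z) = z"
        using c q cinv_cmap[OF i] by auto
      moreover have "cinv TM i z \<in> points TM" using calculation(1) T.cdom_subset_points i by auto
      ultimately show "z \<in> ?l" using q(1) by (intro image_eqI[of _ _ "cinv TM i z"]) auto
    qed
  qed
  moreover have "open (cmap A i ` (V \<inter> cdom A i))" using V i unfolding openin_iff by blast
  ultimately show "open (cmap TM i ` ({w \<in> points TM. fst w \<in> V} \<inter> cdom TM i))"
    by (simp add: open_Times)
qed auto

lemma Hausdorff_TM: "Hausdorff_space T.MT"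
  unfolding Hausdorff_space_def T.topspace_MT
proof (intro allI impI)
  fix w w' assume w: "w \<in> points TM \<and> w' \<in> points TM \<and> w \<noteq> w'"
  show "\<exists>U V. openin T.MT U \<and> openin T.MT V \<and> w \<in> U \<and> w' \<in> V \<and> disjnt U V"
  proof (cases "fst w = fst w'")
    case False
    then obtain U V where U: "openin MT U" "openin MT V" "fst w \<in> U" "fst w' \<in> V" "disjnt U V"
      using Hausdorff w unfolding Hausdorff_space_def topspace_MT points_TM by blast
    have "disjnt {w \<in> points TM. fst w \<in> U} {w \<in> points TM. fst w \<in> V}" using U(5) by (auto simp: disjnt_def)
    then show ?thesis using openin_TM_fst[OF U(1)] openin_TM_fst[OF U(2)] U(3,4) w by blast
  next
    case True
    have "fst w \<in> points A" using w points_TM by blast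
    then obtain i where i: "i \<in> charts A" "fst w \<in> cdom A i" by (auto simp: points_def)
    then have d: "w \<in> cdom TM i" "w' \<in> cdom TM i" using w True by (auto simp: cdom_TM points_TM)
    then have "cmap TM i w \<noteq> cmap TM i w'" using inj_cmap_TM[OF i(1)] w by (auto dest: inj_onD)
    from hausdorff[OF this]
    obtain U V where U: "open U" "open V" "cmap TM i w \<in> U" "cmap TM i w' \<in> V" "U \<inter> V = {}"
      by (elim exE conjE) (rule that)
    have "openin T.MT {q \<in> cdom TM i. cmap TM i q \<in> U}" "openin T.MT {q \<in> cdom TM i. cmap TM i q \<in> V}"
      using T.openin_chart_preimage i(1) U by auto
    moreover have "disjnt {q \<in> cdom TM i. cmap TM i q \<in> U} {q \<in> cdom TM i. cmap TM i q \<in> V}"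
      using U(5) by (auto simp: disjnt_def)
    ultimately show ?thesis using d U(3,4) by blast
  qed
qed

lemma closedin_TM_chart_image:
  "i \<in> charts A \<Longrightarrow> compact K \<Longrightarrow> K \<subseteq> cimage TM i \<Longrightarrow> closedin T.MT (cinv TM i ` K)"
  by (intro compactin_imp_closedin[OF Hausdorff_TM] T.compactin_cinv_image) auto

text \<open>Points outside the support rest. For the others the field, extended by zero, lives on a
  Euclidean space, and its curve stays in the compact set K, hence in the chart. The curve is only
  known on [0, 1], so it is run by a clock B with values there; the chain rule multiplies the
  Hamiltonian by the rate \<beta>.\<close>

lemma chart_supported_flow:
  assumes \<sigma>: "two_form A \<sigma>" and G: "smooth_function TM G" and i: "i \<in> charts A"
    and K: "compact K" "K \<subseteq> cimage TM i" "\<And>w. w \<in> points TM \<Longrightarrow> w \<notin> cinv TM i ` K \<Longrightarrow> G w = 0"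
    and B: "\<And>t. B t \<in> {0..1}" "\<And>t. (B has_real_derivative \<beta> t) (at t)"
    and w: "w \<in> points TM"
  obtains \<psi> where "\<psi> 0 = w" "continuous_map euclideanreal T.MT (\<lambda>t. \<psi> (B t))"
    "\<And>t j. j \<in> charts A \<Longrightarrow> \<psi> (B t) \<in> cdom TM j \<Longrightarrow> hamilton_eq \<sigma> (\<lambda>w. \<beta> t * G w) (\<lambda>t. \<psi> (B t)) t j"
proof (cases "w \<in> cinv TM i ` K")
  case False
  \<comment> \<open>The support is closed, so G vanishes on a neighbourhood of w and not merely at
    w; its differential there is 0.\<close>
  define U where "U = points TM - cinv TM i ` K"
  have U: "openin T.MT U"
    using closedin_TM_chart_image[OF i K(1,2)] unfolding closedin_def T.topspace_MT U_def by blast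
  show ?thesis
  proof (rule that[of "\<lambda>_. w"])
    show "continuous_map euclideanreal T.MT (\<lambda>t. w)" using w T.topspace_MT by simp
    fix t j assume j: "j \<in> charts A" "w \<in> cdom TM j"
    let ?S = "cmap TM j ` (U \<inter> cdom TM j)"
    have "frechet_derivative ((\<lambda>w. \<beta> t * G w) \<circ> cinv TM j) (at (cmap TM j w)) = frechet_derivative (\<lambda>_. 0) (at (cmap TM j w))"
    proof (rule frechet_derivative_transform_open[of ?S])
      show "open ?S" using U j(1) unfolding T.openin_iff by simp
      show "cmap TM j w \<in> ?S" using w False j(2) by (auto simp: U_def)
      show "((\<lambda>w. \<beta> t * G w) \<circ> cinv TM j) y = 0" if "y \<in> ?S" for y
        using that T.cinv_cmap[of j] j(1) K(3) by (auto simp: U_def)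
    qed
    moreover have "twisted_form \<sigma> j (cmap TM j w) 0 v = 0" for v
      using j by (intro twisted_form_zero[OF \<sigma> j(1)]) (auto simp: cmap_TM cdom_TM cimage_def)
    ultimately show "hamilton_eq \<sigma> (\<lambda>w. \<beta> t * G w) (\<lambda>t. w) t j"
      unfolding hamilton_eq_def by (intro exI[of _ 0]) simp
  qed simp
next
  case True
  then obtain z where z: "z \<in> K" "w = cinv TM i z" by auto
  define O' where "O' = cimage A i \<times> (UNIV :: 'e set)"
  have O': "open O'" unfolding O'_def by (intro open_Times open_cimage i open_UNIV)
  have KO: "K \<subseteq> O'" using K(2) cimage_TM[OF i] by (simp add: O'_def)
  have i': "i \<in> charts TM" using i by simp
  define F where "F = (\<lambda>z. G (cinv TM i z))"
  have F: "smooth_on O' F" using T.smooth_functionD[OF G i'] cimage_TM[OF i] by (simp add: F_def O'_def)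
  have F0: "F z = 0" if "z \<in> O'" "z \<notin> K" for z
  proof -
    have zi: "z \<in> cimage TM i" using that(1) cimage_TM[OF i] by (simp add: O'_def)
    have "cinv TM i z \<notin> cinv TM i ` K"
    proof
      assume "cinv TM i z \<in> cinv TM i ` K"
      then obtain z' where "z' \<in> K" "cinv TM i z = cinv TM i z'" by auto
      then have "z = z'" using T.cmap_cinv[OF i'] zi K(2) by (metis subsetD)
      then show False using \<open>z' \<in> K\<close> that(2) by simp
    qed
    moreover have "cinv TM i z \<in> points TM" using T.cinv_in_cdom[OF i' zi] T.cdom_subset_points[OF i'] by blast
    ultimately show ?thesis using K(3) by (simp add: F_def)
  qed
  \<comment> \<open>Smooth on the whole space: on the chart image it is the Hamiltonian field, on
    the open complement of K it is 0, and these two sets cover.\<close>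
  define X where "X z = (if z \<in> O' then ham_field \<sigma> i F z else 0)" for z
  have Xout: "X z = 0" if "z \<notin> K" for z
  proof (cases "z \<in> O'")
    case True
    have "frechet_derivative F (at z) = frechet_derivative (\<lambda>_. 0) (at z)"
      by (rule frechet_derivative_transform_open[of "O' - K"])
         (use O' K(1) True that F0 in \<open>auto intro: compact_imp_closed\<close>)
    then show ?thesis by (simp add: X_def ham_field_def zero_prod_def)
  qed (simp add: X_def)
  have "smooth_on UNIV X"
  proof (rule smooth_on_local)
    fix z :: "'e \<times> 'e"
    show "\<exists>T. open T \<and> z \<in> T \<and> smooth_on T X"
    proof (cases "z \<in> O'")
      case True
      have "smooth_on O' (ham_field \<sigma> i F)" using smooth_on_ham_field[OF \<sigma> i] F by (simp add: O'_def)
      then have "smooth_on O' X" by (rule smooth_on_cong[OF O', rotated]) (simp add: X_def)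
      then show ?thesis using O' True by blast
    next
      case False
      have o: "open (- K)" using K(1) by (simp add: compact_imp_closed open_Compl)
      have "smooth_on (- K) X" by (rule smooth_on_cong[OF o _ smooth_on_const[OF o, of 0]]) (simp add: Xout)
      then show ?thesis using o False KO by blast
    qed
  qed
  from integral_curve_in_compact[OF this K(1) Xout z(1)]
  obtain \<gamma> where \<gamma>: "\<gamma> 0 = z" "\<And>t. t \<in> {0..1} \<Longrightarrow> \<gamma> t \<in> K"
    "\<And>t. t \<in> {0..1} \<Longrightarrow> (\<gamma> has_vector_derivative X (\<gamma> t)) (at t within {0..1::real})" by blast
  define \<psi> where "\<psi> s = cinv TM i (\<gamma> s)" for s
  have \<gamma>i: "\<gamma> (B t) \<in> cimage TM i" for t using \<gamma>(2)[OF B(1)] K(2) by blast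
  \<comment> \<open>At the ends of [0, 1] the curve has only one-sided derivatives. The clock never
    leaves [0, 1], so the composite is differentiable at every time.\<close>
  have der: "((\<lambda>t. \<gamma> (B t)) has_vector_derivative \<beta> t *\<^sub>R X (\<gamma> (B t))) (at t)" for t
  proof -
    have "range B \<subseteq> {0..1}" using B(1) by blast
    from has_vector_derivative_within_subset[OF \<gamma>(3)[OF B(1)] this]
    have "(\<gamma> has_vector_derivative X (\<gamma> (B t))) (at (B t) within range B)" .
    from vector_diff_chain_within[OF _ this, of "\<beta> t"] B(2)[of t]
    show ?thesis by (simp add: has_real_derivative_iff_has_vector_derivative o_def)
  qed
  have cont: "continuous_map euclideanreal T.MT (\<lambda>t. \<psi> (B t))"
    unfolding \<psi>_def
  proof (rule T.continuous_map_curve[OF i'])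
    show "continuous_on UNIV (\<lambda>t. \<gamma> (B t))"
      unfolding continuous_on_eq_continuous_within
      by (intro ballI has_vector_derivative_continuous[OF has_vector_derivative_at_within[OF der]])
  qed (use \<gamma>i in auto)
  have c\<psi>: "cmap TM i (\<psi> (B t)) = \<gamma> (B t)" for t
    using T.cmap_cinv[OF i' \<gamma>i] by (simp add: \<psi>_def)
  have ham: "hamilton_eq \<sigma> (\<lambda>w. \<beta> t * G w) (\<lambda>t. \<psi> (B t)) t i" for t
    unfolding hamilton_eq_def c\<psi>
  proof (intro exI conjI allI)
    show "((\<lambda>t. \<gamma> (B t)) has_vector_derivative \<beta> t *\<^sub>R X (\<gamma> (B t))) (at t)" by (rule der)
    fix v
    let ?z = "\<gamma> (B t)"
    have zO: "?z \<in> O'" using \<gamma>(2)[OF B(1)] KO by blast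
    have x: "fst ?z \<in> cimage A i" using zO by (auto simp: O'_def)
    note dF = smooth_on_has_derivative[OF F zO]
    have bil: "twisted_form \<sigma> i ?z (b *\<^sub>R u) v = b * twisted_form \<sigma> i ?z u v" for b u
    proof -
      have l: "linear (\<sigma> i (fst ?z) u)" and a: "\<sigma> i (fst ?z) u v = - \<sigma> i (fst ?z) v u" for u v
        using \<sigma> i x unfolding two_form_def by blast+
      have "\<sigma> i (fst ?z) (b *\<^sub>R u') v' = b * \<sigma> i (fst ?z) u' v'" for u' v'
        using a[of "b *\<^sub>R u'" v'] a[of u' v'] linear_cmul[OF l[of v'], of b u'] by simp
      then show ?thesis by (simp add: twisted_form_def dp_wedge_dq_def pullback_pi_def algebra_simps)
    qed
    have "frechet_derivative ((\<lambda>w. \<beta> t * G w) \<circ> cinv TM i) (at ?z) v = \<beta> t * frechet_derivative F (at ?z) v"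
    proof -
      have "((\<lambda>z. \<beta> t * F z) has_derivative (\<lambda>v. \<beta> t * frechet_derivative F (at ?z) v)) (at ?z)"
        by (rule has_derivative_mult_right[OF dF])
      from fun_cong[OF frechet_derivative_at[OF this], of v] show ?thesis by (simp add: F_def o_def)
    qed
    then show "twisted_form \<sigma> i ?z (\<beta> t *\<^sub>R X ?z) v = - frechet_derivative ((\<lambda>w. \<beta> t * G w) \<circ> cinv TM i) (at ?z) v"
      using twisted_form_ham_field[OF \<sigma> i x has_derivative_linear[OF dF], of v] zO
      by (simp add: bil X_def)
  qed
  show ?thesis
  proof (rule that[of \<psi>])
    show "\<psi> 0 = w" by (simp add: \<psi>_def \<gamma>(1) z(2))
    fix t j assume j: "j \<in> charts A" "\<psi> (B t) \<in> cdom TM j"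
    have "smooth_function TM (\<lambda>w. \<beta> t * G w)"
      by (rule T.smooth_function_mult[OF T.smooth_function_const G])
    moreover have "\<psi> (B t) \<in> cdom TM i" unfolding \<psi>_def by (rule T.cinv_in_cdom[OF i' \<gamma>i])
    ultimately show "hamilton_eq \<sigma> (\<lambda>w. \<beta> t * G w) (\<lambda>t. \<psi> (B t)) t j"
      using hamilton_eq_transition[OF \<sigma> _ cont i _ j ham] by simp
  qed (rule cont)
qed

end

section \<open>Performing chart-supported Hamiltonian flows one after the other\<close>

text \<open>The \<open>k\<close>-th of \<open>n\<close> steps takes place while \<open>(k + 1/3) / n \<le> t \<le> (k + 2/3) / n\<close>;
  between the steps all fields vanish.\<close>

definition step_clock :: "nat \<Rightarrow> nat \<Rightarrow> real \<Rightarrow> real" where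
  "step_clock n k t = smooth_step (3 * (real n * t - real k) - 1)"

definition step_rate :: "nat \<Rightarrow> nat \<Rightarrow> real \<Rightarrow> real" where
  "step_rate n k t = frechet_derivative (step_clock n k) (at t) 1"

lemma smooth_on_step_clock: "smooth_on UNIV (step_clock n k)"
  unfolding step_clock_def[abs_def]
  by (rule smooth_on_compose[OF _ _ smooth_on_smooth_step]) (auto intro!: smooth_intros)

lemma smooth_on_step_rate: "smooth_on UNIV (step_rate n k)"
  unfolding step_rate_def[abs_def] by (rule smooth_on_frechet_derivative[OF smooth_on_step_clock])

lemma step_clock_has_derivative: "(step_clock n k has_real_derivative step_rate n k t) (at t)"
proof -
  note d = smooth_on_has_derivative[OF smooth_on_step_clock UNIV_I, of n k t]
  have "frechet_derivative (step_clock n k) (at t) = (*) (step_rate n k t)"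
  proof
    fix h
    show "frechet_derivative (step_clock n k) (at t) h = step_rate n k t * h"
      using linear_cmul[OF has_derivative_linear[OF d], of h 1] by (simp add: step_rate_def)
  qed
  with d show ?thesis by (simp add: has_field_derivative_def)
qed

lemma step_clock_in: "step_clock n k t \<in> {0..1}"
  using smooth_step_bounds by (simp add: step_clock_def)

lemma step_clock_eq_0: "real n * t - real k \<le> 1/3 \<Longrightarrow> step_clock n k t = 0"
  by (simp add: step_clock_def smooth_step_eq_0)

lemma step_clock_eq_1: "real n * t - real k \<ge> 2/3 \<Longrightarrow> step_clock n k t = 1"
  by (simp add: step_clock_def smooth_step_eq_1)

lemma step_rate_eq_0:
  assumes "real n * t - real k < 1/3 \<or> real n * t - real k > 2/3"
  shows "step_rate n k t = 0"
proof -
  have o: "open {t. real n * t - real k < 1/3}" "open {t. real n * t - real k > 2/3}"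
    by (intro open_Collect_less continuous_intros)+
  from assms have "\<exists>c. frechet_derivative (step_clock n k) (at t) = frechet_derivative (\<lambda>_. c) (at t)"
  proof
    assume t: "real n * t - real k < 1/3"
    show ?thesis
      by (rule exI, rule frechet_derivative_transform_open[OF o(1)]) (use t in \<open>auto intro!: step_clock_eq_0\<close>)
  next
    assume t: "real n * t - real k > 2/3"
    show ?thesis
      by (rule exI, rule frechet_derivative_transform_open[OF o(2)]) (use t in \<open>auto intro!: step_clock_eq_1\<close>)
  qed
  then show ?thesis by (auto simp: step_rate_def)
qed

context closed_manifold
begin

interpretation T: atlas TM by (rule atlas_TM)

definition integral_curve ::
    "('i, 'e) form2 \<Rightarrow> (real \<Rightarrow> 'a \<times> ('i \<Rightarrow> 'e) \<Rightarrow> real) \<Rightarrow> (real \<Rightarrow> 'a \<times> ('i \<Rightarrow> 'e)) \<Rightarrow> bool" where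
  "integral_curve \<sigma> F c \<longleftrightarrow> continuous_map euclideanreal (manifold_topology TM) c \<and>
     (\<forall>t. \<forall>j\<in>charts A. c t \<in> cdom TM j \<longrightarrow> hamilton_eq \<sigma> (F t) c t j)"

text \<open>Induction on the number m of steps performed. The invariant adds that the curve rests
  from (m - 1/3) / n on, when step m - 1 has ended; step m begins at (m + 1/3) / n, so old and new
  curve coincide on an interval around m / n and can be pasted.\<close>

lemma stepwise_integral_curve:
  assumes \<sigma>: "two_form A \<sigma>" and n: "n > 0"
    and I: "\<And>k. k < n \<Longrightarrow> I k \<in> charts A"
    and G: "\<And>k. k < n \<Longrightarrow> smooth_function TM (G k)"
    and K: "\<And>k. k < n \<Longrightarrow> compact (K k)" "\<And>k. k < n \<Longrightarrow> K k \<subseteq> cimage TM (I k)"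
      "\<And>k w. k < n \<Longrightarrow> w \<in> points TM \<Longrightarrow> w \<notin> cinv TM (I k) ` K k \<Longrightarrow> G k w = 0"
    and w: "w \<in> points TM"
  shows "\<exists>c. integral_curve \<sigma> (\<lambda>t w. \<Sum>k<n. step_rate n k t * G k w) c \<and> c 0 = w"
proof -
  have "m \<le> n \<Longrightarrow> \<exists>c w'. integral_curve \<sigma> (\<lambda>t w. \<Sum>k<m. step_rate n k t * G k w) c \<and> c 0 = w \<and>
      (\<forall>t. real n * t \<ge> real m - 1/3 \<longrightarrow> c t = w')" for m
  proof (induction m)
    case 0
    have "integral_curve \<sigma> (\<lambda>t w. \<Sum>k<0. step_rate n k t * G k w) (\<lambda>_. w)"
      unfolding integral_curve_def
    proof (intro conjI allI ballI impI)
      show "continuous_map euclideanreal T.MT (\<lambda>_. w)" using w T.topspace_MT by simp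
      fix t j assume j: "j \<in> charts A" "w \<in> cdom TM j"
      have "twisted_form \<sigma> j (cmap TM j w) 0 v = 0" for v
        using j by (intro twisted_form_zero[OF \<sigma> j(1)]) (auto simp: cmap_TM cdom_TM cimage_def)
      then show "hamilton_eq \<sigma> (\<lambda>w. \<Sum>k<0. step_rate n k t * G k w) (\<lambda>_. w) t j"
        unfolding hamilton_eq_def by (intro exI[of _ 0]) (simp add: o_def)
    qed
    then show ?case by blast
  next
    case (Suc m)
    then obtain c w' where c: "integral_curve \<sigma> (\<lambda>t w. \<Sum>k<m. step_rate n k t * G k w) c" "c 0 = w"
      "\<And>t. real n * t \<ge> real m - 1/3 \<Longrightarrow> c t = w'" by auto
    have m: "m < n" using Suc by simp
    have "c (real m / real n) = w'" using n by (intro c(3)) simp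
    moreover have cc: "continuous_map euclideanreal T.MT c" using c(1) by (simp add: integral_curve_def)
    ultimately have w': "w' \<in> points TM"
      using T.topspace_MT unfolding continuous_map by (metis UNIV_I image_subset_iff topspace_euclidean)
    obtain \<psi> where \<psi>: "\<psi> 0 = w'" "continuous_map euclideanreal T.MT (\<lambda>t. \<psi> (step_clock n m t))"
      "\<And>t j. j \<in> charts A \<Longrightarrow> \<psi> (step_clock n m t) \<in> cdom TM j \<Longrightarrow>
         hamilton_eq \<sigma> (\<lambda>w. step_rate n m t * G m w) (\<lambda>t. \<psi> (step_clock n m t)) t j"
      by (rule chart_supported_flow[where B = "step_clock n m" and \<beta> = "step_rate n m", OF \<sigma> G[OF m] I[OF m]
          K(1)[OF m] K(2)[OF m] _ step_clock_in step_clock_has_derivative w']) (erule (1) K(3)[OF m], rule that)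
    define d where "d t = \<psi> (step_clock n m t)" for t
    \<comment> \<open>Switching at m / n, in the middle of the resting interval.\<close>
    define e where "e t = (if real n * t < real m then c t else d t)" for t
    have ec: "e t = c t" if "t < (real m + 1/3) / real n" for t
    proof (cases "real n * t < real m")
      case False
      have "real n * t < real m + 1/3" using that n by (simp add: field_simps)
      then have "d t = w'" using \<psi>(1) step_clock_eq_0[of n t m] by (simp add: d_def)
      then show ?thesis using False c(3)[of t] by (simp add: e_def)
    qed (simp add: e_def)
    have ed: "e t = d t" if "t > (real m - 1/3) / real n" for t
    proof (cases "real n * t < real m")
      case True
      have "real n * t > real m - 1/3" using that n by (simp add: field_simps)
      moreover have "d t = w'" using \<psi>(1) step_clock_eq_0[of n t m] True by (simp add: d_def)
      ultimately show ?thesis using True c(3)[of t] by (simp add: e_def)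
    qed (simp add: e_def)
    have "integral_curve \<sigma> (\<lambda>t w. \<Sum>k<Suc m. step_rate n k t * G k w) e"
      unfolding integral_curve_def
    proof (intro conjI allI ballI impI)
      have "(real m - 1/3) / real n < (real m + 1/3) / real n" using n by (simp add: divide_strict_right_mono)
      then show "continuous_map euclideanreal T.MT e"
        using ec ed \<psi>(2) by (intro continuous_map_paste[OF cc _ _ ec ed]) (auto simp: d_def)
      fix t j assume j: "j \<in> charts A" "e t \<in> cdom TM j"
      show "hamilton_eq \<sigma> (\<lambda>w. \<Sum>k<Suc m. step_rate n k t * G k w) e t j"
      proof (cases "t < (real m + 1/3) / real n")
        case True
        then have "real n * t < real m + 1/3" using n by (simp add: field_simps)
        then have "step_rate n m t = 0" by (intro step_rate_eq_0) simp
        then have eq: "(\<lambda>w. \<Sum>k<Suc m. step_rate n k t * G k w) = (\<lambda>w. \<Sum>k<m. step_rate n k t * G k w)" by simp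
        have "hamilton_eq \<sigma> (\<lambda>w. \<Sum>k<m. step_rate n k t * G k w) c t j"
          using c(1) j ec[OF True] unfolding integral_curve_def by simp
        then show ?thesis unfolding eq
          by (rule hamilton_eq_cong[of _ _ _ _ _ "{..<(real m + 1/3) / real n}"]) (use True ec in auto)
      next
        case False
        have "(real m - 1/3) / real n < (real m + 1/3) / real n" using n by (simp add: divide_strict_right_mono)
        then have t: "t > (real m - 1/3) / real n" using False by linarith
        \<comment> \<open>All earlier steps are over: step k ends at (k + 2/3) / n, and k + 2/3
          \<le> m - 1/3.\<close>
        have "step_rate n k t = 0" if "k < m" for k
        proof -
          have "real k + 1 \<le> real m" using that by linarith
          moreover have "real n * t > real m - 1/3" using t n by (simp add: field_simps)
          ultimately show ?thesis by (intro step_rate_eq_0) linarith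
        qed
        then have eq: "(\<lambda>w. \<Sum>k<Suc m. step_rate n k t * G k w) = (\<lambda>w. step_rate n m t * G m w)" by simp
        have "hamilton_eq \<sigma> (\<lambda>w. step_rate n m t * G m w) d t j"
          using \<psi>(3)[OF j(1), of t] j(2) ed[OF t] unfolding d_def by simp
        then show ?thesis unfolding eq
          by (rule hamilton_eq_cong[of _ _ _ _ _ "{(real m - 1/3) / real n<..}"]) (use t ed in auto)
      qed
    qed
    moreover have "e 0 = w"
    proof (cases "m = 0")
      case True
      then have "c 0 = w'" by (intro c(3)) simp
      then show ?thesis using True c(2) \<psi>(1) step_clock_eq_0[of n 0 0] by (simp add: e_def d_def)
    next
      case False
      then show ?thesis using c(2) by (simp add: e_def)
    qed
    moreover have "e t = \<psi> 1" if "real n * t \<ge> real (Suc m) - 1/3" for t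
    proof -
      have "step_clock n m t = 1" using that by (intro step_clock_eq_1) simp
      then show ?thesis using that by (simp add: e_def d_def)
    qed
    ultimately show ?case by blast
  qed
  from this[OF order.refl] show ?thesis by blast
qed

text \<open>For the smooth F of the application, integral curves are unique, so the assembled map is
  the actual flow. Inserting the explicit curves on S by hand saves a uniqueness proof.\<close>

lemma hamiltonian_flow_of_curves:
  assumes "\<And>w. w \<in> points TM \<Longrightarrow> \<exists>c. integral_curve \<sigma> F c \<and> c 0 = w"
    and "\<And>w. w \<in> S \<Longrightarrow> integral_curve \<sigma> F (e w) \<and> e w 0 = w"
  obtains \<Phi> where "hamiltonian_flow TM (twisted_form \<sigma>) F \<Phi>" "\<And>w t. w \<in> S \<Longrightarrow> \<Phi> t w = e w t"
proof -
  have "\<forall>w\<in>points TM. \<exists>c. integral_curve \<sigma> F c \<and> c 0 = w" using assms(1) by blast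
  from bchoice[OF this] obtain C where C: "\<And>w. w \<in> points TM \<Longrightarrow> integral_curve \<sigma> F (C w) \<and> C w 0 = w" by blast
  define \<Phi> where "\<Phi> t w = (if w \<in> S then e w t else C w t)" for t w
  have \<Phi>: "integral_curve \<sigma> F (\<lambda>t. \<Phi> t w) \<and> \<Phi> 0 w = w" if "w \<in> points TM" for w
    using C[OF that] assms(2)[of w] by (cases "w \<in> S") (simp_all add: \<Phi>_def)
  show ?thesis
  proof (rule that[of \<Phi>])
    show "hamiltonian_flow TM (twisted_form \<sigma>) F \<Phi>"
      using \<Phi> unfolding hamiltonian_flow_def integral_curve_def hamilton_eq_def by simp
  qed (simp add: \<Phi>_def)
qed

lemma compactly_supported_stepwise:
  assumes I: "\<And>k. k < n \<Longrightarrow> I k \<in> charts A"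
    and G: "\<And>k. k < n \<Longrightarrow> smooth_function TM (G k)"
    and K: "\<And>k. k < n \<Longrightarrow> compact (K k)" "\<And>k. k < n \<Longrightarrow> K k \<subseteq> cimage TM (I k)"
      "\<And>k w. k < n \<Longrightarrow> w \<in> points TM \<Longrightarrow> w \<notin> cinv TM (I k) ` K k \<Longrightarrow> G k w = 0"
  shows "compactly_supported_hamiltonian TM (\<lambda>t w. \<Sum>k<n. step_rate n k t * G k w)"
  unfolding compactly_supported_hamiltonian_def
proof (intro conjI ballI)
  fix i assume i: "i \<in> charts TM"
  have o: "open ((UNIV :: real set) \<times> cimage TM i)" by (intro open_Times T.open_cimage i open_UNIV)
  have "smooth_on (UNIV \<times> cimage TM i) (\<lambda>z. step_rate n k (fst z) * G k (cinv TM i (snd z)))" if "k < n" for k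
  proof (rule smooth_on_mult[OF o])
    show "smooth_on ((UNIV :: real set) \<times> cimage TM i) (\<lambda>z. step_rate n k (fst z))"
      by (rule smooth_on_compose[OF o smooth_on_bounded_linear_fun[OF o bounded_linear_fst] smooth_on_step_rate]) simp
    show "smooth_on ((UNIV :: real set) \<times> cimage TM i) (\<lambda>z. G k (cinv TM i (snd z)))"
      by (rule smooth_on_compose[OF o smooth_on_bounded_linear_fun[OF o bounded_linear_snd] T.smooth_functionD[OF G[OF that] i]]) auto
  qed
  then show "smooth_on (UNIV \<times> cimage TM i) (\<lambda>(t, x). \<Sum>k<n. step_rate n k t * G k (cinv TM i x))"
    unfolding case_prod_beta by (intro smooth_on_sum o) simp
next
  have "compactin T.MT (\<Union>((\<lambda>k. cinv TM (I k) ` K k) ` {..<n}))"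
    using I K by (intro compactin_Union) (auto intro!: T.compactin_cinv_image)
  moreover have "\<forall>t. \<forall>w\<in>points TM - \<Union>((\<lambda>k. cinv TM (I k) ` K k) ` {..<n}).
      (\<Sum>k<n. step_rate n k t * G k w) = 0"
    using K(3) by (auto intro!: sum.neutral)
  ultimately show "\<exists>K. compactin T.MT K \<and> (\<forall>t. \<forall>w\<in>points TM - K. (\<Sum>k<n. step_rate n k t * G k w) = 0)" by blast
qed

section \<open>Translations along the fibres\<close>

text \<open>The covector dg at q in the encoding of \<open>cotangent_space\<close>, which demands
  the value 0 in charts away from q.\<close>

definition covector :: "('a \<Rightarrow> real) \<Rightarrow> 'a \<Rightarrow> 'i \<Rightarrow> 'e" where
  "covector g q i = (if i \<in> charts A \<and> q \<in> cdom A i then gradient g i (cmap A i q) else 0)"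

lemma covector_in_cotangent_space:
  assumes "smooth_function A g"
  shows "covector g q \<in> cotangent_space A q"
  unfolding cotangent_space_def
proof (intro CollectI conjI allI impI ballI)
  fix i j v assume ij: "i \<in> charts A" "j \<in> charts A" "q \<in> cdom A i \<inter> cdom A j"
  then show "covector g q i \<bullet> v = covector g q j \<bullet> frechet_derivative (\<tau> i j) (at (cmap A i q)) v"
    using differential_transition[OF assms ij(1,2) cmap_in_overlap, of q v]
    by (simp add: covector_def differential_eq_gradient[OF assms, symmetric] cmap_in_cimage transition_cmap dtau_def)
qed (auto simp: covector_def)

lemma cotangent_space_diff_sum:
  assumes "p \<in> cotangent_space A q" "\<And>k. k \<in> S \<Longrightarrow> r k \<in> cotangent_space A q"
  shows "(\<lambda>i. p i - (\<Sum>k\<in>S. s k *\<^sub>R r k i)) \<in> cotangent_space A q"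
proof -
  have 0: "r k i = 0" if "k \<in> S" "\<not> (i \<in> charts A \<and> q \<in> cdom A i)" for k i
    using assms(2)[OF that(1)] that(2) unfolding cotangent_space_def by blast
  have eq: "u i \<bullet> v = u j \<bullet> dtau i j (cmap A i q) v"
    if "u \<in> cotangent_space A q" "i \<in> charts A" "j \<in> charts A" "q \<in> cdom A i \<inter> cdom A j" for u i j v
    using covector_transition[OF that(1-3)] that(4) by blast
  show ?thesis
    unfolding cotangent_space_def
  proof (intro CollectI conjI allI impI ballI)
    fix i assume "\<not> (i \<in> charts A \<and> q \<in> cdom A i)"
    then show "p i - (\<Sum>k\<in>S. s k *\<^sub>R r k i) = 0" using 0 assms(1) unfolding cotangent_space_def by simp
  next
    fix i j v assume ij: "i \<in> charts A" "j \<in> charts A" "q \<in> cdom A i \<inter> cdom A j"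
    have "(p i - (\<Sum>k\<in>S. s k *\<^sub>R r k i)) \<bullet> v = p i \<bullet> v - (\<Sum>k\<in>S. s k * (r k i \<bullet> v))"
      by (simp add: inner_diff_left inner_sum_left)
    also have "\<dots> = p j \<bullet> dtau i j (cmap A i q) v - (\<Sum>k\<in>S. s k * (r k j \<bullet> dtau i j (cmap A i q) v))"
      using eq[OF assms(1) ij] eq[OF assms(2) ij] by simp
    also have "\<dots> = (p j - (\<Sum>k\<in>S. s k *\<^sub>R r k j)) \<bullet> dtau i j (cmap A i q) v"
      by (simp add: inner_diff_left inner_sum_left)
    finally show "(p i - (\<Sum>k\<in>S. s k *\<^sub>R r k i)) \<bullet> v =
        (p j - (\<Sum>k\<in>S. s k *\<^sub>R r k j)) \<bullet> frechet_derivative (\<tau> i j) (at (cmap A i q)) v"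
      by (simp add: dtau_def)
  qed
qed

text \<open>G is g times a bump in the fibre coordinate of chart i. It agrees with the pullback of g
  near two kinds of points: those with small fibre coordinate, and those over the complement of the
  support of g, where both vanish at any height in the fibre.\<close>

lemma fibre_cutoff:
  assumes g: "smooth_function A g" and i: "i \<in> charts A" and C: "compact C" "C \<subseteq> cimage A i"
    and g0: "\<And>q. q \<in> points A \<Longrightarrow> q \<notin> cinv A i ` C \<Longrightarrow> g q = 0" and \<rho>: "\<rho> > 0"
  obtains G K where "smooth_function TM G" "compact K" "K \<subseteq> cimage TM i"
    "\<And>w. w \<in> points TM \<Longrightarrow> w \<notin> cinv TM i ` K \<Longrightarrow> G w = 0"
    "\<And>w. w \<in> points TM \<Longrightarrow> (fst w \<in> cinv A i ` C \<longrightarrow> norm (snd w i) < \<rho>) \<Longrightarrow>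
       \<exists>U. openin (manifold_topology TM) U \<and> w \<in> U \<and> (\<forall>w'\<in>U. G w' = g (fst w'))"
proof -
  have i': "i \<in> charts TM" using i by simp
  have "\<rho> < \<rho> + 1" by simp
  then obtain h :: "'e \<Rightarrow> real" where h: "smooth_on UNIV h" "\<And>z. 0 \<le> h z" "\<And>z. h z \<le> 1"
      "\<And>z. dist 0 z \<le> \<rho> \<Longrightarrow> h z = 1" "\<And>z. dist 0 z \<ge> \<rho> + 1 \<Longrightarrow> h z = 0"
    by (rule smooth_bump_exists[OF \<rho>, where c = 0]) (rule that)
  define K where "K = C \<times> cball (0::'e) (\<rho> + 1)"
  define u where "u z = g (cinv A i (fst z)) * h (snd z)" for z
  define G where "G w = (if w \<in> cdom TM i then u (cmap TM i w) else 0)" for w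
  have K: "compact K" "K \<subseteq> cimage TM i"
    using C cimage_TM[OF i] by (auto simp: K_def intro!: compact_Times)
  have o: "open (cimage TM i)" by (rule T.open_cimage[OF i'])
  have fst: "smooth_on (cimage TM i) fst" by (rule smooth_on_bounded_linear_fun[OF o bounded_linear_fst])
  have snd: "smooth_on (cimage TM i) snd" by (rule smooth_on_bounded_linear_fun[OF o bounded_linear_snd])
  have u: "smooth_on (cimage TM i) u"
    unfolding u_def[abs_def]
    by (intro smooth_on_mult o smooth_on_compose[OF o fst smooth_functionD[OF g i]] smooth_on_compose[OF o snd h(1)])
       (auto simp: cimage_TM[OF i])
  have out: "u z = 0" if z: "z \<in> cimage TM i" "z \<notin> K" for z
  proof (cases "fst z \<in> C")
    case True
    then have "snd z \<notin> cball 0 (\<rho> + 1)" using z(2) by (cases z) (auto simp: K_def)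
    then have "h (snd z) = 0" by (intro h(5)) simp
    then show ?thesis by (simp add: u_def)
  next
    case False
    have x: "fst z \<in> cimage A i" using z(1) by (auto simp: cimage_TM[OF i])
    have "cinv A i (fst z) \<notin> cinv A i ` C"
    proof
      assume "cinv A i (fst z) \<in> cinv A i ` C"
      then obtain x' where "x' \<in> C" "cinv A i (fst z) = cinv A i x'" by auto
      then show False using cmap_cinv[OF i] x C(2) False by (metis subsetD)
    qed
    then have "g (cinv A i (fst z)) = 0"
      using g0 cinv_in_cdom[OF i x] cdom_subset_points[OF i] by blast
    then show ?thesis by (simp add: u_def)
  qed
  have cl: "closedin T.MT (cinv TM i ` K)" by (rule closedin_TM_chart_image[OF i K])
  have sm: "smooth_function TM G"
    unfolding G_def
  proof (rule T.smooth_function_extend[OF i' cl _ u])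
    show "cinv TM i ` K \<subseteq> cdom TM i" using K(2) T.cinv_in_cdom[OF i'] by blast
    show "u z = 0" if "z \<in> cimage TM i" "cinv TM i z \<notin> cinv TM i ` K" for z
      using out[OF that(1)] that(2) by blast
  qed
  show ?thesis
  proof (rule that[OF sm K])
    fix w assume w: "w \<in> points TM" "w \<notin> cinv TM i ` K"
    show "G w = 0"
    proof (cases "w \<in> cdom TM i")
      case True
      have "cmap TM i w \<notin> K"
      proof
        assume "cmap TM i w \<in> K"
        then have "cinv TM i (cmap TM i w) \<in> cinv TM i ` K" by (rule imageI)
        then show False using w(2) T.cinv_cmap[OF i' True] by simp
      qed
      then show ?thesis using out T.cmap_in_cimage[OF True] True by (simp add: G_def)
    qed (simp add: G_def)
  next
    fix w assume w: "w \<in> points TM" "fst w \<in> cinv A i ` C \<longrightarrow> norm (snd w i) < \<rho>"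
    show "\<exists>U. openin T.MT U \<and> w \<in> U \<and> (\<forall>w'\<in>U. G w' = g (fst w'))"
    proof (cases "fst w \<in> cinv A i ` C")
      case True
      let ?U = "{w' \<in> cdom TM i. cmap TM i w' \<in> {z. norm (snd z) < \<rho>}}"
      have "open {z :: 'e \<times> 'e. norm (snd z) < \<rho>}" by (intro open_Collect_less continuous_intros)
      then have "openin T.MT ?U" by (rule T.openin_chart_preimage[OF i'])
      moreover have "cinv A i ` C \<subseteq> cdom A i"
        using C(2) cinv_in_cdom[OF i] by (meson image_subsetI subsetD)
      then have "fst w \<in> cdom A i" using True by (rule subsetD)
      then have "w \<in> ?U" using w True by (simp add: cdom_TM points_TM cmap_TM)
      moreover have "G w' = g (fst w')" if "w' \<in> ?U" for w'
      proof -
        have "h (snd w' i) = 1" using that by (intro h(4)) (simp add: cmap_TM)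
        then show ?thesis using that cinv_cmap[OF i] by (simp add: G_def u_def cmap_TM cdom_TM)
      qed
      ultimately show ?thesis by blast
    next
      case False
      have "closedin MT (cinv A i ` C)"
        using compactin_imp_closedin[OF Hausdorff compactin_cinv_image[OF i C]] .
      then have V: "openin MT (points A - cinv A i ` C)" by (simp add: closedin_def topspace_MT)
      let ?U = "{w' \<in> points TM. fst w' \<in> points A - cinv A i ` C}"
      have "openin T.MT ?U" by (rule openin_TM_fst[OF V])
      moreover have "w \<in> ?U" using w(1) False by (simp add: points_TM)
      moreover have "G w' = g (fst w')" if "w' \<in> ?U" for w'
      proof -
        have "g (fst w') = 0" using that g0 by blast
        then show ?thesis using cinv_cmap[OF i] by (simp add: G_def u_def cmap_TM cdom_TM)
      qed
      ultimately show ?thesis by blast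
    qed
  qed
qed

text \<open>Near each c t the Hamiltonian is a function of the base point alone, so its differential
  sees base directions only and is balanced by a vertical velocity, which is the derivative of the
  translation.\<close>

lemma fibre_translation_integral_curve:
  assumes \<sigma>: "two_form A \<sigma>" and n: "n > 0"
    and g: "\<And>k. k < n \<Longrightarrow> smooth_function A (g k)" and w: "w \<in> points TM"
    and c_def: "\<And>t. c t = (fst w, \<lambda>i. snd w i - (\<Sum>k<n. step_clock n k t *\<^sub>R covector (g k) (fst w) i))"
    and G: "\<And>k t. k < n \<Longrightarrow> \<exists>U. openin (manifold_topology TM) U \<and> c t \<in> U \<and> (\<forall>w'\<in>U. G k w' = g k (fst w'))"
  shows "integral_curve \<sigma> (\<lambda>t w. \<Sum>k<n. step_rate n k t * G k w) c"
  unfolding integral_curve_def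
proof (intro conjI allI ballI impI)
  let ?q = "fst w"
  have q: "?q \<in> points A" and p: "snd w \<in> cotangent_space A ?q" using w by (auto simp: points_TM)
  have cs: "snd (c t) \<in> cotangent_space A ?q" for t
    using cotangent_space_diff_sum[OF p covector_in_cotangent_space[OF g], of "{..<n}" "\<lambda>k. k"] by (simp add: c_def)
  have dom: "c t \<in> cdom TM j" if "?q \<in> cdom A j" for t j
    using cs that by (simp add: cdom_TM c_def)
  have cmap_c: "cmap TM j (c t) = (cmap A j ?q, snd w j - (\<Sum>k<n. step_clock n k t *\<^sub>R covector (g k) ?q j))" for t j
    by (simp add: cmap_TM c_def)
  have der: "((\<lambda>t. cmap TM j (c t)) has_vector_derivative (0, - (\<Sum>k<n. step_rate n k t *\<^sub>R covector (g k) ?q j))) (at t)" for t j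
  proof -
    have "((\<lambda>t. step_clock n k t *\<^sub>R v) has_vector_derivative step_rate n k t *\<^sub>R v) (at t)" for k and v :: 'e
      using has_vector_derivative_scaleR[OF step_clock_has_derivative has_vector_derivative_const] by simp
    then have "((\<lambda>t. snd w j - (\<Sum>k<n. step_clock n k t *\<^sub>R covector (g k) ?q j)) has_vector_derivative
        0 - (\<Sum>k<n. step_rate n k t *\<^sub>R covector (g k) ?q j)) (at t)"
      by (intro has_vector_derivative_diff has_vector_derivative_const has_vector_derivative_sum)
    then show ?thesis
      unfolding cmap_c using has_vector_derivative_Pair[OF has_vector_derivative_const] by simp
  qed
  obtain i where i: "i \<in> charts A" "?q \<in> cdom A i" using q by (auto simp: points_def)
  have "continuous_map euclideanreal T.MT (\<lambda>t. cinv TM i (cmap TM i (c t)))"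
  proof (rule T.continuous_map_curve)
    show "continuous_on UNIV (\<lambda>t. cmap TM i (c t))"
      unfolding continuous_on_eq_continuous_within
      by (intro ballI has_vector_derivative_continuous[OF has_vector_derivative_at_within[OF der]])
    show "range (\<lambda>t. cmap TM i (c t)) \<subseteq> cimage TM i" using T.cmap_in_cimage[OF dom[OF i(2)]] by blast
  qed (use i in simp)
  then show "continuous_map euclideanreal T.MT c"
    using T.cinv_cmap[OF _ dom[OF i(2)]] i(1) by simp
  fix t j assume j: "j \<in> charts A" "c t \<in> cdom TM j"
  then have j': "j \<in> charts TM" "?q \<in> cdom A j" by (auto simp: cdom_TM c_def)
  let ?z = "cmap TM j (c t)" and ?x = "cmap A j ?q"
  have "\<forall>k\<in>{..<n}. \<exists>U. openin T.MT U \<and> c t \<in> U \<and> (\<forall>w'\<in>U. G k w' = g k (fst w'))" using G by blast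
  from bchoice[OF this] obtain U where U: "\<And>k. k < n \<Longrightarrow> openin T.MT (U k)" "\<And>k. k < n \<Longrightarrow> c t \<in> U k"
    "\<And>k w'. k < n \<Longrightarrow> w' \<in> U k \<Longrightarrow> G k w' = g k (fst w')" by auto
  \<comment> \<open>One neighbourhood for all pieces. Since n > 0, the index set of the intersection
    is not empty.\<close>
  define V where "V = (\<Inter>k<n. U k)"
  have V: "openin T.MT V" "c t \<in> V"
    using U n unfolding V_def by (auto intro!: openin_INT2)
  let ?S = "cmap TM j ` (V \<inter> cdom TM j)"
  have S: "open ?S" "?z \<in> ?S" using V j j' unfolding T.openin_iff by auto
  have xc: "?x \<in> cimage A j" by (rule cmap_in_cimage[OF j'(2)])
  have D: "((\<lambda>z. \<Sum>k<n. step_rate n k t * g k (cinv A j (fst z))) has_derivative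
      (\<lambda>v. \<Sum>k<n. step_rate n k t * (covector (g k) ?q j \<bullet> fst v))) (at ?z)"
  proof (rule has_derivative_sum, rule has_derivative_mult_right)
    fix k assume "k \<in> {..<n}"
    then have k: "k < n" by simp
    have "((\<lambda>x. g k (cinv A j x)) has_derivative differential (g k) j ?x) (at (fst ?z))"
      using differential[OF g[OF k] j(1) xc] by (simp add: cmap_c)
    from diff_chain_at[OF bounded_linear_imp_has_derivative[OF bounded_linear_fst] this]
    have "((\<lambda>z. g k (cinv A j (fst z))) has_derivative (\<lambda>v. differential (g k) j ?x (fst v))) (at ?z)"
      by (simp add: o_def)
    then show "((\<lambda>z. g k (cinv A j (fst z))) has_derivative (\<lambda>v. covector (g k) ?q j \<bullet> fst v)) (at ?z)"
      using differential_eq_gradient[OF g[OF k] j(1) xc] j(1) j'(2) by (simp add: covector_def)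
  qed
  have "((\<lambda>z. \<Sum>k<n. step_rate n k t * G k (cinv TM j z)) has_derivative
      (\<lambda>v. \<Sum>k<n. step_rate n k t * (covector (g k) ?q j \<bullet> fst v))) (at ?z)"
  proof (rule has_derivative_transform_within_open[OF D S])
    fix z assume "z \<in> ?S"
    then obtain w' where w': "w' \<in> V" "w' \<in> cdom TM j" "z = cmap TM j w'" by auto
    have "G k (cinv TM j z) = g k (cinv A j (fst z))" if "k < n" for k
    proof -
      have "cinv TM j z = w'" using T.cinv_cmap[OF j'(1) w'(2)] w'(3) by simp
      moreover have "cinv A j (fst z) = fst w'" using w'(2,3) cinv_cmap[OF j(1)] by (simp add: cmap_TM cdom_TM)
      moreover have "G k w' = g k (fst w')" using w'(1) that by (intro U(3)) (auto simp: V_def)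
      ultimately show ?thesis by simp
    qed
    then show "(\<Sum>k<n. step_rate n k t * g k (cinv A j (fst z))) = (\<Sum>k<n. step_rate n k t * G k (cinv TM j z))"
      by simp
  qed
  note fd = fun_cong[OF frechet_derivative_at[OF this]]
  \<comment> \<open>The base component of the velocity is 0, so this kills the \<sigma>
    term.\<close>
  have "linear (\<sigma> j ?x u)" "\<sigma> j ?x 0 u = - \<sigma> j ?x u 0" for u
    using \<sigma> j(1) xc unfolding two_form_def by blast+
  then have \<sigma>0: "\<sigma> j ?x 0 u = 0" for u using linear_0 by fastforce
  show "hamilton_eq \<sigma> (\<lambda>w. \<Sum>k<n. step_rate n k t * G k w) c t j"
    unfolding hamilton_eq_def
  proof (intro exI conjI allI)
    show "((\<lambda>s. cmap TM j (c s)) has_vector_derivative (0, - (\<Sum>k<n. step_rate n k t *\<^sub>R covector (g k) ?q j))) (at t)"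
      by (rule der)
    fix v
    show "twisted_form \<sigma> j ?z (0, - (\<Sum>k<n. step_rate n k t *\<^sub>R covector (g k) ?q j)) v =
        - frechet_derivative ((\<lambda>w. \<Sum>k<n. step_rate n k t * G k w) \<circ> cinv TM j) (at ?z) v"
      unfolding o_def fd[symmetric]
      using \<sigma>0 by (simp add: twisted_form_def dp_wedge_dq_def pullback_pi_def cmap_c inner_sum_left)
  qed
qed

end

section \<open>Energy sublevels of Tonelli Hamiltonians\<close>

lemma smooth_on_deriv:
  fixes g :: "real \<Rightarrow> real"
  assumes "smooth_on UNIV g"
  shows "(g has_real_derivative deriv g s) (at s)" "smooth_on UNIV (deriv g)"
proof -
  have d: "(g has_real_derivative frechet_derivative g (at s) 1) (at s)" for s
  proof -
    note f = smooth_on_has_derivative[OF assms UNIV_I, of s]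
    have "frechet_derivative g (at s) = (*) (frechet_derivative g (at s) 1)"
    proof
      fix h
      show "frechet_derivative g (at s) h = frechet_derivative g (at s) 1 * h"
        using linear_cmul[OF has_derivative_linear[OF f], of h 1] by simp
    qed
    with f show ?thesis unfolding has_field_derivative_def by simp
  qed
  have eq: "deriv g = (\<lambda>s. frechet_derivative g (at s) 1)"
    by (rule ext) (rule DERIV_imp_deriv[OF d])
  show "(g has_real_derivative deriv g s) (at s)" unfolding eq by (rule d)
  show "smooth_on UNIV (deriv g)" unfolding eq by (rule smooth_on_frechet_derivative[OF assms])
qed

context closed_manifold
begin

interpretation T: atlas TM by (rule atlas_TM)

context
  fixes H :: "'a \<times> ('i \<Rightarrow> 'e) \<Rightarrow> real"
  assumes tonelli: "tonelli A H"
begin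

definition local_H :: "'i \<Rightarrow> 'e \<times> 'e \<Rightarrow> real" where
  "local_H i z = H (cinv TM i z)"

lemma smooth_on_local_H:
  assumes "i \<in> charts A"
  shows "smooth_on (cimage A i \<times> UNIV) (local_H i)"
proof -
  have "smooth_function TM H" using tonelli by (simp add: tonelli_def)
  from T.smooth_functionD[OF this, of i] assms show ?thesis
    by (simp add: local_H_def[abs_def] cimage_TM)
qed

lemma local_H_cmap: "i \<in> charts A \<Longrightarrow> w \<in> cdom TM i \<Longrightarrow> local_H i (cmap A i (fst w), snd w i) = H w"
  using T.cinv_cmap[of i w] by (simp add: local_H_def cmap_TM)

lemma open_local_H_greater:
  assumes "i \<in> charts A"
  shows "open {z \<in> cimage A i \<times> UNIV. local_H i z > a}" "open {z \<in> cimage A i \<times> UNIV. local_H i z < a}"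
proof -
  have o: "open (cimage A i \<times> (UNIV :: 'e set))" by (intro open_Times open_cimage assms open_UNIV)
  note c = smooth_on_imp_continuous_on[OF smooth_on_local_H[OF assms]]
  have "open ((cimage A i \<times> UNIV) \<inter> local_H i -` {a<..})" "open ((cimage A i \<times> UNIV) \<inter> local_H i -` {..<a})"
    by (intro continuous_open_preimage c o open_greaterThan open_lessThan)+
  moreover have "{z \<in> cimage A i \<times> UNIV. local_H i z > a} = (cimage A i \<times> UNIV) \<inter> local_H i -` {a<..}"
    "{z \<in> cimage A i \<times> UNIV. local_H i z < a} = (cimage A i \<times> UNIV) \<inter> local_H i -` {..<a}" by auto
  ultimately show "open {z \<in> cimage A i \<times> UNIV. local_H i z > a}" "open {z \<in> cimage A i \<times> UNIV. local_H i z < a}"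
    by simp_all
qed

text \<open>\<open>fibrewise_convex\<close> gives the sign of the second derivative at parameter 0
  only. Starting at the covector with coordinates s0 y moves an arbitrary parameter s0 to 0.\<close>

lemma convex_local_H:
  assumes i: "i \<in> charts A" and x: "x \<in> cimage A i" and y: "y \<noteq> 0"
  shows "convex_on UNIV (\<lambda>s. local_H i (x, s *\<^sub>R y))"
proof -
  define g where "g s = local_H i (x, s *\<^sub>R y)" for s
  have "smooth_on UNIV (\<lambda>s::real. (x, s *\<^sub>R y))" by (intro smooth_intros open_UNIV)
  then have g: "smooth_on UNIV g"
    unfolding g_def[abs_def] by (rule smooth_on_compose[OF open_UNIV _ smooth_on_local_H[OF i]]) (use x in auto)
  note d1 = smooth_on_deriv[OF g]
  note d2 = smooth_on_deriv[OF d1(2)]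
  let ?q = "cinv A i x"
  define r where "r = snd (cinv TM i (x, y))"
  have r: "r \<in> cotangent_space A ?q" "r i = y"
    using cinv_TM[OF i x, of y] by (auto simp: cdom_TM r_def)
  have "deriv (deriv g) s0 \<ge> 0" for s0
  proof -
    define p where "p = snd (cinv TM i (x, s0 *\<^sub>R y))"
    have p: "p \<in> cotangent_space A ?q" "p i = s0 *\<^sub>R y"
      using cinv_TM[OF i x, of "s0 *\<^sub>R y"] by (auto simp: cdom_TM p_def)
    have Hs: "H (?q, \<lambda>i. p i + s *\<^sub>R r i) = g (s + s0)" for s
    proof -
      \<comment> \<open>The closure lemma with a one-element index set and coefficient -s, to see
        that p + s r is a covector.\<close>
      have "(\<lambda>j. p j - (\<Sum>k\<in>{()}. (- s) *\<^sub>R r j)) \<in> cotangent_space A ?q"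
        by (rule cotangent_space_diff_sum[OF p(1), of "{()}" "\<lambda>_. r" "\<lambda>_. - s"]) (rule r(1))
      then have "(?q, \<lambda>j. p j + s *\<^sub>R r j) \<in> cdom TM i"
        using cinv_in_cdom[OF i x] by (simp add: cdom_TM)
      from local_H_cmap[OF i this] show ?thesis
        using cmap_cinv[OF i x] by (simp add: g_def p(2) r(2) algebra_simps)
    qed
    have "r \<noteq> (\<lambda>_. 0)" using r(2) y by auto
    moreover have "?q \<in> points A" using cinv_in_cdom[OF i x] cdom_subset_points[OF i] by blast
    ultimately have "(deriv ^^ 2) (\<lambda>s::real. H (?q, \<lambda>i. p i + s *\<^sub>R r i)) 0 > 0"
      using tonelli p(1) r(1) unfolding tonelli_def fibrewise_convex_def by blast
    then have pos: "deriv (deriv (\<lambda>s. g (s + s0))) 0 > 0" unfolding Hs by (simp add: numeral_2_eq_2)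
    have "deriv (\<lambda>s. g (s + s0)) = (\<lambda>s. deriv g (s + s0))"
    proof
      fix s
      show "deriv (\<lambda>s. g (s + s0)) s = deriv g (s + s0)"
        by (rule DERIV_imp_deriv[OF d1(1)[of "s + s0", unfolded DERIV_shift]])
    qed
    moreover have "deriv (\<lambda>s. deriv g (s + s0)) 0 = deriv (deriv g) (0 + s0)"
      by (rule DERIV_imp_deriv[OF d2(1)[of "0 + s0", unfolded DERIV_shift]])
    ultimately show ?thesis using pos by simp
  qed
  then have "convex_on UNIV g" by (intro f''_ge0_imp_convex[OF convex_UNIV d1(1) d2(1)])
  then show ?thesis by (simp add: g_def[abs_def])
qed

text \<open>Superlinearity in one fibre, compactness of a sphere and convexity along rays give
  coercivity that is uniform over nearby fibres.\<close>

lemma local_H_coercive_near: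
  assumes i: "i \<in> charts A" and x0: "x0 \<in> cimage A i"
  obtains X R where "open X" "x0 \<in> X" "X \<subseteq> cimage A i" "R > 0"
    "\<And>x y. x \<in> X \<Longrightarrow> norm y \<ge> R \<Longrightarrow> local_H i (x, y) > c"
proof -
  \<comment> \<open>At least c, and at least as large as H on the zero covectors over points near
    x0.\<close>
  define b where "b = max c (local_H i (x0, 0) + 1)"
  have "fibrewise_superlinear A H" using tonelli by (simp add: tonelli_def)
  then obtain R1 where R1: "\<And>p. p \<in> cotangent_space A (cinv A i x0) \<Longrightarrow> norm (p i) \<ge> R1 \<Longrightarrow>
      H (cinv A i x0, p) \<ge> 1 * norm (p i)"
    using i cinv_in_cdom[OF i x0] unfolding fibrewise_superlinear_def by blast
  \<comment> \<open>On the sphere of radius R growth with slope 1 already gives H \<ge> R \<ge> b +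
    1.\<close>
  define R where "R = max (max R1 (b + 1)) 1"
  have big: "local_H i (x0, y) > b" if "norm y = R" for y
  proof -
    note w = cinv_TM[OF i x0, of y]
    define p where "p = snd (cinv TM i (x0, y))"
    have p: "p \<in> cotangent_space A (cinv A i x0)" "p i = y" using w by (auto simp: cdom_TM p_def)
    have "cinv TM i (x0, y) = (cinv A i x0, p)" using w(3) by (simp add: p_def prod_eq_iff)
    then have "local_H i (x0, y) \<ge> norm y" using R1[OF p(1)] p(2) that by (simp add: local_H_def R_def)
    then show ?thesis using that by (simp add: R_def)
  qed
  let ?O = "cimage A i \<times> (UNIV :: 'e set)"
  have "{x0} \<times> sphere 0 R \<subseteq> {z \<in> ?O. local_H i z > b}" using big x0 by auto
  from Elementary_Topology.tube_lemma[OF compact_sphere open_local_H_greater(1)[OF i] this]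
  obtain X1 where X1: "x0 \<in> X1" "open X1" "X1 \<times> sphere 0 R \<subseteq> {z \<in> ?O. local_H i z > b}" by blast
  have "{x0} \<times> {0} \<subseteq> {z \<in> ?O. local_H i z < local_H i (x0, 0) + 1}" using x0 by auto
  from Elementary_Topology.tube_lemma[OF compact_sing open_local_H_greater(2)[OF i] this]
  obtain X2 where X2: "x0 \<in> X2" "open X2" "X2 \<times> {0} \<subseteq> {z \<in> ?O. local_H i z < local_H i (x0, 0) + 1}" by blast
  show ?thesis
  proof (rule that[of "X1 \<inter> X2" R])
    show "X1 \<inter> X2 \<subseteq> cimage A i" using X2(3) by auto
    show R0: "R > 0" by (simp add: R_def)
    fix x y :: 'e assume x: "x \<in> X1 \<inter> X2" and y: "norm y \<ge> R"
    have xi: "x \<in> cimage A i" using x X2(3) by auto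
    define e where "e = inverse (norm y) *\<^sub>R y"
    have ny: "norm y > 0" "y \<noteq> 0" using y R0 by auto
    have e: "norm e = 1" "norm y *\<^sub>R e = y" using ny by (auto simp: e_def)
    then have "e \<noteq> 0" by auto
    from convex_local_H[OF i xi this] have cv: "convex_on UNIV (\<lambda>s. local_H i (x, s *\<^sub>R e))" .
    have h0: "local_H i (x, 0) \<le> b" using x X2(3) by (force simp: b_def)
    have hR: "local_H i (x, R *\<^sub>R e) > b" using x X1(3) e(1) R0 by (auto simp: subset_eq)
    define t where "t = R / norm y"
    have t: "0 \<le> t" "t \<le> 1" "t * norm y = R" using y ny R0 by (auto simp: t_def field_simps)
    show "local_H i (x, y) > c"
    \<comment> \<open>If H were at most b at y, then, being at most b at 0, by convexity it would be
      at most b where the segment crosses the sphere of radius R.\<close>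
    proof (rule ccontr)
      assume "\<not> local_H i (x, y) > c"
      then have hy: "local_H i (x, y) \<le> b" by (simp add: b_def)
      have "local_H i (x, ((1 - t) *\<^sub>R 0 + t *\<^sub>R norm y) *\<^sub>R e)
          \<le> (1 - t) * local_H i (x, 0 *\<^sub>R e) + t * local_H i (x, norm y *\<^sub>R e)"
        using convex_onD[OF cv, of t 0 "norm y"] t by simp
      also have "\<dots> \<le> (1 - t) * b + t * b"
        using t h0 hy e(2) by (intro add_mono mult_left_mono) auto
      also have "\<dots> = b" by (simp add: algebra_simps)
      finally show False using hR t(3) by simp
    qed
  qed (use X1 X2 in auto)
qed

lemma local_H_coercive:
  assumes i: "i \<in> charts A" and C: "compact C" "C \<subseteq> cimage A i"
  obtains R where "R > 0" "\<And>x y. x \<in> C \<Longrightarrow> norm y \<ge> R \<Longrightarrow> local_H i (x, y) > c"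
proof -
  have "\<forall>x\<in>C. \<exists>X. \<exists>R>0. open X \<and> x \<in> X \<and> (\<forall>x\<in>X. \<forall>y. norm y \<ge> R \<longrightarrow> local_H i (x, y) > c)"
  proof
    fix x assume "x \<in> C"
    then have "x \<in> cimage A i" using C(2) by blast
    then obtain X R where XR: "open X" "x \<in> X" "X \<subseteq> cimage A i" "R > 0"
      "\<And>x y. x \<in> X \<Longrightarrow> norm y \<ge> R \<Longrightarrow> local_H i (x, y) > c"
      by (rule local_H_coercive_near[OF i, where c = c]) (rule that)
    then show "\<exists>X. \<exists>R>0. open X \<and> x \<in> X \<and> (\<forall>x\<in>X. \<forall>y. norm y \<ge> R \<longrightarrow> local_H i (x, y) > c)"
      by (intro exI[of _ X] exI[of _ R] conjI ballI allI impI XR(1,2,4,5))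
  qed
  from bchoice[OF this] obtain X where "\<forall>x\<in>C. \<exists>R>0. open (X x) \<and> x \<in> X x \<and>
      (\<forall>x'\<in>X x. \<forall>y. norm y \<ge> R \<longrightarrow> local_H i (x', y) > c)" by blast
  from bchoice[OF this] obtain R where XR: "\<And>x. x \<in> C \<Longrightarrow> R x > 0" "\<And>x. x \<in> C \<Longrightarrow> open (X x)"
    "\<And>x. x \<in> C \<Longrightarrow> x \<in> X x" "\<And>x x' y. x \<in> C \<Longrightarrow> x' \<in> X x \<Longrightarrow> norm y \<ge> R x \<Longrightarrow> local_H i (x', y) > c" by blast
  have cover: "C \<subseteq> (\<Union>x\<in>C. X x)" using XR(3) by blast
  obtain C' where C': "C' \<subseteq> C" "finite C'" "C \<subseteq> (\<Union>x\<in>C'. X x)"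
    by (rule compactE_image[OF C(1) XR(2) cover]) (assumption, rule that)
  define R' where "R' = Max (insert 1 (R ` C'))"
  have R': "R' > 0" "\<And>x. x \<in> C' \<Longrightarrow> R x \<le> R'"
    using C'(2) by (auto simp: R'_def intro: less_le_trans[OF zero_less_one])
  show ?thesis
  proof (rule that[OF R'(1)])
    fix x y :: 'e assume x: "x \<in> C" and y: "norm y \<ge> R'"
    obtain x' where x': "x' \<in> C'" "x \<in> X x'" using x C'(3) by blast
    then show "local_H i (x, y) > c" using XR(4)[of x' x y] C'(1) R'(2)[of x'] y by auto
  qed
qed

text \<open>Some fibre has its infimum above k. Over nearby points, large covectors have energy
  above k by local coercivity, and the remaining compact ball of covectors is covered by the tube
  lemma.\<close>

lemma energy_gap:
  assumes ne: "points A \<noteq> {}" and k: "k < e0 A H"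
  obtains U where "openin MT U" "U \<noteq> {}" "\<And>w. w \<in> points TM \<Longrightarrow> fst w \<in> U \<Longrightarrow> H w > k"
proof -
  have "(\<lambda>q. INF p\<in>cotangent_space A q. H (q, p)) ` points A \<noteq> {}" using ne by simp
  from less_cSupD[OF this] obtain q where q: "q \<in> points A" "k < (INF p\<in>cotangent_space A q. H (q, p))"
    using k unfolding e0_def by blast
  obtain i where i: "i \<in> charts A" "q \<in> cdom A i" using q(1) by (auto simp: points_def)
  define x0 where "x0 = cmap A i q"
  have x0: "x0 \<in> cimage A i" "cinv A i x0 = q" using i by (auto simp: x0_def cmap_in_cimage cinv_cmap)
  have fibre: "H (q, p) = local_H i (x0, p i)" if "p \<in> cotangent_space A q" for p
    using local_H_cmap[OF i(1), of "(q, p)"] that i(2) by (simp add: cdom_TM x0_def)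
  \<comment> \<open>Coercivity with threshold 0 bounds H below on the fibre; without this the
    infimum of reals need not be a lower bound.\<close>
  obtain X0 R0 where XR0: "open X0" "x0 \<in> X0" "X0 \<subseteq> cimage A i" "R0 > 0"
    "\<And>x y. x \<in> X0 \<Longrightarrow> norm y \<ge> R0 \<Longrightarrow> local_H i (x, y) > 0"
    by (rule local_H_coercive_near[OF i(1) x0(1), where c = 0]) (rule that)
  have "continuous_on (cball 0 R0) (\<lambda>y. local_H i (x0, y))"
    by (rule continuous_on_compose2[OF smooth_on_imp_continuous_on[OF smooth_on_local_H[OF i(1)]]])
       (use x0 in \<open>auto intro!: continuous_intros\<close>)
  then have "bounded ((\<lambda>y. local_H i (x0, y)) ` cball 0 R0)"
    by (intro compact_imp_bounded compact_continuous_image compact_cball)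
  then obtain b where "\<forall>y\<in>(\<lambda>y. local_H i (x0, y)) ` cball 0 R0. norm y \<le> b"
    unfolding bounded_iff by blast
  then have b: "\<bar>local_H i (x0, y)\<bar> \<le> b" if "norm y \<le> R0" for y using that by simp
  have "min (- b) 0 \<le> local_H i (x0, y)" for y
    using b[of y] XR0(5)[OF XR0(2), of y] by (cases "norm y \<le> R0") auto
  then have "bdd_below ((\<lambda>p. H (q, p)) ` cotangent_space A q)"
    by (intro bdd_belowI2[of _ "min (- b) 0"]) (simp add: fibre)
  then have low: "k < H (q, p)" if "p \<in> cotangent_space A q" for p
    using q(2) cINF_lower that by (meson less_le_trans)
  have lowy: "k < local_H i (x0, y)" for y
  proof -
    note w = cinv_TM[OF i(1) x0(1), of y]
    have "snd (cinv TM i (x0, y)) \<in> cotangent_space A q" using w x0(2) by (simp add: cdom_TM)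
    from low[OF this] fibre[OF this] show ?thesis using w(4) by simp
  qed
  obtain X R where XR: "open X" "x0 \<in> X" "X \<subseteq> cimage A i" "R > 0"
    "\<And>x y. x \<in> X \<Longrightarrow> norm y \<ge> R \<Longrightarrow> local_H i (x, y) > k"
    by (rule local_H_coercive_near[OF i(1) x0(1), where c = k]) (rule that)
  have "{x0} \<times> cball 0 R \<subseteq> {z \<in> cimage A i \<times> UNIV. local_H i z > k}" using lowy x0(1) by auto
  from Elementary_Topology.tube_lemma[OF compact_cball open_local_H_greater(1)[OF i(1)] this]
  obtain Y where Y: "x0 \<in> Y" "open Y" "Y \<times> cball 0 R \<subseteq> {z \<in> cimage A i \<times> UNIV. local_H i z > k}" by blast
  show ?thesis
  proof (rule that[of "{q \<in> cdom A i. cmap A i q \<in> X \<inter> Y}"])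
    show "openin MT {q \<in> cdom A i. cmap A i q \<in> X \<inter> Y}"
      by (rule openin_chart_preimage[OF i(1)]) (intro open_Int XR Y)
    show "{q \<in> cdom A i. cmap A i q \<in> X \<inter> Y} \<noteq> {}" using i(2) XR(2) Y(1) by (auto simp: x0_def)
    fix w assume w: "w \<in> points TM" "fst w \<in> {q \<in> cdom A i. cmap A i q \<in> X \<inter> Y}"
    then have "w \<in> cdom TM i" by (simp add: cdom_TM points_TM)
    from local_H_cmap[OF i(1) this] have Hw: "H w = local_H i (cmap A i (fst w), snd w i)" by simp
    show "H w > k"
    proof (cases "norm (snd w i) \<ge> R")
      case True
      then show ?thesis using XR(5) w(2) Hw by auto
    next
      case False
      then have "(cmap A i (fst w), snd w i) \<in> Y \<times> cball 0 R" using w(2) by auto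
      from subsetD[OF Y(3) this] show ?thesis using Hw by simp
    qed
  qed
qed

end

section \<open>Displacing the sublevel\<close>

text \<open>Recombines the translations by the pieces of a partition of unity into one by a multiple
  of dg.\<close>

lemma gradient_sum_mult:
  assumes "\<And>k. k \<in> S \<Longrightarrow> smooth_function A (f k)" "smooth_function A g" "i \<in> charts A" "x \<in> cimage A i"
    and "\<And>q. q \<in> points A \<Longrightarrow> (\<Sum>k\<in>S. f k q) = a * g q"
  shows "(\<Sum>k\<in>S. gradient (f k) i x) = a *\<^sub>R gradient g i x"
proof -
  have "((\<lambda>x. \<Sum>k\<in>S. f k (cinv A i x)) has_derivative (\<lambda>v. \<Sum>k\<in>S. differential (f k) i x v)) (at x)"
    by (rule has_derivative_sum) (rule differential[OF assms(1,3,4)])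
  then have 1: "((\<lambda>x. a * g (cinv A i x)) has_derivative (\<lambda>v. \<Sum>k\<in>S. differential (f k) i x v)) (at x)"
  proof (rule has_derivative_transform_within_open[OF _ open_cimage[OF assms(3)] assms(4)])
    show "(\<Sum>k\<in>S. f k (cinv A i y)) = a * g (cinv A i y)" if "y \<in> cimage A i" for y
      using cinv_in_cdom[OF assms(3) that] cdom_subset_points[OF assms(3)] by (intro assms(5)) auto
  qed
  have 2: "((\<lambda>x. a * g (cinv A i x)) has_derivative (\<lambda>v. a * differential g i x v)) (at x)"
    by (rule has_derivative_mult_right[OF differential[OF assms(2-4)]])
  have "(\<Sum>k\<in>S. differential (f k) i x v) = a * differential g i x v" for v
    using fun_cong[OF has_derivative_unique[OF 1 2]] .
  then have "(\<Sum>k\<in>S. gradient (f k) i x) \<bullet> v = (a *\<^sub>R gradient g i x) \<bullet> v" for v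
    using differential_eq_gradient[OF assms(1,3,4)] differential_eq_gradient[OF assms(2-4)]
    by (simp add: inner_sum_left)
  then show ?thesis using vector_eq_rdot by blast
qed

text \<open>Each summand is the product of 1 - b j over j < k minus that over j \<le> k, so the sum
  telescopes. The weights add up to 1 wherever some b j is 1, and nothing has to be divided.\<close>

lemma partition_of_unity_product:
  fixes b :: "nat \<Rightarrow> real"
  shows "(\<Sum>k<n. b k * (\<Prod>j<k. 1 - b j)) = 1 - (\<Prod>j<n. 1 - b j)"
  by (induction n) (simp_all add: algebra_simps)

text \<open>An atlas without points is a closed connected manifold by the definition used; there
  \<open>e0\<close> is a supremum over the empty set and k < e0 carries no information. The identity
  displaces the empty set.\<close>

lemma displaceable_empty:
  assumes "points A = {}" "S \<subseteq> points TM"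
  shows "displaceable TM (twisted_form \<sigma>) S"
proof -
  have p: "points TM = {}" using assms(1) by (auto simp: points_TM)
  then have S: "S = {}" using assms(2) by simp
  have "compactly_supported_hamiltonian TM (\<lambda>_ _. 0)"
    unfolding compactly_supported_hamiltonian_def
  proof (intro conjI ballI)
    fix i assume "i \<in> charts TM"
    then have "open ((UNIV :: real set) \<times> cimage TM i)" by (intro open_Times T.open_cimage open_UNIV)
    then show "smooth_on (UNIV \<times> cimage TM i) (\<lambda>(t :: real, x). 0 :: real)"
      unfolding case_prod_beta by (rule smooth_on_const)
  qed (auto intro: exI[of _ "{}"])
  moreover have "hamiltonian_flow TM (twisted_form \<sigma>) (\<lambda>_ _. 0) (\<lambda>t w. w)"
    by (simp add: hamiltonian_flow_def p)
  ultimately show ?thesis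
    unfolding displaceable_def hamiltonian_diffeomorphism_def using S by blast
qed

text \<open>Constants are chosen per ball l of a finite cover: \<open>R l\<close> bounds the
  sublevel over \<open>C l\<close>, \<open>L l\<close> makes the shift at least
  \<open>2 * R l\<close> off U, and \<open>P l\<close> is the radius at which the l-th piece is cut
  off. Sizes of covectors over ball l are always measured in its own chart.\<close>

lemma displaceable_sublevel:
  assumes \<sigma>: "two_form A \<sigma>" and tonelli: "tonelli A H" and k: "k < e0 A H"
  shows "displaceable TM (twisted_form \<sigma>) (sublevel A H k)"
proof (cases "points A = {}")
  case True
  then show ?thesis by (intro displaceable_empty) (auto simp: sublevel_def)
next
  case ne: False
  define S where "S = sublevel A H k"
  have S: "w \<in> S \<longleftrightarrow> w \<in> points TM \<and> H w \<le> k" for w by (simp add: S_def sublevel_def)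
  obtain U where U: "openin MT U" "U \<noteq> {}" "\<And>w. w \<in> points TM \<Longrightarrow> fst w \<in> U \<Longrightarrow> H w > k"
    by (rule energy_gap[OF tonelli ne k]) (rule that)
  obtain g where g: "smooth_function A g" "crit g \<subseteq> U"
    by (rule smooth_function_crit_subset[OF U(1,2)])
  obtain n :: nat and I c r where cov: "\<And>k. k < n \<Longrightarrow> I k \<in> charts A" "\<And>k. k < n \<Longrightarrow> 0 < r k"
    "\<And>k. k < n \<Longrightarrow> cball (c k) (3 * r k) \<subseteq> cimage A (I k)"
    "points A = (\<Union>k<n. cinv A (I k) ` ball (c k) (r k))"
    by (rule chart_cover, rule that)
  have n: "n > 0" using cov(4) ne by (cases n) auto
  define C where "C l = cball (c l) (3 * r l)" for l
  have C: "compact (C l)" for l by (simp add: C_def)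
  have Ci: "C l \<subseteq> cimage A (I l)" if "l < n" for l using cov(3)[OF that] by (simp add: C_def)

  let ?bump = "\<lambda>l b. smooth_function A b \<and> (\<forall>q\<in>cinv A (I l) ` ball (c l) (r l). b q = 1) \<and>
      (\<forall>q. q \<notin> cinv A (I l) ` C l \<longrightarrow> b q = 0)"
  have "\<forall>l\<in>{..<n}. \<exists>b. ?bump l b"
  proof
    fix l assume "l \<in> {..<n}"
    then have l: "l < n" by simp
    have "0 < 2 * r l" "2 * r l < 3 * r l" using cov(2)[OF l] by auto
    then obtain u :: "'e \<Rightarrow> real" where u: "smooth_on UNIV u" "\<And>x. 0 \<le> u x" "\<And>x. u x \<le> 1"
        "\<And>x. dist (c l) x \<le> 2 * r l \<Longrightarrow> u x = 1" "\<And>x. dist (c l) x \<ge> 3 * r l \<Longrightarrow> u x = 0"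
      by (rule smooth_bump_exists[where c = "c l"]) (rule that)
    let ?b = "\<lambda>q. if q \<in> cdom A (I l) then u (cmap A (I l) q) else 0"
    have "smooth_function A ?b"
      by (rule smooth_function_extend_compact[OF cov(1)[OF l] C Ci[OF l] smooth_on_subset[OF u(1) subset_UNIV]])
         (auto simp: C_def u(5))
    moreover have "?b q = 1" if q: "q \<in> cinv A (I l) ` ball (c l) (r l)" for q
    proof -
      obtain x where x: "x \<in> ball (c l) (r l)" "q = cinv A (I l) x" using q by blast
      have "x \<in> C l" using x(1) cov(2)[OF l] by (auto simp: C_def)
      then have "x \<in> cimage A (I l)" using Ci[OF l] by blast
      moreover have "u x = 1" using x(1) cov(2)[OF l] by (intro u(4)) auto
      ultimately show ?thesis using x(2) cinv_in_cdom[OF cov(1)[OF l]] cmap_cinv[OF cov(1)[OF l]] by simp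
    qed
    moreover have "?b q = 0" if q: "q \<notin> cinv A (I l) ` C l" for q
    proof (cases "q \<in> cdom A (I l)")
      case True
      have "cmap A (I l) q \<notin> C l"
      proof
        assume "cmap A (I l) q \<in> C l"
        then have "cinv A (I l) (cmap A (I l) q) \<in> cinv A (I l) ` C l" by (rule imageI)
        then show False using q cinv_cmap[OF cov(1)[OF l] True] by simp
      qed
      then show ?thesis using u(5) by (simp add: C_def)
    qed simp
    ultimately show "\<exists>b. ?bump l b" by blast
  qed
  from bchoice[OF this] obtain b where b': "\<forall>l\<in>{..<n}. ?bump l (b l)" by blast
  have b: "smooth_function A (b l)" "q \<in> cinv A (I l) ` ball (c l) (r l) \<Longrightarrow> b l q = 1"
    "q \<notin> cinv A (I l) ` C l \<Longrightarrow> b l q = 0" if "l < n" for l q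
    using bspec[OF b', of l] that by (simp_all only: lessThan_iff simp_thms)
  define \<rho> where "\<rho> l q = b l q * (\<Prod>j<l. 1 - b j q)" for l q
  have \<rho>: "smooth_function A (\<rho> l)" if "l < n" for l
    unfolding \<rho>_def using that
    by (intro smooth_function_mult smooth_function_prod smooth_function_diff smooth_function_const b(1)) auto
  have \<rho>1: "(\<Sum>l<n. \<rho> l q) = 1" if "q \<in> points A" for q
  proof -
    obtain l where "l < n" "q \<in> cinv A (I l) ` ball (c l) (r l)" using cov(4) \<open>q \<in> points A\<close> by auto
    then have "\<exists>j\<in>{..<n}. 1 - b j q = 0" using b(2) by auto
    then have "(\<Prod>j<n. 1 - b j q) = 0" by (intro prod_zero) auto
    then show ?thesis unfolding \<rho>_def partition_of_unity_product by simp
  qed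

  have "\<forall>l\<in>{..<n}. \<exists>R>0. \<forall>x\<in>C l. \<forall>y. norm y \<ge> R \<longrightarrow> local_H H (I l) (x, y) > k"
  proof
    fix l assume "l \<in> {..<n}"
    then have l: "l < n" by simp
    obtain R where "R > 0" "\<And>x y. x \<in> C l \<Longrightarrow> norm y \<ge> R \<Longrightarrow> local_H H (I l) (x, y) > k"
      by (rule local_H_coercive[OF tonelli cov(1)[OF l] C Ci[OF l], where c = k]) (rule that)
    then show "\<exists>R>0. \<forall>x\<in>C l. \<forall>y. norm y \<ge> R \<longrightarrow> local_H H (I l) (x, y) > k" by blast
  qed
  from bchoice[OF this] obtain R where R: "\<And>l. l < n \<Longrightarrow> R l > 0"
    "\<And>l x y. l < n \<Longrightarrow> x \<in> C l \<Longrightarrow> norm y \<ge> R l \<Longrightarrow> local_H H (I l) (x, y) > k" by auto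
  have S_bound: "norm (snd w (I l)) < R l" if l: "l < n" and w: "w \<in> S" "fst w \<in> cinv A (I l) ` C l" for l w
  proof -
    obtain x where x: "x \<in> C l" "fst w = cinv A (I l) x" using w(2) by auto
    have xi: "x \<in> cimage A (I l)" using x(1) Ci[OF l] by blast
    have "w \<in> cdom TM (I l)" using w(1) x(2) cinv_in_cdom[OF cov(1)[OF l] xi] by (simp add: S points_TM cdom_TM)
    from local_H_cmap[OF tonelli cov(1)[OF l] this]
    have "local_H H (I l) (x, snd w (I l)) = H w" using x(2) cmap_cinv[OF cov(1)[OF l] xi] by simp
    then show ?thesis using R(2)[OF l x(1), of "snd w (I l)"] w(1) by (force simp: S)
  qed

  have "\<forall>l\<in>{..<n}. \<exists>\<Lambda>>0. \<forall>x\<in>cball (c l) (r l). cinv A (I l) x \<notin> U \<longrightarrow> \<Lambda> * norm (gradient g (I l) x) \<ge> 2 * R l"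
  proof
    fix l assume "l \<in> {..<n}"
    then have l: "l < n" by simp
    note i = cov(1)[OF l]
    \<comment> \<open>The part of the closed ball outside U: compact and free of critical points, so
      the gradient has a positive lower bound \<mu> there, and 2 R / \<mu> is a sufficient
      factor.\<close>
    define D where "D = cball (c l) (r l) - cmap A (I l) ` (U \<inter> cdom A (I l))"
    have D: "compact D" unfolding D_def using U(1) i by (intro compact_diff) (auto simp: openin_iff)
    have sub: "cball (c l) (r l) \<subseteq> C l" using cov(2)[OF l] by (auto simp: C_def)
    have Di: "D \<subseteq> cimage A (I l)" using sub Ci[OF l] by (auto simp: D_def)
    have "gradient g (I l) x \<noteq> 0" if x: "x \<in> D" for x
    proof
      assume "gradient g (I l) x = 0"
      have xi: "x \<in> cimage A (I l)" using x Di by blast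
      then have "cinv A (I l) x \<in> crit g"
        using crit_iff[OF g(1) i cinv_in_cdom[OF i xi]] cmap_cinv[OF i xi] \<open>gradient g (I l) x = 0\<close> by simp
      then have "cinv A (I l) x \<in> U \<inter> cdom A (I l)" using g(2) cinv_in_cdom[OF i xi] by blast
      then have "cmap A (I l) (cinv A (I l) x) \<in> cmap A (I l) ` (U \<inter> cdom A (I l))" by (rule imageI)
      then show False using x cmap_cinv[OF i xi] by (simp add: D_def)
    qed
    moreover have "continuous_on D (\<lambda>x. norm (gradient g (I l) x))"
      by (intro continuous_on_norm continuous_on_subset[OF smooth_on_imp_continuous_on[OF smooth_on_gradient[OF g(1) i]] Di])
    ultimately have "\<exists>\<mu>>0. \<forall>x\<in>D. \<mu> \<le> norm (gradient g (I l) x)"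
    proof (cases "D = {}")
      case False
      assume cont: "continuous_on D (\<lambda>x. norm (gradient g (I l) x))" and nz: "\<And>x. x \<in> D \<Longrightarrow> gradient g (I l) x \<noteq> 0"
      obtain x where "x \<in> D" "\<forall>y\<in>D. norm (gradient g (I l) x) \<le> norm (gradient g (I l) y)"
        using continuous_attains_inf[OF D False cont] by blast
      then show ?thesis using nz by (intro exI[of _ "norm (gradient g (I l) x)"]) auto
    qed (auto intro: exI[of _ 1])
    then obtain \<mu> where \<mu>: "\<mu> > 0" "\<And>x. x \<in> D \<Longrightarrow> \<mu> \<le> norm (gradient g (I l) x)" by blast
    show "\<exists>\<Lambda>>0. \<forall>x\<in>cball (c l) (r l). cinv A (I l) x \<notin> U \<longrightarrow> \<Lambda> * norm (gradient g (I l) x) \<ge> 2 * R l"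
    proof (intro exI[of _ "2 * R l / \<mu>"] conjI ballI impI)
      show "2 * R l / \<mu> > 0" using \<mu>(1) R(1)[OF l] by simp
      fix x assume x: "x \<in> cball (c l) (r l)" "cinv A (I l) x \<notin> U"
      have "x \<notin> cmap A (I l) ` (U \<inter> cdom A (I l))" using x(2) cinv_cmap[OF i] by auto
      then have "\<mu> \<le> norm (gradient g (I l) x)" using x(1) by (intro \<mu>(2)) (simp add: D_def)
      then have "2 * R l / \<mu> * \<mu> \<le> 2 * R l / \<mu> * norm (gradient g (I l) x)"
        using \<mu>(1) R(1)[OF l] by (intro mult_left_mono) auto
      then show "2 * R l / \<mu> * norm (gradient g (I l) x) \<ge> 2 * R l" using \<mu>(1) by simp
    qed
  qed
  from bchoice[OF this] obtain L where L': "\<forall>l\<in>{..<n}. L l > 0 \<and>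
    (\<forall>x\<in>cball (c l) (r l). cinv A (I l) x \<notin> U \<longrightarrow> L l * norm (gradient g (I l) x) \<ge> 2 * R l)" by blast
  have L: "L l > 0"
    "x \<in> cball (c l) (r l) \<Longrightarrow> cinv A (I l) x \<notin> U \<Longrightarrow> L l * norm (gradient g (I l) x) \<ge> 2 * R l" if "l < n" for l x
    using bspec[OF L', of l] that by (simp_all only: lessThan_iff simp_thms)
  \<comment> \<open>One factor for all charts; a sum of positive numbers dominates each of
    them.\<close>
  define \<Lambda> where "\<Lambda> = (\<Sum>l<n. L l)"
  have \<Lambda>: "L l \<le> \<Lambda>" if "l < n" for l
    unfolding \<Lambda>_def using that L(1) by (intro member_le_sum) (auto intro: less_imp_le)

  \<comment> \<open>The factor sits outside the partition weight, so the pieces sum to \<Lambda> g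
    although the derivatives of the weights are uncontrolled.\<close>
  define gs where "gs l q = \<Lambda> * (\<rho> l q * g q)" for l q
  have gs: "smooth_function A (gs l)" if "l < n" for l
    unfolding gs_def by (intro smooth_function_mult smooth_function_const \<rho>[OF that] g(1))
  have gs0: "gs l q = 0" if "l < n" "q \<notin> cinv A (I l) ` C l" for l q
    using b(3)[OF that] by (simp add: gs_def \<rho>_def)
  have gs_sum: "(\<Sum>l<n. gs l q) = \<Lambda> * g q" if "q \<in> points A" for q
    using \<rho>1[OF that] by (simp add: gs_def sum_distrib_left[symmetric] sum_distrib_right[symmetric])

  have "\<exists>B. \<forall>x\<in>C l. norm (gradient (gs m) (I l) x) \<le> B" if "l < n" "m < n" for l m
  proof -
    have "continuous_on (C l) (gradient (gs m) (I l))"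
      by (rule continuous_on_subset[OF smooth_on_imp_continuous_on[OF smooth_on_gradient[OF gs[OF that(2)] cov(1)[OF that(1)]]] Ci[OF that(1)]])
    then have "bounded (gradient (gs m) (I l) ` C l)"
      by (intro compact_imp_bounded compact_continuous_image C)
    then show ?thesis unfolding bounded_iff by auto
  qed
  then have "\<forall>l m. \<exists>B. l < n \<longrightarrow> m < n \<longrightarrow> (\<forall>x\<in>C l. norm (gradient (gs m) (I l) x) \<le> B)" by blast
  then obtain B where B: "\<And>l m x. l < n \<Longrightarrow> m < n \<Longrightarrow> x \<in> C l \<Longrightarrow> norm (gradient (gs m) (I l) x) \<le> B l m"
    by metis
  \<comment> \<open>Start of the curve plus all shifts, each counted in full: a curve from the
    sublevel never reaches the cut-off. Every piece m can move covectors over ball l, hence the sum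
    over all m. The absolute values spare a discussion of the sign of B.\<close>
  define P where "P l = R l + (\<Sum>m<n. \<bar>B l m\<bar>)" for l
  have P: "P l > 0" if "l < n" for l unfolding P_def by (rule add_pos_nonneg[OF R(1)[OF that]]) (simp add: sum_nonneg)

  let ?cut = "\<lambda>l G K. smooth_function TM G \<and> compact K \<and> K \<subseteq> cimage TM (I l) \<and>
    (\<forall>w\<in>points TM. w \<notin> cinv TM (I l) ` K \<longrightarrow> G w = 0) \<and>
    (\<forall>w\<in>points TM. (fst w \<in> cinv A (I l) ` C l \<longrightarrow> norm (snd w (I l)) < P l) \<longrightarrow>
       (\<exists>V. openin T.MT V \<and> w \<in> V \<and> (\<forall>w'\<in>V. G w' = gs l (fst w'))))"
  have "\<forall>l\<in>{..<n}. \<exists>G K. ?cut l G K"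
  proof
    fix l assume "l \<in> {..<n}"
    then have l: "l < n" by simp
    obtain G K where "smooth_function TM G" "compact K" "K \<subseteq> cimage TM (I l)"
      "\<And>w. w \<in> points TM \<Longrightarrow> w \<notin> cinv TM (I l) ` K \<Longrightarrow> G w = 0"
      "\<And>w. w \<in> points TM \<Longrightarrow> (fst w \<in> cinv A (I l) ` C l \<longrightarrow> norm (snd w (I l)) < P l) \<Longrightarrow>
         \<exists>V. openin T.MT V \<and> w \<in> V \<and> (\<forall>w'\<in>V. G w' = gs l (fst w'))"
      by (rule fibre_cutoff[OF gs[OF l] cov(1)[OF l] C Ci[OF l] gs0[OF l] P[OF l]]) (assumption, rule that)
    then show "\<exists>G K. ?cut l G K" by blast
  qed
  from bchoice[OF this] obtain G where "\<forall>l\<in>{..<n}. \<exists>K. ?cut l (G l) K" by blast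
  from bchoice[OF this] obtain K where GK: "\<forall>l\<in>{..<n}. ?cut l (G l) (K l)" by blast
  note GK' = bspec[OF GK, OF lessThan_iff[THEN iffD2]]
  note G = GK'[THEN conjunct1]
  note K = GK'[THEN conjunct2, THEN conjunct1] GK'[THEN conjunct2, THEN conjunct2, THEN conjunct1]
    GK'[THEN conjunct2, THEN conjunct2, THEN conjunct2, THEN conjunct1, rule_format]
  note G_eq = GK'[THEN conjunct2, THEN conjunct2, THEN conjunct2, THEN conjunct2, THEN bspec, THEN mp]
  define F where "F t w = (\<Sum>l<n. step_rate n l t * G l w)" for t w
  have F: "compactly_supported_hamiltonian TM F"
    unfolding F_def[abs_def] by (rule compactly_supported_stepwise[OF cov(1) G K])

  define e where "e w t = (fst w, \<lambda>i. snd w i - (\<Sum>l<n. step_clock n l t *\<^sub>R covector (gs l) (fst w) i))" for w t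
  have e: "integral_curve \<sigma> F (e w) \<and> e w 0 = w" if w: "w \<in> S" for w
  proof
    have wp: "w \<in> points TM" using w by (simp add: S)
    have ep: "e w t \<in> points TM" for t
      using cotangent_space_diff_sum[OF _ covector_in_cotangent_space[OF gs], of "snd w" "fst w" "{..<n}" "\<lambda>l. l"] wp
      by (simp add: e_def points_TM)
    show "integral_curve \<sigma> F (e w)"
      unfolding F_def[abs_def]
    proof (rule fibre_translation_integral_curve[OF \<sigma> n gs wp e_def])
      fix l t assume l: "l < n"
      show "\<exists>V. openin T.MT V \<and> e w t \<in> V \<and> (\<forall>w'\<in>V. G l w' = gs l (fst w'))"
      proof (rule G_eq[OF l ep], rule impI)
        assume "fst (e w t) \<in> cinv A (I l) ` C l"
        then have q: "fst w \<in> cinv A (I l) ` C l" by (simp add: e_def)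
        then obtain x where x: "x \<in> C l" "fst w = cinv A (I l) x" by auto
        have xi: "x \<in> cimage A (I l)" using x(1) Ci[OF l] by blast
        have cv: "norm (step_clock n m t *\<^sub>R covector (gs m) (fst w) (I l)) \<le> \<bar>B l m\<bar>" if m: "m < n" for m
        proof -
          have "norm (covector (gs m) (fst w) (I l)) \<le> \<bar>B l m\<bar>"
            using order_trans[OF B[OF l m x(1)] abs_ge_self] x(2) cmap_cinv[OF cov(1)[OF l] xi]
            by (simp add: covector_def)
          \<comment> \<open>At intermediate times a clock value in [0, 1] only shortens the
            shift.\<close>
          moreover have "norm (step_clock n m t *\<^sub>R covector (gs m) (fst w) (I l)) \<le> norm (covector (gs m) (fst w) (I l))"
            using step_clock_in[of n m t] by (simp add: mult_left_le_one_le)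
          ultimately show ?thesis by linarith
        qed
        have "norm (snd (e w t) (I l)) \<le> norm (snd w (I l)) + norm (\<Sum>m<n. step_clock n m t *\<^sub>R covector (gs m) (fst w) (I l))"
          by (simp add: e_def norm_triangle_ineq4)
        also have "norm (\<Sum>m<n. step_clock n m t *\<^sub>R covector (gs m) (fst w) (I l)) \<le> (\<Sum>m<n. \<bar>B l m\<bar>)"
          by (rule sum_norm_le) (simp add: cv del: norm_scaleR)
        finally show "norm (snd (e w t) (I l)) < P l"
          using S_bound[OF l w q] by (simp add: P_def)
      qed
    qed
    show "e w 0 = w" by (simp add: e_def step_clock_eq_0)
  qed
  have ex: "\<exists>c. integral_curve \<sigma> F c \<and> c 0 = w" if "w \<in> points TM" for w
    unfolding F_def[abs_def] by (rule stepwise_integral_curve[OF \<sigma> n cov(1) G K that])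
  obtain \<Phi> where \<Phi>: "hamiltonian_flow TM (twisted_form \<sigma>) F \<Phi>" "\<And>w t. w \<in> S \<Longrightarrow> \<Phi> t w = e w t"
    by (rule hamiltonian_flow_of_curves[OF ex e]) (assumption, assumption, rule that)
  have "\<Phi> 1 w \<notin> S" if w: "w \<in> S" for w
  proof
    assume "\<Phi> 1 w \<in> S"
    then have eS: "e w 1 \<in> S" using \<Phi>(2)[OF w] by simp
    \<comment> \<open>Over U the energy exceeds k, so a point of the sublevel projects outside U,
      where dg is large.\<close>
    have q: "fst w \<in> points A" "fst w \<notin> U" using w U(3)[of w] by (force simp: S points_TM)+
    obtain l where l: "l < n" "fst w \<in> cinv A (I l) ` ball (c l) (r l)" using q(1) cov(4) by auto
    obtain x where x: "x \<in> ball (c l) (r l)" "fst w = cinv A (I l) x" using l(2) by auto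
    have xC: "x \<in> C l" using x(1) cov(2)[OF l(1)] by (auto simp: C_def)
    then have xi: "x \<in> cimage A (I l)" using Ci[OF l(1)] by blast
    have qC: "fst w \<in> cinv A (I l) ` C l" using xC x(2) by blast
    \<comment> \<open>The last step ends at (n - 1/3) / n, so at time 1 every shift has been carried
      out in full.\<close>
    have "step_clock n m 1 = 1" if "m < n" for m
    proof (rule step_clock_eq_1)
      have "real m + 1 \<le> real n" using that by linarith
      then show "2/3 \<le> real n * 1 - real m" by simp
    qed
    then have "snd (e w 1) (I l) = snd w (I l) - (\<Sum>m<n. covector (gs m) (fst w) (I l))"
      by (simp add: e_def)
    also have "(\<Sum>m<n. covector (gs m) (fst w) (I l)) = (\<Sum>m<n. gradient (gs m) (I l) x)"
      using x(2) cmap_cinv[OF cov(1)[OF l(1)] xi] cinv_in_cdom[OF cov(1)[OF l(1)] xi] cov(1)[OF l(1)]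
      by (simp add: covector_def)
    also have "\<dots> = \<Lambda> *\<^sub>R gradient g (I l) x"
      by (rule gradient_sum_mult[OF gs g(1) cov(1)[OF l(1)] xi gs_sum]) auto
    finally have eq: "\<Lambda> *\<^sub>R gradient g (I l) x = snd w (I l) - snd (e w 1) (I l)" by simp
    \<comment> \<open>Start and end lie over the same base point and in the sublevel, so both have
      coordinates shorter than \<open>R l\<close> in the same chart; their difference is too short
      to be \<Lambda> dg.\<close>
    have "norm (snd w (I l)) < R l" by (rule S_bound[OF l(1) w qC])
    moreover have "norm (snd (e w 1) (I l)) < R l"
      by (rule S_bound[OF l(1) eS]) (use qC in \<open>simp add: e_def\<close>)
    ultimately have "norm (\<Lambda> *\<^sub>R gradient g (I l) x) < 2 * R l"
      unfolding eq using norm_triangle_ineq4[of "snd w (I l)" "snd (e w 1) (I l)"] by linarith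
    moreover have "2 * R l \<le> norm (\<Lambda> *\<^sub>R gradient g (I l) x)"
    proof -
      have "2 * R l \<le> L l * norm (gradient g (I l) x)"
        using x q(2) by (intro L(2)[OF l(1)]) auto
      also have "\<dots> \<le> \<Lambda> * norm (gradient g (I l) x)" by (intro mult_right_mono \<Lambda> l(1)) simp
      also have "\<dots> = norm (\<Lambda> *\<^sub>R gradient g (I l) x)" using \<Lambda>[OF l(1)] L(1)[OF l(1)] by simp
      finally show ?thesis .
    qed
    ultimately show False by linarith
  qed
  then have "\<Phi> 1 ` S \<inter> S = {}" by blast
  moreover have "hamiltonian_diffeomorphism TM (twisted_form \<sigma>) (\<Phi> 1)"
    unfolding hamiltonian_diffeomorphism_def using F \<Phi>(1) by blast
  ultimately show ?thesis unfolding displaceable_def S_def by blast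
qed

end

theorem theorem1p4:
  fixes M :: "('i, 'a, 'e::euclidean_space) atlas"
    and \<sigma> :: "('i, 'e) form2"
    and H :: "'a \<times> ('i \<Rightarrow> 'e) \<Rightarrow> real"
    and k :: real
  assumes "closed_connected_manifold M"
    and "closed_two_form M \<sigma>"
    and "tonelli M H"
    and "min_energy M H \<le> k" and "k < e0 M H"
  shows "displaceable (cotangent_bundle M) (twisted_form \<sigma>) (sublevel M H k)"
proof -
  interpret closed_manifold M
    using assms(1) by unfold_locales (auto simp: closed_connected_manifold_def smooth_manifold_def)
  show ?thesis
    using assms(2,3,5) by (intro displaceable_sublevel) (auto simp: closed_two_form_def)
qed

end
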